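(* Let $d\ge1$ be an integer, $1<\alpha<2$, $b\in\mathbb{R}^d$, $M>0$, and put $\widetilde q=1+\frac{\alpha-1}{d}$, $q^*=1+\frac1{\alpha+d}$. Assume $\widetilde q>q^*$. Let $u_M=u_M(x,t)$ be a self-similar solution of $$\partial_t u+(-\Delta)^{\alpha/2}u+b\cdot\nabla\bigl(u|u|^{(\alpha-1)/d}\bigr)=0\quad(x\in\mathbb{R}^d,\ t>0),\qquad u(x,0)=M\delta_0,$$ satisfying, for some constant $C>0$, the estimate $$0\le u_M(x,t)\le C\,p_\alpha(x,t)\qquad\text{for all }x\in\mathbb{R}^d\text{ and }t>0.$$ Then the self-similar profile $U_M(x)=u_M(x,1)$ satisfies, as $|x|\to\infty$, $$U_M(x)=M P_\alpha(x)+\frac{c_1\alpha^2}{\alpha+1}\,\|U_M\|_{\widetilde q}^{\widetilde q}\,\frac{b\cdot x}{|x|^{\alpha+d+2}}+O\Bigl(\max\bigl\{|x|^{-\widetilde q(\alpha+d)};\,|x|^{-(\alpha+d+2)}\bigr\}\Bigr).$$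
   Context: $p_\alpha(x,t)$ is the fundamental solution of $\partial_t v+(-\Delta)^{\alpha/2}v=0$ on $\mathbb{R}^d$, determined by $\widehat{p_\alpha}(\xi,t)=e^{-t|\xi|^\alpha}$; thus $p_\alpha(x,t)=t^{-d/\alpha}P_\alpha(xt^{-1/\alpha})$, where $P_\alpha$ is the inverse Fourier transform of $e^{-|\xi|^\alpha}$ (so $\int P_\alpha=1$). $S_\alpha(t)v_0=p_\alpha(\cdot,t)*v_0$. $\|\cdot\|_p$ is the $L^p(\mathbb{R}^d)$ norm, and $\delta_0$ is the Dirac delta at the origin. Constant: $$c_1=2\pi\alpha2^{\alpha-1}\pi^{-(d+4)/2}\sin(\alpha\pi/2)\,\Gamma\Bigl(\frac{\alpha+d+2}{2}\Bigr)\Gamma\Bigl(\frac{\alpha}{2}\Bigr);$$ it is the constant for which $\nabla P_\alpha(x)=-c_1x|x|^{-(\alpha+d+2)}+O(|x|^{-(2\alpha+d+1)})$ as $|x|\to\infty$. Self-similar solution: a solution $u_M$ with the scaling $u_M(x,t)=t^{-d/\alpha}U_M(xt^{-1/\alpha})$ for all $x\in\mathbb{R}^d$, $t>0$, where $U_M(x)=u_M(x,1)$. Solutions are understood in the sense of the Duhamel formula $u_M(t)=M p_\alpha(\cdot,t)-\int_0^t\nabla S_\alpha(t-s)\cdot\bigl(b\,u_M|u_M|^{(\alpha-1)/d}\bigr)(s)\,ds$ for $t>0$. *)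

theory Defs
  imports "HOL-Analysis.Analysis" "HOL-Library.Landau_Symbols"
begin

text \<open>
  The space \<open>\<real>\<^sup>d\<close> is an arbitrary Euclidean space \<open>'a\<close> with \<open>d = DIM('a)\<close>; a function of
  \<open>x\<close> and \<open>t\<close> has type \<open>'a \<Rightarrow> real \<Rightarrow> real\<close>, and only its values for \<open>t > 0\<close> matter.
\<close>

text \<open>The convention is \<open>\<integral> exp (- i x \<bullet> \<xi>) f x dx\<close> for the Fourier transform, whose value at
  \<open>\<xi> = 0\<close> is the integral of \<open>f\<close>.\<close>

definition inverse_fourier :: "('a::euclidean_space \<Rightarrow> complex) \<Rightarrow> 'a \<Rightarrow> complex" where
  "inverse_fourier f x =
     (1 / (2 * pi) ^ DIM('a)) *\<^sub>R (LINT \<xi>|lborel. exp (\<i> * complex_of_real (x \<bullet> \<xi>)) * f \<xi>)"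

text \<open>The two inverse transforms below are real valued, so taking the real part is only a
  change of type.\<close>

definition heat_profile :: "real \<Rightarrow> 'a::euclidean_space \<Rightarrow> real" where
  "heat_profile \<alpha> x =
     Re (inverse_fourier (\<lambda>\<xi>. complex_of_real (exp (- (norm \<xi> powr \<alpha>)))) x)"

definition heat_kernel :: "real \<Rightarrow> 'a::euclidean_space \<Rightarrow> real \<Rightarrow> real" where
  "heat_kernel \<alpha> x t =
     Re (inverse_fourier (\<lambda>\<xi>. complex_of_real (exp (- t * norm \<xi> powr \<alpha>))) x)"

text \<open>The semigroup acts on scalar and on vector valued functions (componentwise).\<close>

definition heat_semigroup ::
    "real \<Rightarrow> real \<Rightarrow> ('a::euclidean_space \<Rightarrow> 'b::euclidean_space) \<Rightarrow> 'a \<Rightarrow> 'b" where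
  "heat_semigroup \<alpha> t v x = (LINT y|lborel. heat_kernel \<alpha> (x - y) t *\<^sub>R v y)"

definition divergence :: "('a::euclidean_space \<Rightarrow> 'a) \<Rightarrow> 'a \<Rightarrow> real" where
  "divergence F x = (\<Sum>i\<in>Basis. frechet_derivative F (at x) i \<bullet> i)"

definition flux :: "real \<Rightarrow> 'a::euclidean_space \<Rightarrow> ('a \<Rightarrow> real) \<Rightarrow> 'a \<Rightarrow> 'a" where
  "flux \<alpha> b v y = (v y * \<bar>v y\<bar> powr ((\<alpha> - 1) / DIM('a))) *\<^sub>R b"

text \<open>
  The Duhamel formula for the initial datum \<open>M \<delta>\<^sub>0\<close>, which enters through
  \<open>S\<^sub>\<alpha>(t) (M \<delta>\<^sub>0) = M p\<^sub>\<alpha>(\<cdot>, t)\<close>. Integrals and derivatives being total functions in HOL, the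
  first three clauses say that the expressions occurring in the formula are meaningful.
\<close>

definition duhamel_solution ::
    "real \<Rightarrow> 'a::euclidean_space \<Rightarrow> real \<Rightarrow> ('a \<Rightarrow> real \<Rightarrow> real) \<Rightarrow> bool" where
  "duhamel_solution \<alpha> b M u \<longleftrightarrow>
     (\<forall>t>0. \<forall>x.
        (\<forall>s\<in>{0<..<t}. integrable lborel
            (\<lambda>y. heat_kernel \<alpha> (x - y) (t - s) *\<^sub>R flux \<alpha> b (\<lambda>z. u z s) y)) \<and>
        (\<forall>s\<in>{0<..<t}. heat_semigroup \<alpha> (t - s) (flux \<alpha> b (\<lambda>z. u z s)) differentiable (at x)) \<and>
        set_integrable lborel {0<..<t}
            (\<lambda>s. divergence (heat_semigroup \<alpha> (t - s) (flux \<alpha> b (\<lambda>z. u z s))) x) \<and>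
        u x t = M * heat_kernel \<alpha> x t
          - (LINT s:{0<..<t}|lborel.
               divergence (heat_semigroup \<alpha> (t - s) (flux \<alpha> b (\<lambda>z. u z s))) x))"

definition profile :: "('a \<Rightarrow> real \<Rightarrow> real) \<Rightarrow> 'a \<Rightarrow> real" where
  "profile u x = u x 1"

definition self_similar :: "real \<Rightarrow> ('a::euclidean_space \<Rightarrow> real \<Rightarrow> real) \<Rightarrow> bool" where
  "self_similar \<alpha> u \<longleftrightarrow>
     (\<forall>x. \<forall>t>0. u x t = t powr (- (DIM('a) / \<alpha>)) * profile u (t powr (- (1 / \<alpha>)) *\<^sub>R x))"

definition Lp_norm :: "real \<Rightarrow> ('a::euclidean_space \<Rightarrow> real) \<Rightarrow> real" where
  "Lp_norm q f = (LINT x|lborel. \<bar>f x\<bar> powr q) powr (1 / q)"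

definition q_tilde :: "real \<Rightarrow> nat \<Rightarrow> real" where
  "q_tilde \<alpha> d = 1 + (\<alpha> - 1) / d"

definition q_star :: "real \<Rightarrow> nat \<Rightarrow> real" where
  "q_star \<alpha> d = 1 + 1 / (\<alpha> + d)"

definition c1 :: "real \<Rightarrow> nat \<Rightarrow> real" where
  "c1 \<alpha> d = 2 * pi * \<alpha> * 2 powr (\<alpha> - 1) * pi powr (- ((d + 4) / 2)) * sin (\<alpha> * pi / 2)
              * Gamma ((\<alpha> + d + 2) / 2) * Gamma (\<alpha> / 2)"

end

theory Submission
  imports Defs "HOL-Complex_Analysis.Complex_Analysis" "HOL-Probability.Probability"
      "HOL-Real_Asymp.Real_Asymp"
begin

text \<open>
  Write \<open>a = \<alpha> / 2\<close>, \<open>d\<close> for the dimension, \<open>q = q_tilde \<alpha> d\<close> and \<open>p\<close> for the heat kernel.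

  At time one the Duhamel formula says that \<open>M p(\<cdot>, 1) - U\<close> is the integral over \<open>0 < s < 1\<close> of
  the convolution of \<open>b \<cdot> \<nabla>p(\<cdot>, 1 - s)\<close> with \<open>w\<^sub>s = u(\<cdot>, s)\<^sup>q\<close>. Because \<open>u \<le> C p\<close> and \<open>\<alpha> > 1\<close>, the
  weight \<open>w\<^sub>s\<close> has a finite first moment, and its tail is at most of the order \<open>|y|\<close> to the power
  \<open>- q (\<alpha> + d)\<close>. Far away from the origin it therefore acts like a point mass: replacing
  \<open>\<nabla>p(x - y, 1 - s)\<close> by \<open>\<nabla>p(x, 1 - s)\<close> costs one derivative times one moment, that is \<open>|x|\<close> to the
  power \<open>- (\<alpha> + d + 2)\<close>, and the points \<open>y\<close> with \<open>|y| \<ge> |x| / 2\<close> contribute at most the size of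
  the tail of \<open>w\<^sub>s\<close> times the \<open>L\<^sup>1\<close> norm of the gradient, which is integrable in \<open>s\<close> because
  \<open>\<alpha> > 1\<close> (lemma \<open>convolution_expansion\<close>). The mass of \<open>w\<^sub>s\<close> is, by self-similarity, a multiple of
  \<open>s\<close> to the power \<open>- (\<alpha> - 1) / \<alpha>\<close>, the leading term of \<open>\<nabla>p(x, 1 - s)\<close> is proportional to \<open>1 - s\<close>,
  and the Beta integral of the product over \<open>0 < s < 1\<close> is \<open>\<alpha>\<^sup>2 / (\<alpha> + 1)\<close> (lemma
  \<open>profile_expansion\<close>).

  It remains to know the kernel well: its decay, the tail of its gradient with a rate, its second
  derivatives, its first moment and the \<open>L\<^sup>1\<close> norm of its gradient. All of this follows from
  subordination. There is a function \<open>\<eta>\<close> on the half line with Laplace transform \<open>exp (- \<mu>\<^sup>a)\<close>, so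
  by the Fourier transform of Gaussians \<open>p(x, t)\<close> is the \<open>\<eta>\<close>-mixture of the Gaussians of variance
  proportional to \<open>\<theta> \<tau>\<close>, where \<open>\<theta>\<^sup>a = t\<close> (lemma \<open>heat_kernel_eq_mixture\<close>). Differentiating a
  Gaussian mixture in \<open>x\<close> multiplies it by \<open>- 2 \<pi> x\<close> and raises the dimension parameter by two
  (\<open>N_has_derivative\<close>), so all derivatives are controlled by two facts about one function of one
  variable: \<open>\<eta> \<tau>\<close> is \<open>O(\<tau>\<^sup>-\<^sup>s)\<close> on the whole half line for every \<open>s \<le> 1 + a\<close> (\<open>\<eta>_bound\<close>), and it
  equals \<open>a / \<Gamma>(1 - a)\<close> times \<open>\<tau>\<close> to the power \<open>- 1 - a\<close> up to an error of order \<open>- 1 - 2 a\<close>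
  (\<open>\<eta>_asymp\<close>).

  The function \<open>\<eta>\<close> is obtained by Laplace inversion, as an integral of \<open>exp (\<tau> z - z\<^sup>a)\<close> over a
  vertical line. Its two properties come from moving the line to real part \<open>1 / \<tau>\<close>, where
  \<open>exp (\<tau> z)\<close> has constant modulus and scaling fixes all powers of \<open>\<tau>\<close>, and from integrating by
  parts until the integrals converge absolutely. The constant is not computed on the line; it is
  forced by the behaviour of the Laplace transform near the origin.
\<close>

section \<open>Integrals along vertical lines\<close>

lemma integral_derivative_whole_line:
  fixes F F' :: "real \<Rightarrow> complex"
  assumes "\<And>x. (F has_vector_derivative F' x) (at x)" "continuous_on UNIV F'" "integrable lborel F'"
    and "(F \<longlongrightarrow> 0) at_top" "(F \<longlongrightarrow> 0) at_bot"
  shows "(LINT x|lborel. F' x) = 0"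
proof -
  have "(LBINT x=-\<infinity>..\<infinity>. F' x) = 0 - 0"
    using assms
    by (intro interval_integral_FTC_integrable[where F=F])
       (auto simp: ereal_tendsto_simps continuous_on_eq_continuous_at set_integrable_def)
  then show ?thesis
    by (simp add: interval_lebesgue_integral_def set_lebesgue_integral_def)
qed

lemma truncated_integral_tendsto:
  fixes F :: "real \<Rightarrow> complex"
  assumes "integrable lborel F"
  shows "(\<lambda>n. integral {- real n..real n} F) \<longlonglongrightarrow> (LINT y|lborel. F y)"
proof -
  have eq: "integral {- real n..real n} F = (LINT y|lborel. indicator {- real n..real n} y *\<^sub>R F y)" for n
  proof -
    have "set_integrable lborel {- real n..real n} F"
      using assms by (rule integrable_mult_indicator[of "{- real n..real n}" lborel F, folded
          set_integrable_def, rotated]) auto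
    from set_borel_integral_eq_integral(2)[OF this] show ?thesis
      by (simp add: set_lebesgue_integral_def)
  qed
  show ?thesis unfolding eq
  proof (rule integral_dominated_convergence[where w="\<lambda>y. norm (F y)"])
    show "AE y in lborel. (\<lambda>n. indicator {- real n..real n} y *\<^sub>R F y) \<longlonglongrightarrow> F y"
    proof (rule AE_I2, rule tendsto_eventually)
      fix y :: real
      have "eventually (\<lambda>n. real n \<ge> \<bar>y\<bar>) sequentially"
        using filterlim_real_sequentially by (simp add: filterlim_at_top)
      then show "\<forall>\<^sub>F n in sequentially. indicator {- real n..real n} y *\<^sub>R F y = F y"
        by eventually_elim (auto simp: indicator_def)
    qed
  qed (use assms in \<open>auto simp: indicator_def\<close>)
qed

text \<open>
  The two horizontal sides are estimated by the supremum on them, so a contour integral over the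
  rectangle is, up to that error, the difference of the integrals over its vertical sides.
\<close>

lemma rectangle_integral_estimate:
  fixes F :: "complex \<Rightarrow> complex"
  assumes "\<sigma>\<^sub>1 < \<sigma>\<^sub>2" "0 < R" "0 \<le> B"
    and cont: "continuous_on (path_image (rectpath (Complex \<sigma>\<^sub>1 (-R)) (Complex \<sigma>\<^sub>2 R))) F"
    and I: "(F has_contour_integral I) (rectpath (Complex \<sigma>\<^sub>1 (-R)) (Complex \<sigma>\<^sub>2 R))"
    and B: "\<And>z. \<lbrakk>\<sigma>\<^sub>1 \<le> Re z; Re z \<le> \<sigma>\<^sub>2; \<bar>Im z\<bar> = R\<rbrakk> \<Longrightarrow> norm (F z) \<le> B"
  shows "norm (I - \<i> * (integral {-R..R} (\<lambda>y. F (Complex \<sigma>\<^sub>2 y))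
      - integral {-R..R} (\<lambda>y. F (Complex \<sigma>\<^sub>1 y))))
           \<le> 2 * B * (\<sigma>\<^sub>2 - \<sigma>\<^sub>1)"
proof -
  define a1 a2 a3 a4 where "a1 = Complex \<sigma>\<^sub>1 (-R)" and "a2 = Complex \<sigma>\<^sub>2 (-R)"
    and "a3 = Complex \<sigma>\<^sub>2 R" and "a4 = Complex \<sigma>\<^sub>1 R"
  note adef = a1_def a2_def a3_def a4_def
  have rp: "rectpath a1 a3 = linepath a1 a2 +++ linepath a2 a3 +++ linepath a3 a4 +++ linepath a4 a1"
    by (simp add: rectpath_def Let_def adef)
  have pim: "path_image (rectpath a1 a3) = closed_segment a1 a2 \<union> closed_segment a2 a3 \<union> closed_segment
      a3 a4 \<union> closed_segment a4 a1"
    by (auto simp: rp path_image_join)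
  have c: "continuous_on (closed_segment a1 a2) F" "continuous_on (closed_segment a2 a3) F"
     "continuous_on (closed_segment a3 a4) F" "continuous_on (closed_segment a4 a1) F"
    using cont unfolding a1_def[symmetric] a3_def[symmetric] pim
    by (auto intro: continuous_on_subset)
  have ci: "F contour_integrable_on linepath a1 a2" "F contour_integrable_on linepath a2 a3"
    "F contour_integrable_on linepath a3 a4" "F contour_integrable_on linepath a4 a1"
    using c by (auto intro: contour_integrable_continuous_linepath)
  have h: "(F has_contour_integral (contour_integral (linepath a1 a2) F
      + (contour_integral (linepath a2 a3) F
      + (contour_integral (linepath a3 a4) F + contour_integral (linepath a4 a1) F)))) (rectpath a1 a3)"
    unfolding rp by (intro has_contour_integral_join has_contour_integral_integral ci valid_path_join) auto
  have Ieq: "I = contour_integral (linepath a1 a2) F + (contour_integral (linepath a2 a3) F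
      + (contour_integral (linepath a3 a4) F + contour_integral (linepath a4 a1) F))"
    using has_contour_integral_unique[OF _ h] I by (simp add: adef)
  have v2: "contour_integral (linepath a2 a3) F = \<i> * integral {-R..R} (\<lambda>y. F (Complex \<sigma>\<^sub>2 y))"
    by (rule contour_integral_linepath_same_Re) (use assms in \<open>auto simp: adef\<close>)
  have "contour_integral (linepath a1 a4) F = \<i> * integral {-R..R} (\<lambda>y. F (Complex \<sigma>\<^sub>1 y))"
    by (rule contour_integral_linepath_same_Re) (use assms in \<open>auto simp: adef\<close>)
  then have v4: "contour_integral (linepath a4 a1) F = - (\<i> * integral {-R..R} (\<lambda>y. F (Complex \<sigma>\<^sub>1 y)))"
    using contour_integral_reverse_linepath[OF c(4)] by simp
  have seg1: "\<sigma>\<^sub>1 \<le> Re z \<and> Re z \<le> \<sigma>\<^sub>2 \<and> \<bar>Im z\<bar> = R" if "z \<in> closed_segment a1 a2" for z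
    using that assms(1,2) closed_segment_same_Im[of a1 a2] by (auto simp: adef closed_segment_eq_real_ivl)
  have seg3: "\<sigma>\<^sub>1 \<le> Re z \<and> Re z \<le> \<sigma>\<^sub>2 \<and> \<bar>Im z\<bar> = R" if "z \<in> closed_segment a3 a4" for z
    using that assms(1,2) closed_segment_same_Im[of a3 a4] by (auto simp: adef closed_segment_eq_real_ivl)
  have n: "norm (a2 - a1) = \<sigma>\<^sub>2 - \<sigma>\<^sub>1" "norm (a4 - a3) = \<sigma>\<^sub>2 - \<sigma>\<^sub>1"
    using assms(1) by (auto simp: adef complex_norm cmod_def)
  have b1: "norm (contour_integral (linepath a1 a2) F) \<le> B * (\<sigma>\<^sub>2 - \<sigma>\<^sub>1)"
    using has_contour_integral_bound_linepath[OF has_contour_integral_integral[OF ci(1)] assms(3)] B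
        seg1 n by auto
  have b3: "norm (contour_integral (linepath a3 a4) F) \<le> B * (\<sigma>\<^sub>2 - \<sigma>\<^sub>1)"
    using has_contour_integral_bound_linepath[OF has_contour_integral_integral[OF ci(3)] assms(3)] B
        seg3 n by auto
  have "I - \<i> * (integral {-R..R} (\<lambda>y. F (Complex \<sigma>\<^sub>2 y)) - integral {-R..R} (\<lambda>y. F (Complex \<sigma>\<^sub>1 y)))
     = contour_integral (linepath a1 a2) F + contour_integral (linepath a3 a4) F"
    unfolding Ieq v2 v4 by (simp add: algebra_simps)
  also have "norm \<dots> \<le> 2 * B * (\<sigma>\<^sub>2 - \<sigma>\<^sub>1)"
    using norm_triangle_ineq[of "contour_integral (linepath a1 a2) F" "contour_integral (linepath a3 a4)
        F"] b1 b3
    by (simp add: algebra_simps)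
  finally show ?thesis .
qed

text \<open>
  Cauchy's theorem on rectangles whose height tends to infinity: the decay of the bound \<open>B\<close>
  removes the horizontal sides.
\<close>

lemma vertical_line_integral_shift:
  fixes F :: "complex \<Rightarrow> complex"
  assumes "0 < \<sigma>\<^sub>1" "\<sigma>\<^sub>1 < \<sigma>\<^sub>2" and hol: "F holomorphic_on {z. Re z > 0}"
    and int: "integrable lborel (\<lambda>y. F (Complex \<sigma>\<^sub>1 y))" "integrable lborel (\<lambda>y. F (Complex \<sigma>\<^sub>2 y))"
    and B: "\<And>z. \<lbrakk>\<sigma>\<^sub>1 \<le> Re z; Re z \<le> \<sigma>\<^sub>2; 1 \<le> \<bar>Im z\<bar>\<rbrakk> \<Longrightarrow> norm (F z) \<le> B \<bar>Im z\<bar>"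
    and lim: "(\<lambda>n. B (real n)) \<longlonglongrightarrow> 0"
  shows "(LINT y|lborel. F (Complex \<sigma>\<^sub>1 y)) = (LINT y|lborel. F (Complex \<sigma>\<^sub>2 y))"
proof -
  let ?D = "\<lambda>n. integral {-real n..real n} (\<lambda>y. F (Complex \<sigma>\<^sub>2 y))
      - integral {-real n..real n} (\<lambda>y. F (Complex \<sigma>\<^sub>1 y))"
  have "?D \<longlonglongrightarrow> (LINT y|lborel. F (Complex \<sigma>\<^sub>2 y)) - (LINT y|lborel. F (Complex \<sigma>\<^sub>1 y))"
    by (intro tendsto_diff truncated_integral_tendsto int)
  moreover have "?D \<longlonglongrightarrow> 0"
  proof (rule Lim_null_comparison)
    show "(\<lambda>n. 2 * B (real n) * (\<sigma>\<^sub>2 - \<sigma>\<^sub>1)) \<longlonglongrightarrow> 0"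
      using tendsto_mult_right_zero[OF lim, of "2 * (\<sigma>\<^sub>2 - \<sigma>\<^sub>1)"] by (simp add: mult_ac)
    show "\<forall>\<^sub>F n in sequentially. norm (?D n) \<le> 2 * B (real n) * (\<sigma>\<^sub>2 - \<sigma>\<^sub>1)"
    proof (rule eventually_sequentiallyI[of 1])
      fix n :: nat assume n: "1 \<le> n"
      let ?p = "rectpath (Complex \<sigma>\<^sub>1 (- real n)) (Complex \<sigma>\<^sub>2 (real n))"
      have sub: "path_image ?p \<subseteq> {z. Re z > 0}"
        using path_image_rectpath_subset_cbox[of "Complex \<sigma>\<^sub>1 (- real n)" "Complex \<sigma>\<^sub>2 (real n)"] assms(1,2)
        by (auto simp: in_cbox_complex_iff)
      have "(F has_contour_integral 0) ?p"
        by (rule Cauchy_theorem_convex_simple[OF hol]) (use sub in \<open>auto simp: convex_halfspace_Re_gt\<close>)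
      moreover have "0 \<le> B (real n)"
        using order_trans[OF norm_ge_zero B[of "Complex \<sigma>\<^sub>1 (real n)"]] assms(2) n by simp
      ultimately have "norm (0 - \<i> * ?D n) \<le> 2 * B (real n) * (\<sigma>\<^sub>2 - \<sigma>\<^sub>1)"
        using n assms(2) B sub
        by (intro rectangle_integral_estimate)
           (auto intro!: continuous_on_subset[OF holomorphic_on_imp_continuous_on[OF hol]], metis
               One_nat_def n of_nat_1 of_nat_mono)
      then show "norm (?D n) \<le> 2 * B (real n) * (\<sigma>\<^sub>2 - \<sigma>\<^sub>1)"
        by (simp add: norm_mult)
    qed
  qed
  ultimately show ?thesis using LIMSEQ_unique by fastforce
qed

text \<open>
  Cauchy's formula on the rectangle with left side on the line \<open>Re z = \<sigma>\<close> and the other three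
  sides at distance of order \<open>n\<close>: there the denominator contributes \<open>1 / n\<close>, which compensates the
  length of the sides, so that any decay of \<open>G\<close> makes them disappear.
\<close>

lemma half_plane_Cauchy_formula:
  fixes G :: "complex \<Rightarrow> complex"
  assumes "0 < \<sigma>" "\<sigma> < \<mu>" and hol: "G holomorphic_on {z. Re z > 0}"
    and int: "integrable lborel (\<lambda>y. G (Complex \<sigma> y) / (of_real \<mu> - Complex \<sigma> y))"
    and B: "\<And>z n. \<lbrakk>\<sigma> \<le> Re z; real n \<le> norm z\<rbrakk> \<Longrightarrow> norm (G z) \<le> B n"
    and lim: "B \<longlonglongrightarrow> 0"
  shows "(LINT y|lborel. G (Complex \<sigma> y) / (of_real \<mu> - Complex \<sigma> y)) = 2 * pi * G (of_real \<mu>)"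
proof -
  let ?F = "\<lambda>z. G z / (z - of_real \<mu>)"
  let ?J = "\<lambda>n. integral {-real n..real n} (\<lambda>y. ?F (Complex \<sigma> y))"
  have neg: "?F (Complex \<sigma> y) = - (G (Complex \<sigma> y) / (of_real \<mu> - Complex \<sigma> y))" for y
    using minus_divide_right[of "G (Complex \<sigma> y)" "of_real \<mu> - Complex \<sigma> y"] by simp
  have int': "integrable lborel (\<lambda>y. ?F (Complex \<sigma> y))"
    unfolding neg using int by simp
  have 1: "(\<lambda>n. 2 * pi * G (of_real \<mu>) + ?J n) \<longlonglongrightarrow> 2 * pi * G (of_real \<mu>) + (LINT y|lborel. ?F (Complex \<sigma> y))"
    by (intro tendsto_add tendsto_const truncated_integral_tendsto int')
  have "(\<lambda>n. 2 * pi * G (of_real \<mu>) + ?J n) \<longlonglongrightarrow> 0"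
  proof (rule Lim_null_comparison)
    show "(\<lambda>n. 6 * B n) \<longlonglongrightarrow> 0"
      using tendsto_mult_right_zero[OF lim, of 6] by simp
    obtain N :: nat where N: "real N > \<mu>" using reals_Archimedean2 by blast
    show "\<forall>\<^sub>F n in sequentially. norm (2 * pi * G (of_real \<mu>) + ?J n) \<le> 6 * B n"
    proof (rule eventually_sequentiallyI[of "N + 1"])
      fix n :: nat assume n: "N + 1 \<le> n"
      then have nl: "real n \<ge> \<mu> + 1" "real n > 0" using N assms(1,2) by auto
      \<comment> \<open>The right side passes through \<open>\<mu> + n\<close>, so the three far sides keep the distance \<open>n\<close> from \<open>\<mu>\<close>.\<close>
      let ?s = "\<mu> + real n"
      let ?p = "rectpath (Complex \<sigma> (- real n)) (Complex ?s (real n))"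
      have cb: "path_image ?p = cbox (Complex \<sigma> (- real n)) (Complex ?s (real n))
          - box (Complex \<sigma> (- real n)) (Complex ?s (real n))"
        by (rule path_image_rectpath_cbox_minus_box) (use nl assms(2) in auto)
      have inb: "of_real \<mu> \<in> box (Complex \<sigma> (- real n)) (Complex ?s (real n))"
        using nl assms(1,2) by (simp add: in_box_complex_iff)
      have "path_image ?p \<subseteq> {z. Re z > 0}"
        unfolding cb using assms(1) by (auto simp: in_cbox_complex_iff)
      moreover have "of_real \<mu> \<notin> path_image ?p"
        unfolding cb using inb by blast
      ultimately have sub: "path_image ?p \<subseteq> {z. Re z > 0} - {of_real \<mu>}" by blast
      have B0: "0 \<le> B n"
        using order_trans[OF norm_ge_zero B[of "of_real (real n)" n]] nl assms(2) by simp
      have "(?F has_contour_integral (of_real (2 * pi) * \<i> * winding_number ?p (of_real \<mu>)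
          * G (of_real \<mu>))) ?p"
        by (rule Cauchy_integral_formula_convex_simple[OF _ hol])
           (use sub assms(1,2) in \<open>auto simp: convex_halfspace_Re_gt interior_open open_halfspace_Re_gt\<close>)
      then have ci: "(?F has_contour_integral (of_real (2 * pi) * \<i> * G (of_real \<mu>))) ?p"
        using winding_number_rectpath[OF inb] by simp
      have Fb: "norm (?F z) \<le> B n / n" if "\<sigma> \<le> Re z" "real n \<le> norm z" "real n \<le> norm (z - of_real \<mu>)" for z
        unfolding norm_divide using B[OF that(1,2)] that(3) nl B0 by (intro frac_le) auto
      let ?r = "integral {-real n..real n} (\<lambda>y. ?F (Complex ?s y))"
      have e: "norm (of_real (2 * pi) * \<i> * G (of_real \<mu>) - \<i> * (?r - ?J n)) \<le> 2 * (B n / n) * (?s - \<sigma>)"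
      proof (rule rectangle_integral_estimate[OF _ _ _ _ ci])
        show "continuous_on (path_image ?p) ?F"
          by (intro continuous_intros continuous_on_subset[OF holomorphic_on_imp_continuous_on[OF hol]])
              (use sub in auto)
        fix z assume "\<sigma> \<le> Re z" "Re z \<le> ?s" "\<bar>Im z\<bar> = real n"
        then show "norm (?F z) \<le> B n / n"
          using abs_Im_le_cmod[of z] abs_Im_le_cmod[of "z - of_real \<mu>"] by (intro Fb) auto
      qed (use nl assms B0 in auto)
      have r: "norm ?r \<le> B n / n * (real n - (- real n))"
      proof (rule integral_bound)
        show "continuous_on {- real n..real n} (\<lambda>y. ?F (Complex ?s y))"
        proof (intro continuous_intros)
          show "continuous_on {- real n..real n} (\<lambda>y. G (Complex ?s y))"
            using nl assms(1,2)
            by (intro continuous_on_compose2[OF holomorphic_on_imp_continuous_on[OF hol]])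
               (auto simp: Complex_eq intro!: continuous_intros)
          show "\<forall>y\<in>{- real n..real n}. Complex ?s y - of_real \<mu> \<noteq> 0"
            using nl by (auto simp: complex_eq_iff)
        qed
        fix y assume "y \<in> {- real n..real n}"
        show "norm (?F (Complex ?s y)) \<le> B n / n"
          using nl assms(1,2) abs_Re_le_cmod[of "Complex ?s y"]
              abs_Re_le_cmod[of "Complex ?s y - of_real \<mu>"] by (intro Fb) auto
      qed (use nl in auto)
      have "norm (2 * pi * G (of_real \<mu>) + ?J n) = norm (\<i> * (2 * pi * G (of_real \<mu>) + ?J n))"
        by (simp add: norm_mult)
      also have "\<i> * (2 * pi * G (of_real \<mu>) + ?J n)
          = (of_real (2 * pi) * \<i> * G (of_real \<mu>) - \<i> * (?r - ?J n)) + \<i> * ?r"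
        by (simp add: algebra_simps)
      also have "norm \<dots> \<le> 2 * (B n / n) * (?s - \<sigma>) + B n / n * (2 * real n)"
        by (rule norm_triangle_le) (use e r in \<open>auto simp: norm_mult algebra_simps\<close>)
      also have "2 * (B n / n) * (?s - \<sigma>) \<le> 2 * (B n / n) * (2 * real n)"
        using nl B0 assms by (intro mult_left_mono) auto
      also have "2 * (B n / n) * (2 * real n) + B n / n * (2 * real n) = 6 * B n"
        using nl by simp
      finally show "norm (2 * pi * G (of_real \<mu>) + ?J n) \<le> 6 * B n" by simp
    qed
  qed
  from LIMSEQ_unique[OF 1 this] have "2 * pi * G (of_real \<mu>) + (LINT y|lborel. ?F (Complex \<sigma> y)) = 0" .
  then show ?thesis unfolding neg by (simp add: algebra_simps add_eq_0_iff)
qed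

lemma integral_inverse_sum_squares:
  assumes "0 < \<sigma>"
  shows "integrable lborel (\<lambda>y::real. 1 / (\<sigma>\<^sup>2 + y\<^sup>2))" "(LINT y|lborel. 1 / (\<sigma>\<^sup>2 + y\<^sup>2)) = pi / \<sigma>"
proof -
  have i: "integrable lborel (\<lambda>x::real. inverse (1 + x\<^sup>2))"
    using integrable_inverse_1_plus_square by (simp add: set_integrable_def)
  have v: "(LINT x|lborel. inverse (1 + x\<^sup>2)) = pi"
    using LBINT_inverse_1_plus_square by (simp add: interval_lebesgue_integral_def
        set_lebesgue_integral_def)
  have e: "1 / (\<sigma>\<^sup>2 + (0 + \<sigma> * x)\<^sup>2) = (1 / \<sigma>\<^sup>2) * inverse (1 + x\<^sup>2)" for x
  proof -
    have "\<sigma>\<^sup>2 + (0 + \<sigma> * x)\<^sup>2 = \<sigma>\<^sup>2 * (1 + x\<^sup>2)" by (simp add: algebra_simps power2_eq_square)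
    then show ?thesis by (simp add: inverse_eq_divide)
  qed
  have "integrable lborel (\<lambda>x::real. 1 / (\<sigma>\<^sup>2 + (0 + \<sigma> * x)\<^sup>2))"
    unfolding e by (intro integrable_mult_right i)
  then show "integrable lborel (\<lambda>y::real. 1 / (\<sigma>\<^sup>2 + y\<^sup>2))"
    using lborel_integrable_real_affine_iff[of \<sigma> "\<lambda>y::real. 1 / (\<sigma>\<^sup>2 + y\<^sup>2)" 0] assms by simp
  have "(LINT y|lborel. 1 / (\<sigma>\<^sup>2 + y\<^sup>2)) = \<bar>\<sigma>\<bar> *\<^sub>R (LINT x|lborel. 1 / (\<sigma>\<^sup>2 + (0 + \<sigma> * x)\<^sup>2))"
    by (rule lborel_integral_real_affine) (use assms in simp)
  also have "\<dots> = pi / \<sigma>"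
    unfolding e using v assms by (simp add: power2_eq_square)
  finally show "(LINT y|lborel. 1 / (\<sigma>\<^sup>2 + y\<^sup>2)) = pi / \<sigma>" .
qed

text \<open>
  Since \<open>|z| \<ge> \<sigma>\<close> on the line, \<open>|z|\<^sup>s\<close> is at most \<open>\<sigma>\<close> to the power \<open>s + 2\<close> times \<open>|z|\<^sup>-\<^sup>2\<close>, and
  the last factor has integral \<open>\<pi> / \<sigma>\<close>. The resulting power of \<open>\<sigma>\<close> is the one dictated by scaling.
\<close>

lemma vertical_line_integral_bound:
  fixes G :: "complex \<Rightarrow> complex"
  assumes "0 < \<sigma>" "s \<le> -2" "0 \<le> C"
    and cont: "continuous_on UNIV (\<lambda>y. G (Complex \<sigma> y))"
    and B: "\<And>y. norm (G (Complex \<sigma> y)) \<le> C * norm (Complex \<sigma> y) powr s"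
  shows "integrable lborel (\<lambda>y. G (Complex \<sigma> y))"
    and "norm (LINT y|lborel. G (Complex \<sigma> y)) \<le> pi * C * \<sigma> powr (s + 1)"
proof -
  have B': "norm (G (Complex \<sigma> y)) \<le> C * \<sigma> powr (s + 2) * (1 / (\<sigma>\<^sup>2 + y\<^sup>2))" for y
  proof -
    have n: "norm (Complex \<sigma> y) \<ge> \<sigma>" "(norm (Complex \<sigma> y))\<^sup>2 = \<sigma>\<^sup>2 + y\<^sup>2"
      using abs_Re_le_cmod[of "Complex \<sigma> y"] assms(1) by (auto simp: cmod_power2)
    have "norm (Complex \<sigma> y) powr s = norm (Complex \<sigma> y) powr (s + 2) * norm (Complex \<sigma> y) powr (-2)"
      by (simp flip: powr_add)
    also have "norm (Complex \<sigma> y) powr (-2) = 1 / (\<sigma>\<^sup>2 + y\<^sup>2)"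
      using n assms(1) by (simp add: powr_minus_divide flip: n(2))
    finally have e: "norm (Complex \<sigma> y) powr s = norm (Complex \<sigma> y) powr (s + 2) * (1 / (\<sigma>\<^sup>2 + y\<^sup>2))" .
    have "norm (Complex \<sigma> y) powr (s + 2) \<le> \<sigma> powr (s + 2)"
      using n(1) assms by (intro powr_mono2') auto
    then have "norm (Complex \<sigma> y) powr s \<le> \<sigma> powr (s + 2) * (1 / (\<sigma>\<^sup>2 + y\<^sup>2))"
      unfolding e by (intro mult_right_mono) auto
    then show ?thesis using B[of y] assms(3)
      by (smt (verit, ccfv_SIG) mult.assoc mult_left_mono)
  qed
  have i: "integrable lborel (\<lambda>y. C * \<sigma> powr (s + 2) * (1 / (\<sigma>\<^sup>2 + y\<^sup>2)))"
    by (intro integrable_mult_right integral_inverse_sum_squares assms)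
  show 1: "integrable lborel (\<lambda>y. G (Complex \<sigma> y))"
  proof (rule Bochner_Integration.integrable_bound[OF i])
    show "AE y in lborel. norm (G (Complex \<sigma> y)) \<le> norm (C * \<sigma> powr (s + 2) * (1 / (\<sigma>\<^sup>2 + y\<^sup>2)))"
      unfolding real_norm_def using B' abs_ge_self order_trans by blast
  qed (use borel_measurable_continuous_onI[OF cont] in simp)
  have "norm (LINT y|lborel. G (Complex \<sigma> y)) \<le> (LINT y|lborel. norm (G (Complex \<sigma> y)))"
    by (rule integral_norm_bound)
  also have "\<dots> \<le> (LINT y|lborel. C * \<sigma> powr (s + 2) * (1 / (\<sigma>\<^sup>2 + y\<^sup>2)))"
    by (rule integral_mono) (use 1 i B' in auto)
  also have "\<dots> = pi * C * (\<sigma> powr (s + 2) / \<sigma>)"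
    by (subst integral_mult_right_zero) (use integral_inverse_sum_squares(2)[OF assms(1)] in simp)
  also have "\<sigma> powr (s + 2) / \<sigma> = \<sigma> powr (s + 1)"
    using assms(1) powr_diff[of \<sigma> "s+2" 1] by (simp add: add.commute)
  finally show "norm (LINT y|lborel. G (Complex \<sigma> y)) \<le> pi * C * \<sigma> powr (s + 1)" .
qed

section \<open>Power integrals, changes of variables, differentiation under the integral\<close>

text \<open>
  The exponential series dominates any power of \<open>x\<^sup>a\<close> for \<open>x \<ge> 1\<close>; both factors are at most one
  for \<open>x \<le> 1\<close>.
\<close>

lemma powr_times_exp_bounded:
  fixes m \<kappa> a :: real
  assumes "0 \<le> m" "0 < \<kappa>" "0 < a"
  shows "\<exists>C>0. \<forall>x>0. x powr m * exp (- \<kappa> * x powr a) \<le> C"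
proof -
  obtain n :: nat where n: "m / a \<le> real n" using real_arch_simple by blast
  define C where "C = 1 + fact n / \<kappa> ^ n"
  have C: "1 \<le> C" "fact n / \<kappa> ^ n \<le> C" using assms by (auto simp: C_def)
  have "x powr m * exp (- \<kappa> * x powr a) \<le> C" if x: "0 < x" for x
  proof (cases "x \<le> 1")
    case True
    have "x powr m \<le> 1" using True x assms by (intro powr_le1) auto
    moreover have "exp (- \<kappa> * x powr a) \<le> 1" using assms by simp
    ultimately have "x powr m * exp (- \<kappa> * x powr a) \<le> 1" by (intro mult_le_one) auto
    then show ?thesis using C by linarith
  next
    case False
    have p: "0 < x powr a" using x by simp
    have "x powr m \<le> x powr (a * real n)" using False n assms by (intro powr_mono) (auto simp: field_simps)
    also have "\<dots> = (x powr a) ^ n" using x by (simp add: powr_realpow flip: powr_powr)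
    finally have 1: "x powr m \<le> (x powr a) ^ n" .
    have "(\<kappa> * x powr a) ^ n / fact n \<le> exp (\<kappa> * x powr a)"
    proof -
      have "(\<lambda>k. (\<kappa> * x powr a) ^ k / fact k) sums exp (\<kappa> * x powr a)"
        using exp_converges[of "\<kappa> * x powr a"] by (simp add: field_simps)
      then have "(\<Sum>k\<in>{n}. (\<kappa> * x powr a) ^ k / fact k) \<le> exp (\<kappa> * x powr a)"
        unfolding sums_iff using assms p by (metis (no_types, lifting) sum_le_suminf[of _ "{n}"]
            finite.intros divide_nonneg_nonneg fact_ge_zero mult_nonneg_nonneg less_imp_le zero_le_power)
      then show ?thesis by simp
    qed
    then have "(x powr a) ^ n \<le> fact n / \<kappa> ^ n * exp (\<kappa> * x powr a)"
      using assms by (simp add: power_mult_distrib field_simps)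
    with 1 have "x powr m \<le> fact n / \<kappa> ^ n * exp (\<kappa> * x powr a)" by linarith
    then have "x powr m * exp (- \<kappa> * x powr a) \<le> fact n / \<kappa> ^ n"
      by (simp add: exp_minus field_simps)
    then show ?thesis using C by linarith
  qed
  then show ?thesis using C by (intro exI[of _ C]) auto
qed

lemma integral_exp_half_line:
  fixes w :: complex
  assumes "0 < Re w"
  shows "integrable lborel (\<lambda>t. indicator {0<..} t *\<^sub>R exp (- (of_real t * w)))"
    and "(LINT t|lborel. indicator {0<..} t *\<^sub>R exp (- (of_real t * w))) = 1 / w"
proof -
  have i: "integrable lborel (\<lambda>t. indicator {0<..} t *\<^sub>R exp (- (t * Re w)))"
    using integrable_I0i_exp_mscale[OF assms] by (simp add: set_integrable_def)
  show i': "integrable lborel (\<lambda>t. indicator {0<..} t *\<^sub>R exp (- (of_real t * w)))"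
    by (rule Bochner_Integration.integrable_bound[OF i])
       (auto simp: indicator_def intro!: borel_measurable_indicator borel_measurable_continuous_onI
           continuous_intros
          borel_measurable_scaleR)
  have w: "w \<noteq> 0" using assms by auto
  have "(LBINT x=0..\<infinity>. exp (- (of_real x * w))) = 0 - (- 1 / w)"
  proof (rule interval_integral_FTC_integrable[where F="\<lambda>x. - exp (- (of_real x * w)) / w"])
    fix x :: real
    show "((\<lambda>x. - exp (- (of_real x * w)) / w) has_vector_derivative exp (- (of_real x * w))) (at x)"
      using w by (auto intro!: derivative_eq_intros has_vector_derivative_real_field simp: field_simps)
    show "isCont (\<lambda>x. exp (- (of_real x * w))) x" by (auto intro!: continuous_intros)
  next
    show "set_integrable lborel (einterval 0 \<infinity>) (\<lambda>x. exp (- (complex_of_real x * w)))"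
      using i' by (simp add: set_integrable_def zero_ereal_def)
    have "((\<lambda>x. - exp (- (of_real x * w)) / w) \<longlongrightarrow> - exp (- (of_real 0 * w)) / w) (at_right 0)"
      using w by (intro tendsto_intros) auto
    then show "(((\<lambda>x. - exp (- (of_real x * w)) / w) \<circ> real_of_ereal) \<longlongrightarrow> - 1 / w) (at_right 0)"
      by (simp add: zero_ereal_def ereal_tendsto_simps)
    have "((\<lambda>x. exp (- (of_real x * w))) \<longlongrightarrow> 0) at_top"
    proof (rule tendsto_norm_zero_cancel)
      have "((\<lambda>x. exp (- (x * Re w))) \<longlongrightarrow> 0) at_top"
        using assms by real_asymp
      then show "((\<lambda>x. norm (exp (- (of_real x * w)))) \<longlongrightarrow> 0) at_top"
        by simp
    qed
    then have "((\<lambda>x. - exp (- (of_real x * w)) / w) \<longlongrightarrow> - 0 / w) at_top"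
      using w by (intro tendsto_intros)
    then show "(((\<lambda>x. - exp (- (of_real x * w)) / w) \<circ> real_of_ereal) \<longlongrightarrow> 0) (at_left \<infinity>)"
      by (simp add: ereal_tendsto_simps)
  qed auto
  then show "(LINT t|lborel. indicator {0<..} t *\<^sub>R exp (- (of_real t * w))) = 1 / w"
    by (simp add: interval_lebesgue_integral_def set_lebesgue_integral_def zero_ereal_def)
qed

lemma norm_exp_minus_minus_1_le:
  fixes w :: complex
  assumes "0 \<le> Re w"
  shows "norm (exp (- w) - 1) \<le> norm w"
proof -
  have "norm (exp (- w) - exp (- 0)) \<le> 1 * norm (w - 0)"
  proof (rule field_differentiable_bound[where S="{z. 0 \<le> Re z}" and f="\<lambda>z. exp (- z)"
      and f'="\<lambda>z. - exp (- z)"])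
    show "((\<lambda>z. exp (- z)) has_field_derivative - exp (- z)) (at z within {z. 0 \<le> Re z})" for z :: complex
      by (auto intro!: derivative_eq_intros)
  qed (use assms in \<open>auto simp: convex_halfspace_Re_ge\<close>)
  then show ?thesis by simp
qed

lemma nonneg_has_integral_imp_bochner:
  fixes f :: "real \<Rightarrow> real"
  assumes I: "(f has_integral I) S" and nn: "\<And>x. x \<in> S \<Longrightarrow> 0 \<le> f x"
    and [measurable]: "f \<in> borel_measurable borel" "S \<in> sets borel"
  shows "has_bochner_integral lborel (\<lambda>x. indicator S x * f x) I"
proof (rule has_bochner_integral_nn_integral)
  show "0 \<le> I" using has_integral_nonneg[OF I] nn by auto
  show "(\<integral>\<^sup>+ x. ennreal (indicat_real S x * f x) \<partial>lborel) = ennreal I"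
    using nn_integral_has_integral_lebesgue[OF nn I] by simp
qed (use nn in \<open>auto simp: indicator_def\<close>)

lemma powr_integrable_near_0:
  assumes "-1 < (e::real)"
  shows "integrable lborel (\<lambda>x. indicator {0..1} x * x powr e)"
  using nonneg_has_integral_imp_bochner[OF has_integral_powr_from_0[OF assms, of 1]]
  by (auto simp: has_bochner_integral_iff)

lemma powr_integrable_at_infinity:
  assumes "(e::real) < -1"
  shows "integrable lborel (\<lambda>x. indicator {1..} x * x powr e)"
  using nonneg_has_integral_imp_bochner[OF has_integral_powr_to_inf[OF assms, of 1]]
  by (auto simp: has_bochner_integral_iff)

lemma Gamma_integral_scaled:
  fixes s \<mu> :: real
  assumes "0 < s" "0 < \<mu>"
  shows "has_bochner_integral lborel (\<lambda>x. indicator {0..} x * (x powr (s - 1) * exp (- (x * \<mu>))))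
      (Gamma s * \<mu> powr (- s))"
proof -
  let ?f = "\<lambda>x::real. indicator {0..} x * (x powr (s - 1) / exp x)"
  have 1: "has_bochner_integral lborel ?f (Gamma s)"
    by (rule nonneg_has_integral_imp_bochner[OF Gamma_integral_real[OF assms(1)]]) auto
  have e: "?f (0 + \<mu> * x) = \<mu> powr (s - 1) * (indicator {0..} x * (x powr (s - 1) * exp (- (x * \<mu>))))" for x
    using assms(2) by (auto simp: indicator_def zero_le_mult_iff powr_mult exp_minus field_simps)
  have 2: "integrable lborel (\<lambda>x. ?f (0 + \<mu> * x))"
    using lborel_integrable_real_affine_iff[of \<mu> ?f 0] 1 assms(2) by (simp add: has_bochner_integral_iff)
  have "Gamma s = \<bar>\<mu>\<bar> *\<^sub>R (LINT x|lborel. ?f (0 + \<mu> * x))"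
    using lborel_integral_real_affine[of \<mu> ?f 0] 1 assms(2) by (simp add: has_bochner_integral_iff)
  then have "Gamma s = \<mu> * \<mu> powr (s - 1) * (LINT x|lborel. indicator {0..} x
      * (x powr (s - 1) * exp (- (x * \<mu>))))"
    unfolding e using assms(2) by simp
  also have "\<mu> * \<mu> powr (s - 1) = \<mu> powr s" using assms(2) powr_add[of \<mu> 1 "s - 1"] by simp
  finally have "(LINT x|lborel. indicator {0..} x * (x powr (s - 1) * exp (- (x * \<mu>))))
      = Gamma s * \<mu> powr (- s)"
    using assms(2) by (simp add: powr_minus field_simps)
  moreover have "integrable lborel (\<lambda>x. indicator {0..} x * (x powr (s - 1) * exp (- (x * \<mu>))))"
    using 2 assms(2) unfolding e by (subst (asm) integrable_mult_left_iff) auto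
  ultimately show ?thesis by (simp add: has_bochner_integral_iff)
qed

text \<open>
  The Gamma integral after the substitution \<open>x \<mapsto> 1 / x\<close>. In this form it evaluates the mixtures of
  Gaussians with a power weight in the variance.
\<close>

lemma Gamma_integral_inverted:
  fixes s B :: real
  assumes "0 < s" "0 < B"
  shows "has_bochner_integral lborel (\<lambda>x. indicator {0<..} x * (x powr (- 1 - s) * exp (- (B / x))))
      (Gamma s * B powr (- s))"
proof -
  let ?f = "\<lambda>x::real. x powr (s - 1) * exp (- (x * B))"
  have im: "inverse ` {0<..} = ({0<..} :: real set)"
  proof -
    have "x \<in> inverse ` {0<..}" if "0 < x" for x :: real
      using that by (intro image_eqI[of _ _ "inverse x"]) auto
    then show ?thesis by auto
  qed
  have "has_bochner_integral lborel (\<lambda>x. indicator {0<..} x * ?f x) (Gamma s * B powr (- s))"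
    using Gamma_integral_scaled[OF assms] by (rule
        has_bochner_integral_discrete_difference[of "{0}", THEN iffD1, rotated -1])
            (auto simp: indicator_def)
  then have f: "set_integrable lborel {0<..} ?f" "(LINT x:{0<..}|lborel. ?f x) = Gamma s * B powr (- s)"
    by (auto simp: has_bochner_integral_iff set_integrable_def set_lebesgue_integral_def)
  have "?f absolutely_integrable_on {0<..}"
    using f(1) unfolding set_integrable_def by (intro integrable_completion[THEN iffD2]) auto
  moreover have "integral {0<..} ?f = Gamma s * B powr (- s)"
    using set_borel_integral_eq_integral(2)[OF f(1)] f(2) by simp
  ultimately have R: "?f absolutely_integrable_on (inverse ` {0<..}) \<and> integral (inverse ` {0<..}) ?f
      = Gamma s * B powr (- s)"
    unfolding im by simp
  have "(\<lambda>x. \<bar>- (inverse x ^ 2)\<bar> * ?f (inverse x)) absolutely_integrable_on {0<..}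
      \<and> integral {0<..} (\<lambda>x. \<bar>- (inverse x ^ 2)\<bar> * ?f (inverse x)) = Gamma s * B powr (- s)
     \<longleftrightarrow> ?f absolutely_integrable_on (inverse ` {0<..}) \<and> integral (inverse ` {0<..}) ?f
         = Gamma s * B powr (- s)"
  proof (rule has_absolute_integral_change_of_variables_1'[where f="?f" and g=inverse
      and g'="\<lambda>x. - (inverse x ^ 2)" and S="{0<..}"])
    show "(inverse has_field_derivative - (inverse x ^ 2)) (at x within {0<..})"
        if "x \<in> {0<..}" for x :: real
      using that by (auto intro!: derivative_eq_intros simp: power2_eq_square)
  qed (auto simp: inj_on_def)
  then have "(\<lambda>x. \<bar>- (inverse x ^ 2)\<bar> * ?f (inverse x)) absolutely_integrable_on {0<..}
      \<and> integral {0<..} (\<lambda>x. \<bar>- (inverse x ^ 2)\<bar> * ?f (inverse x)) = Gamma s * B powr (- s)"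
    using R by (rule iffD2)
  then have L: "(\<lambda>x. \<bar>- (inverse x ^ 2)\<bar> * ?f (inverse x)) absolutely_integrable_on {0<..}"
    "integral {0<..} (\<lambda>x. \<bar>- (inverse x ^ 2)\<bar> * ?f (inverse x)) = Gamma s * B powr (- s)"
    by (rule conjunct1, rule conjunct2)
  have "((\<lambda>x. \<bar>- (inverse x ^ 2)\<bar> * ?f (inverse x)) has_integral Gamma s * B powr (- s)) {0<..}"
    using integrable_integral[OF set_lebesgue_integral_eq_integral(1)[OF L(1)]] unfolding L(2) .
  then have "((\<lambda>x. x powr (- 1 - s) * exp (- (B / x))) has_integral Gamma s * B powr (- s)) {0<..}"
  proof (rule has_integral_eq[rotated])
    fix x :: real assume x: "x \<in> {0<..}"
    have "inverse x ^ 2 = x powr (-2)" using x by (simp add: powr_minus powr_numeral power_inverse)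
    moreover have "inverse x powr (s - 1) = x powr (- (s - 1))" using x inverse_powr[of x "s - 1"]
        unfolding powr_minus[of x "s - 1"] by simp
    moreover have "x powr (-2) * x powr (- (s - 1)) = x powr (- 1 - s)" by (simp flip: powr_add)
    ultimately show "\<bar>- (inverse x ^ 2)\<bar> * ?f (inverse x) = x powr (- 1 - s) * exp (- (B / x))"
      by (simp add: field_simps)
  qed
  then show ?thesis by (rule nonneg_has_integral_imp_bochner) auto
qed

lemma mult_abs_powr:
  assumes "0 \<le> (x::real)"
  shows "x * \<bar>x\<bar> powr e = x powr (1 + e)"
  using assms by (cases "x = 0") (simp_all add: powr_add)

lemma has_integral_01_imp_set_integral:
  fixes f :: "real \<Rightarrow> real"
  assumes I: "(f has_integral I) {0..1}" and nn: "\<And>x. x \<in> {0..1} \<Longrightarrow> 0 \<le> f x"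
      and f: "f \<in> borel_measurable borel"
  shows "has_bochner_integral lborel (\<lambda>x. indicator {0<..<1} x * f x) I"
proof -
  have "(f has_integral I) {0<..<1}"
    using I by (simp add: has_integral_Icc_iff_Ioo)
  then show ?thesis
    by (rule nonneg_has_integral_imp_bochner) (use nn f in auto)
qed

lemma powr_set_integral:
  assumes "-1 < (e::real)"
  shows "has_bochner_integral lborel (\<lambda>x. indicator {0<..<1} x * x powr e) (1 / (e + 1))"
  using has_integral_01_imp_set_integral[OF has_integral_powr_from_0[OF assms, of 1]] by auto

lemma reflected_powr_set_integrable:
  assumes "-1 < (e::real)"
  shows "integrable lborel (\<lambda>x. indicator {0<..<1} x * (1 - x) powr e)"
proof -
  have "integrable lborel (\<lambda>x. indicator {0<..<1} (1 + (-1) * x) * (1 + (-1) * x) powr e)"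
    using powr_set_integral[OF assms] by (intro lborel_integrable_real_affine)
        (auto simp: has_bochner_integral_iff)
  then show ?thesis by (simp add: indicator_def conj_commute)
qed

lemma lborel_integral_affine:
  fixes f :: "'a::euclidean_space \<Rightarrow> real"
  assumes c: "c \<noteq> 0" and [measurable]: "f \<in> borel_measurable borel"
  shows "integrable lborel (\<lambda>y. f (x + c *\<^sub>R y)) \<longleftrightarrow> integrable lborel f"
    and "(LINT y|lborel. f y) = \<bar>c\<bar> ^ DIM('a) * (LINT y|lborel. f (x + c *\<^sub>R y))"
proof -
  have lb: "(lborel :: 'a measure) = density (distr lborel borel (\<lambda>y. x + c *\<^sub>R y))
      (\<lambda>_. ennreal (\<bar>c\<bar> ^ DIM('a)))"
    using lborel_affine[OF c, of x] by (simp add: ennreal_power)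
  have "integrable lborel f \<longleftrightarrow> integrable (density (distr lborel borel (\<lambda>y. x + c *\<^sub>R y))
      (\<lambda>_. ennreal (\<bar>c\<bar> ^ DIM('a)))) f"
    using lb by (rule arg_cong)
  also have "\<dots> \<longleftrightarrow> integrable lborel (\<lambda>y. \<bar>c\<bar> ^ DIM('a) * f (x + c *\<^sub>R y))"
    by (subst integrable_density) (auto simp: integrable_distr_eq)
  also have "\<dots> \<longleftrightarrow> integrable lborel (\<lambda>y. f (x + c *\<^sub>R y))"
    using c by (subst integrable_mult_left_iff) auto
  finally show "integrable lborel (\<lambda>y. f (x + c *\<^sub>R y)) \<longleftrightarrow> integrable lborel f" by blast
  have "(LINT y|lborel. f y) = (LINT y|density (distr lborel borel (\<lambda>y. x + c *\<^sub>R y))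
      (\<lambda>_. ennreal (\<bar>c\<bar> ^ DIM('a))). f y)"
    using lb by (rule arg_cong)
  also have "\<dots> = (LINT y|lborel. \<bar>c\<bar> ^ DIM('a) * f (x + c *\<^sub>R y))"
    by (subst integral_density) (auto simp: integral_distr)
  finally show "(LINT y|lborel. f y) = \<bar>c\<bar> ^ DIM('a) * (LINT y|lborel. f (x + c *\<^sub>R y))"
    by simp
qed

text \<open>
  The mean value theorem bounds the difference quotients by \<open>w\<close>, so dominated convergence applies
  to them.
\<close>

lemma has_field_derivative_integral:
  fixes f f' :: "real \<Rightarrow> 'b \<Rightarrow> real"
  assumes f: "\<And>h. integrable M (f h)"
    and der: "\<And>h y. ((\<lambda>h. f h y) has_field_derivative f' h y) (at h)"
    and bound: "\<And>h y. \<bar>f' h y\<bar> \<le> w y" and w: "integrable M w"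
    and meas: "f' h \<in> borel_measurable M"
  shows "((\<lambda>h. \<integral>y. f h y \<partial>M) has_field_derivative (\<integral>y. f' h y \<partial>M)) (at h)"
  unfolding has_field_derivative_iff
proof (rule tendsto_at_iff_sequentially[THEN iffD2], intro allI impI)
  fix X :: "nat \<Rightarrow> real" assume X: "\<forall>i. X i \<in> UNIV - {h}" "X \<longlonglongrightarrow> h"
  let ?q = "\<lambda>i y. (f (X i) y - f h y) / (X i - h)"
  have "(\<lambda>i. \<integral>y. ?q i y \<partial>M) \<longlonglongrightarrow> (\<integral>y. f' h y \<partial>M)"
  proof (rule integral_dominated_convergence[OF meas _ w])
    show "?q i \<in> borel_measurable M" for i using f by (auto intro!: borel_measurable_integrable)
    show "AE y in M. (\<lambda>i. ?q i y) \<longlonglongrightarrow> f' h y"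
    proof (rule AE_I2)
      fix y
      have "((\<lambda>k. (f k y - f h y) / (k - h)) \<longlongrightarrow> f' h y) (at h)"
        using der[of y h] by (simp add: has_field_derivative_iff)
      then show "(\<lambda>i. ?q i y) \<longlonglongrightarrow> f' h y"
        using X unfolding tendsto_at_iff_sequentially comp_def by blast
    qed
    show "AE y in M. norm (?q i y) \<le> w y" for i
    proof (rule AE_I2)
      fix y
      have "norm (f (X i) y - f h y) \<le> w y * norm (X i - h)"
        by (rule field_differentiable_bound[where S=UNIV and f'="\<lambda>h. f' h y"]) (use der bound in auto)
      then show "norm (?q i y) \<le> w y" using X(1) by (simp add: field_simps)
    qed
  qed
  then show "((\<lambda>k. ((\<integral>y. f k y \<partial>M) - (\<integral>y. f h y \<partial>M)) / (k - h)) \<circ> X) \<longlonglongrightarrow> (\<integral>y. f' h y \<partial>M)"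
    using f by (simp add: comp_def)
qed

section \<open>Gaussian integrals\<close>

lemma gaussian_Fourier_real:
  fixes x T :: real
  assumes T: "0 < T"
  shows "has_bochner_integral lborel (\<lambda>s. exp (\<i> * of_real (x * s)) * of_real (exp (- T * s\<^sup>2)))
           (of_real (sqrt (pi / T) * exp (- x\<^sup>2 / (4 * T))))"
proof -
  define c where "c = sqrt (2 * T)"
  define t where "t = x / c"
  have c: "0 < c" "c\<^sup>2 = 2 * T" using T by (auto simp: c_def)
  let ?f = "\<lambda>y. of_real (std_normal_density y) * exp (\<i> * of_real (t * y)) :: complex"
  have di: "integrable lborel std_normal_density"
    using integrable_normal_density[of 1 0] by simp
  have fi: "integrable lborel ?f"
    by (rule Bochner_Integration.integrable_bound[OF di]) (auto simp: norm_mult)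
  have fv: "(LINT y|lborel. ?f y) = of_real (exp (- (t\<^sup>2) / 2))"
  proof -
    have "char std_normal_distribution t = (LINT y|lborel. std_normal_density y *\<^sub>R exp
        (\<i> * of_real (t * y)))"
      unfolding char_def by (subst integral_density) auto
    then show ?thesis by (simp add: char_std_normal_distribution scaleR_conv_of_real)
  qed
  have e: "?f (0 + c * s) = of_real (1 / sqrt (2 * pi))
      * (exp (\<i> * of_real (x * s)) * of_real (exp (- T * s\<^sup>2)))" for s
  proof -
    have "(c * s)\<^sup>2 / 2 = T * s\<^sup>2" using c by (simp add: power_mult_distrib)
    then have e1: "std_normal_density (c * s) = 1 / sqrt (2 * pi) * exp (- T * s\<^sup>2)"
      by (simp add: normal_density_def)
    have e2: "t * (c * s) = x * s" using c by (simp add: t_def)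
    show ?thesis unfolding add_0_left e1 e2 by simp
  qed
  have "integrable lborel (\<lambda>s. ?f (0 + c * s))"
    by (rule lborel_integrable_real_affine[OF fi]) (use c in simp)
  then have "integrable lborel (\<lambda>s. of_real (sqrt (2 * pi)) * ?f (0 + c * s))"
    by (rule integrable_mult_right)
  then have 1: "integrable lborel (\<lambda>s. exp (\<i> * of_real (x * s)) * of_real (exp (- T * s\<^sup>2)))"
    unfolding e by (simp add: mult.assoc[symmetric] flip: of_real_mult)
  have "of_real (exp (- (t\<^sup>2) / 2)) = c *\<^sub>R (of_real (1 / sqrt (2 * pi))
      * (LINT s|lborel. exp (\<i> * of_real (x * s)) * of_real (exp (- T * s\<^sup>2))))"
    using lborel_integral_real_affine[of c ?f 0] c unfolding fv e by (simp add: integral_mult_right_zero)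
  then have "(LINT s|lborel. exp (\<i> * of_real (x * s)) * of_real (exp (- T * s\<^sup>2)))
      = of_real (sqrt (2 * pi) / c * exp (- (t\<^sup>2) / 2))"
    using c by (simp add: scaleR_conv_of_real field_simps)
  also have "sqrt (2 * pi) / c = sqrt (pi / T)" by (simp add: c_def real_sqrt_mult real_sqrt_divide)
  also have "- (t\<^sup>2) / 2 = - x\<^sup>2 / (4 * T)" using c by (simp add: t_def power_divide)
  finally show ?thesis using 1 by (simp add: has_bochner_integral_iff)
qed

text \<open>
  Fubini for functions of product form: Lebesgue measure is the image of the product measure under
  the coordinate map.
\<close>

lemma lborel_integral_prod:
  fixes f :: "'a::euclidean_space \<Rightarrow> real \<Rightarrow> complex"
  assumes "\<And>b. b \<in> Basis \<Longrightarrow> integrable lborel (f b)"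
  shows "has_bochner_integral lborel (\<lambda>x::'a. \<Prod>b\<in>Basis. f b (x \<bullet> b)) (\<Prod>b\<in>Basis. LINT s|lborel. f b s)"
proof -
  interpret product_sigma_finite "\<lambda>_::'a. lborel :: real measure" ..
  let ?P = "\<Pi>\<^sub>M b\<in>Basis. (lborel :: real measure)"
  let ?T = "\<lambda>g. \<Sum>b\<in>Basis. g b *\<^sub>R b :: 'a"
  have [measurable]: "\<And>b. b \<in> Basis \<Longrightarrow> f b \<in> borel_measurable borel"
    using borel_measurable_integrable[OF assms] by simp
  have lb: "(lborel :: 'a measure) = distr ?P borel ?T" by (rule lborel_eq)
  have eq: "(\<Prod>b\<in>Basis. f b (?T g \<bullet> b)) = (\<Prod>b\<in>Basis. f b (g b))" for g
    by (intro prod.cong refl) simp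
  have T: "?T \<in> measurable ?P borel" by measurable
  have m: "(\<lambda>x::'a. \<Prod>b\<in>Basis. f b (x \<bullet> b)) \<in> borel_measurable borel" by measurable
  have "integrable (distr ?P borel ?T) (\<lambda>x::'a. \<Prod>b\<in>Basis. f b (x \<bullet> b))"
    unfolding integrable_distr_eq[OF T m] eq by (intro product_integrable_prod assms) auto
  moreover have "integral\<^sup>L (distr ?P borel ?T) (\<lambda>x::'a. \<Prod>b\<in>Basis. f b (x \<bullet> b))
      = (\<Prod>b\<in>Basis. LINT s|lborel. f b s)"
    unfolding integral_distr[OF T m] eq by (intro product_integral_prod assms) auto
  ultimately show ?thesis unfolding lb[symmetric] by (simp add: has_bochner_integral_iff)
qed

lemma gaussian_Fourier:
  fixes x :: "'a::euclidean_space"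
  assumes T: "0 < T"
  shows "has_bochner_integral lborel (\<lambda>\<xi>::'a. exp (\<i> * of_real (x \<bullet> \<xi>)) * of_real (exp (- T * (norm \<xi>)\<^sup>2)))
           (of_real ((pi / T) powr (DIM('a) / 2) * exp (- (norm x)\<^sup>2 / (4 * T))))"
proof -
  have n: "(norm \<xi>)\<^sup>2 = (\<Sum>b\<in>Basis. (\<xi> \<bullet> b)\<^sup>2)" for \<xi> :: 'a
    unfolding power2_norm_eq_inner by (subst euclidean_inner) (simp add: power2_eq_square)
  have 1: "(\<Prod>b\<in>Basis. exp (\<i> * of_real ((x \<bullet> b) * (\<xi> \<bullet> b))) * of_real (exp (- T * (\<xi> \<bullet> b)\<^sup>2)))
      = exp (\<i> * of_real (x \<bullet> \<xi>)) * of_real (exp (- T * (norm \<xi>)\<^sup>2))" for \<xi> :: 'a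
    unfolding n euclidean_inner[of x \<xi>] by (simp add: prod.distrib exp_sum sum_distrib_left flip:
        of_real_prod)
  have 2: "(\<Prod>b\<in>Basis. complex_of_real (sqrt (pi / T) * exp (- (x \<bullet> b)\<^sup>2 / (4 * T))))
      = of_real ((pi / T) powr (DIM('a) / 2) * exp (- (norm x)\<^sup>2 / (4 * T)))"
  proof -
    have "(\<Prod>b\<in>Basis. sqrt (pi / T) * exp (- (x \<bullet> b)\<^sup>2 / (4 * T)))
        = sqrt (pi / T) ^ DIM('a) * exp (\<Sum>b\<in>Basis. - (x \<bullet> b)\<^sup>2 / (4 * T))"
      by (simp add: prod.distrib exp_sum)
    also have "(\<Sum>b\<in>Basis. - (x \<bullet> b)\<^sup>2 / (4 * T)) = - (norm x)\<^sup>2 / (4 * T)"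
      unfolding n by (simp add: sum_negf sum_divide_distrib)
    also have "sqrt (pi / T) ^ DIM('a) = (pi / T) powr (DIM('a) / 2)"
      using T by (simp add: powr_half_sqrt[symmetric] powr_powr flip: powr_realpow)
    finally show ?thesis by (simp only: of_real_prod[symmetric])
  qed
  show ?thesis
    using lborel_integral_prod[of "\<lambda>b s. exp (\<i> * of_real ((x \<bullet> b) * s)) * of_real (exp (- T * s\<^sup>2))"]
      gaussian_Fourier_real[OF T]
    unfolding 1 2[symmetric] has_bochner_integral_iff by simp
qed

lemma gaussian_integral:
  assumes T: "0 < T"
  shows "has_bochner_integral lborel (\<lambda>\<xi>::'a::euclidean_space. exp (- T * (norm \<xi>)\<^sup>2))
      ((pi / T) powr (DIM('a) / 2))"
proof -
  have "has_bochner_integral lborel (\<lambda>\<xi>::'a. complex_of_real (exp (- T * (norm \<xi>)\<^sup>2)))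
      (of_real ((pi / T) powr (DIM('a) / 2)))"
    using gaussian_Fourier[OF T, of "0::'a"] by simp
  then show ?thesis
    unfolding has_bochner_integral_iff by (simp add: complex_of_real_integrable_eq) 
qed

text \<open>
  A factor \<open>|z|\<close> is paid for by doubling the variance and contributes \<open>\<surd>T\<close>, because
  \<open>x \<le> 2 exp (x\<^sup>2 / 8)\<close>.
\<close>

lemma norm_times_gaussian_le:
  fixes z :: "'a::real_normed_vector"
  assumes T: "0 < T"
  shows "norm z * exp (- (norm z)\<^sup>2 / (4 * T)) \<le> 2 * sqrt T * exp (- (norm z)\<^sup>2 / (8 * T))"
proof -
  define x where "x = norm z / sqrt T"
  have "0 \<le> (x / 2 - 1)\<^sup>2" by simp
  then have "x \<le> 1 + x\<^sup>2 / 4" by (simp add: power2_eq_square algebra_simps)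
  then have "x \<le> 2 * (1 + x\<^sup>2 / 8)" by simp
  also have "1 + x\<^sup>2 / 8 \<le> exp (x\<^sup>2 / 8)" by (rule exp_ge_add_one_self)
  finally have "x \<le> 2 * exp (x\<^sup>2 / 8)" by simp
  moreover have "x\<^sup>2 = (norm z)\<^sup>2 / T" using T by (simp add: x_def power_divide)
  ultimately have "norm z / sqrt T \<le> 2 * exp ((norm z)\<^sup>2 / (8 * T))" by (simp add: x_def mult.commute)
  then have "norm z \<le> 2 * sqrt T * exp ((norm z)\<^sup>2 / (8 * T))" using T by (simp add: field_simps)
  then have "norm z * exp (- (norm z)\<^sup>2 / (4 * T))
      \<le> 2 * sqrt T * exp ((norm z)\<^sup>2 / (8 * T)) * exp (- (norm z)\<^sup>2 / (4 * T))"
    by (intro mult_right_mono) auto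
  also have "\<dots> = 2 * sqrt T * exp ((norm z)\<^sup>2 / (8 * T) + - (norm z)\<^sup>2 / (4 * T))"
    by (simp only: exp_add mult.assoc)
  also have "(norm z)\<^sup>2 / (8 * T) + - (norm z)\<^sup>2 / (4 * T) = - (norm z)\<^sup>2 / (8 * T)"
    using T by (simp add: field_simps)
  finally show ?thesis .
qed

section \<open>The Bromwich integral of the stable exponent\<close>

text \<open>
  The parameter \<open>a\<close> is half of the order \<open>\<alpha>\<close> of the equation: as a function of \<open>\<mu> = |\<xi>|\<^sup>2\<close> the
  symbol is \<open>\<mu>\<^sup>a\<close>.
\<close>

locale stable_index =
  fixes a :: real
  assumes half_less_a: "1/2 < a" and a_less_1: "a < 1"
begin

text \<open>
  The derivatives of \<open>exp (- z\<^sup>a)\<close> are linear combinations of these functions, which is why a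
  general power \<open>p\<close> is carried along.
\<close>

definition damped_power :: "real \<Rightarrow> complex \<Rightarrow> complex" where
  "damped_power p z = z powr of_real p * exp (- (z powr of_real a))"

definition \<kappa> :: real where "\<kappa> = cos (a * pi / 2)"

lemma a_pos: "0 < a" using half_less_a by simp

lemma \<kappa>_pos: "0 < \<kappa>"
  unfolding \<kappa>_def using a_pos a_less_1 by (intro cos_gt_zero_pi)
      (auto simp: field_simps intro: less_le_trans[of _ 0])

text \<open>
  In the right half plane \<open>z\<^sup>a\<close> stays within the angle \<open>a \<pi> / 2\<close> of the positive axis, and \<open>\<kappa>\<close> is
  the cosine of that angle.
\<close>

lemma norm_damped_power_le:
  assumes "0 < Re z"
  shows "norm (damped_power p z) \<le> norm z powr p * exp (- \<kappa> * norm z powr a)"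
proof -
  have z: "z \<noteq> 0" using assms by auto
  have im: "\<bar>Im (Ln z)\<bar> < pi / 2" using assms z Re_Ln_pos_lt by blast
  have "z powr of_real a = exp (of_real a * Ln z)" using z by (simp add: powr_def)
  then have re: "Re (z powr of_real a) = norm z powr a * cos (a * Im (Ln z))"
    using z by (simp add: Re_exp powr_def)
  have "cos (a * pi / 2) \<le> cos \<bar>a * Im (Ln z)\<bar>"
  proof (rule cos_monotone_0_pi_le)
    show "\<bar>a * Im (Ln z)\<bar> \<le> a * pi / 2" using im a_pos by (simp add: abs_mult)
    show "a * pi / 2 \<le> pi" using a_less_1 a_pos by (simp add: field_simps)
  qed simp
  then have "\<kappa> * norm z powr a \<le> Re (z powr of_real a)"
    unfolding re \<kappa>_def by (simp add: mult.commute mult_left_mono)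
  then show ?thesis unfolding damped_power_def norm_mult
      by (intro mult_mono) (auto simp: norm_powr_real_powr')
qed

lemma damped_power_bound:
  assumes "s \<le> p"
  obtains C where "0 < C" "\<And>z. 0 < Re z \<Longrightarrow> norm (damped_power p z) \<le> C * norm z powr s"
proof -
  obtain C where C: "C > 0" "\<And>x. x > 0 \<Longrightarrow> x powr (p - s) * exp (- \<kappa> * x powr a) \<le> C"
    using powr_times_exp_bounded[of "p - s" \<kappa> a] assms \<kappa>_pos a_pos by auto
  show ?thesis
  proof (rule that[OF C(1)])
    fix z :: complex assume z: "0 < Re z"
    then have n: "norm z > 0" by auto
    have "norm z powr p * exp (- \<kappa> * norm z powr a)
        = norm z powr s * (norm z powr (p - s) * exp (- \<kappa> * norm z powr a))"
      by (simp add: mult.assoc[symmetric] flip: powr_add)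
    also have "\<dots> \<le> norm z powr s * C" by (intro mult_left_mono C n) auto
    finally show "norm (damped_power p z) \<le> C * norm z powr s" using norm_damped_power_le[OF z, of p]
        by (simp add: mult.commute)
  qed
qed

lemma damped_power_has_derivative:
  assumes "0 < Re z"
  shows "(damped_power p has_field_derivative
      (of_real p * damped_power (p - 1) z - of_real a * damped_power (p - 1 + a) z)) (at z)"
proof -
  have z: "z \<notin> \<real>\<^sub>\<le>\<^sub>0" using assms complex_nonpos_Reals_iff by auto
  have "(damped_power p has_field_derivative
      (of_real p * z powr (of_real p - 1)) * exp (- (z powr of_real a))
       + exp (- (z powr of_real a)) * (- (of_real a * z powr (of_real a - 1))) * z powr of_real p) (at z)"
    unfolding damped_power_def[abs_def] using z by (auto intro!: derivative_eq_intros)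
  moreover have "z powr of_real (p - 1 + a) = z powr (of_real a - 1) * z powr of_real p"
    by (simp add: algebra_simps flip: powr_add)
  ultimately show ?thesis by (simp add: damped_power_def algebra_simps)
qed

lemma damped_power_holomorphic: "damped_power p holomorphic_on {z. 0 < Re z}"
  by (intro holomorphic_onI) (use damped_power_has_derivative field_differentiable_def
      field_differentiable_at_within in blast)


definition bromwich_fun :: "real \<Rightarrow> real \<Rightarrow> complex \<Rightarrow> complex" where
  "bromwich_fun p \<tau> z = exp (of_real \<tau> * z) * damped_power p z"

text \<open>
  The line \<open>Re z = 1\<close> is an arbitrary choice; the value is the same on all lines, by
  \<open>bromwich_eq\<close>.
\<close>

definition bromwich :: "real \<Rightarrow> real \<Rightarrow> complex" where
  "bromwich p \<tau> = (LINT y|lborel. bromwich_fun p \<tau> (Complex 1 y))"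

lemma bromwich_fun_bound:
  assumes "s \<le> p"
  obtains C where "0 < C" "\<And>\<tau> z. 0 < Re z \<Longrightarrow> norm (bromwich_fun p \<tau> z) \<le> exp (\<tau> * Re z) * C * norm z powr s"
proof -
  obtain C where C: "0 < C" "\<And>z. 0 < Re z \<Longrightarrow> norm (damped_power p z) \<le> C * norm z powr s"
    using damped_power_bound[OF assms] by blast
  show ?thesis
    by (rule that[OF C(1)]) (use C(2) in \<open>simp add: bromwich_fun_def norm_mult mult.assoc\<close>)
qed

lemma bromwich_fun_holomorphic: "bromwich_fun p \<tau> holomorphic_on {z. 0 < Re z}"
  unfolding bromwich_fun_def[abs_def] by (intro holomorphic_intros damped_power_holomorphic)

lemma bromwich_fun_continuous:
  assumes "0 < \<sigma>" shows "continuous_on UNIV (\<lambda>y. bromwich_fun p \<tau> (Complex \<sigma> y))"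
  by (rule continuous_on_compose2[OF holomorphic_on_imp_continuous_on[OF bromwich_fun_holomorphic]])
     (use assms in \<open>auto simp: Complex_eq intro!: continuous_intros\<close>)

lemma damped_power_continuous:
  assumes "0 < \<sigma>" shows "continuous_on UNIV (\<lambda>y. damped_power p (Complex \<sigma> y))"
  by (rule continuous_on_compose2[OF holomorphic_on_imp_continuous_on[OF damped_power_holomorphic]])
     (use assms in \<open>auto simp: Complex_eq intro!: continuous_intros\<close>)

lemma bromwich_fun_integrable:
  assumes "0 < \<sigma>" shows "integrable lborel (\<lambda>y. bromwich_fun p \<tau> (Complex \<sigma> y))"
proof -
  obtain C where C: "0 < C" "\<And>z. 0 < Re z \<Longrightarrow> norm (bromwich_fun p \<tau> z)
      \<le> exp (\<tau> * Re z) * C * norm z powr min p (-2)"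
    using bromwich_fun_bound[of "min p (-2)" p] by (metis min.cobounded1)
  show ?thesis
    by (rule vertical_line_integral_bound(1)[where s="min p (-2)" and C="exp (\<tau> * \<sigma>) * C"])
       (use assms C(1) C(2)[of "Complex \<sigma> y" for y] bromwich_fun_continuous in auto)
qed

lemma bromwich_shift:
  assumes "0 < \<sigma>\<^sub>1" "\<sigma>\<^sub>1 < \<sigma>\<^sub>2"
  shows "(LINT y|lborel. bromwich_fun p \<tau> (Complex \<sigma>\<^sub>1 y))
      = (LINT y|lborel. bromwich_fun p \<tau> (Complex \<sigma>\<^sub>2 y))"
proof -
  define s where "s = min p (-2)"
  obtain C where C: "0 < C" "\<And>z. 0 < Re z \<Longrightarrow> norm (bromwich_fun p \<tau> z) \<le> exp (\<tau> * Re z) * C * norm z powr s"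
    using bromwich_fun_bound[of s p] by (metis min.cobounded1 s_def)
  define E where "E = exp (\<bar>\<tau>\<bar> * \<sigma>\<^sub>2) * C"
  show ?thesis
  proof (rule vertical_line_integral_shift[where B="\<lambda>y. E * y powr s"])
    fix z assume z: "\<sigma>\<^sub>1 \<le> Re z" "Re z \<le> \<sigma>\<^sub>2" "1 \<le> \<bar>Im z\<bar>"
    have "\<tau> * Re z \<le> \<bar>\<tau>\<bar> * \<sigma>\<^sub>2"
      using z assms by (intro mult_mono) auto
    then have "exp (\<tau> * Re z) * C \<le> E" unfolding E_def using C by simp
    moreover have "norm z powr s \<le> \<bar>Im z\<bar> powr s"
      using z abs_Im_le_cmod[of z] by (intro powr_mono2') (auto simp: s_def)
    ultimately have "exp (\<tau> * Re z) * C * norm z powr s \<le> E * \<bar>Im z\<bar> powr s"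
      using C by (intro mult_mono) (auto simp: E_def)
    then show "norm (bromwich_fun p \<tau> z) \<le> E * \<bar>Im z\<bar> powr s" using C(2)[of z] z assms by linarith
  next
    have "s < 0" by (simp add: s_def)
    then have "(\<lambda>n. real n powr s) \<longlonglongrightarrow> 0"
      using tendsto_neg_powr[OF _ filterlim_real_sequentially] by blast
    then show "(\<lambda>n. E * real n powr s) \<longlonglongrightarrow> 0" by (rule tendsto_mult_right_zero)
  qed (use assms bromwich_fun_integrable bromwich_fun_holomorphic in auto)
qed

lemma bromwich_eq:
  assumes "0 < \<sigma>" shows "bromwich p \<tau> = (LINT y|lborel. bromwich_fun p \<tau> (Complex \<sigma> y))"
proof (cases \<sigma> "1::real" rule: linorder_cases)
  case less
  then show ?thesis unfolding bromwich_def using bromwich_shift[OF assms] by simp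
next
  case greater
  then show ?thesis unfolding bromwich_def by (intro bromwich_shift) simp
qed (simp add: bromwich_def)

text \<open>
  The derivative of \<open>bromwich_fun p \<tau>\<close> along the line integrates to zero. Each use of the identity
  lowers the power in the integrand by at least \<open>1 - a\<close> at the price of one factor \<open>1 / \<tau>\<close>.
\<close>

lemma bromwich_by_parts:
  "of_real \<tau> * bromwich p \<tau> = of_real a * bromwich (p - 1 + a) \<tau> - of_real p * bromwich (p - 1) \<tau>"
proof -
  let ?F = "\<lambda>y. bromwich_fun p \<tau> (Complex 1 y)"
  let ?F' = "\<lambda>y. \<i> * (of_real \<tau> * bromwich_fun p \<tau> (Complex 1 y)
      + (of_real p * bromwich_fun (p - 1) \<tau> (Complex 1 y) - of_real a
          * bromwich_fun (p - 1 + a) \<tau> (Complex 1 y)))"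
  have i: "integrable lborel (\<lambda>y. bromwich_fun q \<tau> (Complex 1 y))" for q
      by (rule bromwich_fun_integrable) simp
  have lim: "(?F \<longlongrightarrow> 0) F" if F: "filterlim (\<lambda>y::real. \<bar>y\<bar>) at_top F" for F
  proof -
    define s where "s = min p (-2)"
    obtain C where C: "0 < C" "\<And>z. 0 < Re z \<Longrightarrow> norm (bromwich_fun p \<tau> z)
        \<le> exp (\<tau> * Re z) * C * norm z powr s"
      using bromwich_fun_bound[of s p] by (metis min.cobounded1 s_def)
    have "((\<lambda>y. exp \<tau> * C * \<bar>y\<bar> powr s) \<longlongrightarrow> 0) F"
      by (intro tendsto_mult_right_zero tendsto_neg_powr F) (simp add: s_def)
    moreover have "eventually (\<lambda>y. norm (?F y) \<le> exp \<tau> * C * \<bar>y\<bar> powr s) F"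
    proof -
      have "eventually (\<lambda>y. 1 \<le> \<bar>y\<bar>) F" using F by (simp add: filterlim_at_top)
      then show ?thesis
      proof eventually_elim
        case (elim y)
        have "norm (Complex 1 y) powr s \<le> \<bar>y\<bar> powr s"
          using elim abs_Im_le_cmod[of "Complex 1 y"] by (intro powr_mono2') (auto simp: s_def)
        then have "exp \<tau> * C * norm (Complex 1 y) powr s \<le> exp \<tau> * C * \<bar>y\<bar> powr s"
          using C by (intro mult_left_mono) auto
        moreover have "norm (?F y) \<le> exp \<tau> * C * norm (Complex 1 y) powr s"
          using C(2)[of "Complex 1 y"] by simp
        ultimately show ?case by linarith
      qed
    qed
    ultimately show ?thesis by (rule Lim_null_comparison[rotated])
  qed
  have "(LINT y|lborel. ?F' y) = 0"
  proof (rule integral_derivative_whole_line[of ?F])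
    fix y :: real
    let ?D = "\<lambda>z. of_real \<tau> * bromwich_fun p \<tau> z
        + (of_real p * bromwich_fun (p - 1) \<tau> z - of_real a * bromwich_fun (p - 1 + a) \<tau> z)"
    have "(bromwich_fun p \<tau> has_field_derivative ?D z) (at z)" if "0 < Re z" for z
      unfolding bromwich_fun_def[abs_def] by (rule derivative_eq_intros damped_power_has_derivative that
          refl)+ (simp add: algebra_simps)
    then have d: "(bromwich_fun p \<tau> has_field_derivative ?D (Complex 1 y)) (at (Complex 1 y))"
      by simp
    have c: "(Complex 1 has_vector_derivative \<i>) (at y)"
      unfolding Complex_eq by (auto intro!: derivative_eq_intros)
    have "((bromwich_fun p \<tau> \<circ> Complex 1) has_vector_derivative (\<i> * ?D (Complex 1 y))) (at y)"
      by (rule field_vector_diff_chain_at[OF c d])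
    then show "(?F has_vector_derivative ?F' y) (at y)" by (simp only: o_def)
  next
    show "continuous_on UNIV ?F'" by (intro continuous_intros bromwich_fun_continuous) auto
    show "integrable lborel ?F'" by (intro integrable_mult_right Bochner_Integration.integrable_add
        Bochner_Integration.integrable_diff i)
    show "(?F \<longlongrightarrow> 0) at_top"
      by (rule lim) real_asymp
    show "(?F \<longlongrightarrow> 0) at_bot"
      by (rule lim) real_asymp
  qed
  then have "\<i> * (of_real \<tau> * bromwich p \<tau> + (of_real p * bromwich (p - 1) \<tau> - of_real a
      * bromwich (p - 1 + a) \<tau>)) = 0"
    by (simp add: bromwich_def i)
  then have "of_real \<tau> * bromwich p \<tau> + (of_real p * bromwich (p - 1) \<tau> - of_real a
      * bromwich (p - 1 + a) \<tau>) = 0"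
    by (simp only: mult_eq_0_iff) simp
  then show ?thesis by (simp only: eq_neg_iff_add_eq_0[symmetric] minus_diff_eq)
qed

text \<open>
  For \<open>s \<le> -2\<close> the integral over the line \<open>Re z = 1 / \<tau>\<close> converges absolutely and scaling gives
  the power of \<open>\<tau>\<close>. Integration by parts passes from the exponent \<open>s - 1\<close> to \<open>s\<close>. That \<open>s\<close> may be
  any number up to \<open>p\<close>, however negative, expresses the rapid decay as \<open>\<tau>\<close> tends to zero.
\<close>

lemma bromwich_bound:
  assumes "s \<le> p"
  obtains C where "0 < C" "\<And>\<tau>. 0 < \<tau> \<Longrightarrow> norm (bromwich p \<tau>) \<le> C * \<tau> powr (- 1 - s)"
proof -
  have *: "\<exists>C>0. \<forall>\<tau>>0. norm (bromwich p \<tau>) \<le> C * \<tau> powr (- 1 - s)" if "s \<le> p" "s \<le> real n - 2" for p s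
      and n :: nat
    using that
  proof (induction n arbitrary: p s)
    case 0
    obtain C where C: "0 < C" "\<And>\<tau> z. 0 < Re z \<Longrightarrow> norm (bromwich_fun p \<tau> z)
        \<le> exp (\<tau> * Re z) * C * norm z powr s"
      using bromwich_fun_bound[OF 0(1)] by blast
    have "norm (bromwich p \<tau>) \<le> pi * (exp 1 * C) * \<tau> powr (- 1 - s)" if "0 < \<tau>" for \<tau>
    proof -
      have "norm (LINT y|lborel. bromwich_fun p \<tau> (Complex (1/\<tau>) y))
          \<le> pi * (exp 1 * C) * (1/\<tau>) powr (s + 1)"
        by (rule vertical_line_integral_bound(2)[where s="s" and C="exp 1 * C"])
           (use that 0 C(1) C(2)[of "Complex (1/\<tau>) y" \<tau> for y] bromwich_fun_continuous in auto)
      also have "(1/\<tau>) powr (s + 1) = \<tau> powr (- 1 - s)"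
        using that powr_minus_divide[of \<tau> "s + 1"] by (simp add: powr_divide algebra_simps)
      finally show ?thesis using bromwich_eq[of "1/\<tau>"] that by simp
    qed
    then show ?case using C(1) by (intro exI[of _ "pi * (exp 1 * C)"]) auto
  next
    case (Suc n)
    obtain C1 where C1: "0 < C1" "\<And>\<tau>. 0 < \<tau> \<Longrightarrow> norm (bromwich (p - 1) \<tau>) \<le> C1 * \<tau> powr (- 1 - (s - 1))"
      using Suc.IH[of "s - 1" "p - 1"] Suc.prems by auto
    obtain C2 where C2: "0 < C2" "\<And>\<tau>. 0 < \<tau> \<Longrightarrow> norm (bromwich (p - 1 + a) \<tau>) \<le> C2 * \<tau> powr (- 1 - (s - 1))"
      using Suc.IH[of "s - 1" "p - 1 + a"] Suc.prems a_pos by auto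
    have "norm (bromwich p \<tau>) \<le> (a * C2 + \<bar>p\<bar> * C1) * \<tau> powr (- 1 - s)" if "0 < \<tau>" for \<tau>
    proof -
      have "\<tau> * norm (bromwich p \<tau>) = norm (of_real \<tau> * bromwich p \<tau>)" using that by (simp add: norm_mult)
      also have "\<dots> \<le> a * norm (bromwich (p - 1 + a) \<tau>) + \<bar>p\<bar> * norm (bromwich (p - 1) \<tau>)"
        unfolding bromwich_by_parts using a_pos
            norm_triangle_ineq4[of "of_real a * bromwich (p - 1 + a) \<tau>" "of_real p * bromwich (p - 1) \<tau>"]
        by (simp add: norm_mult)
      also have "\<dots> \<le> a * (C2 * \<tau> powr (- 1 - (s - 1))) + \<bar>p\<bar> * (C1 * \<tau> powr (- 1 - (s - 1)))"
        using C1(2)[OF that] C2(2)[OF that] a_pos by (intro add_mono mult_left_mono) auto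
      also have "\<tau> powr (- 1 - (s - 1)) = \<tau> * \<tau> powr (- 1 - s)"
        using that powr_add[of \<tau> 1 "- 1 - s"] by simp
      finally have "\<tau> * norm (bromwich p \<tau>) \<le> \<tau> * ((a * C2 + \<bar>p\<bar> * C1) * \<tau> powr (- 1 - s))"
          by (simp add: algebra_simps)
      then show ?thesis using that by simp
    qed
    moreover have "0 < a * C2 + \<bar>p\<bar> * C1" using a_pos C1 C2 by (simp add: add_pos_nonneg)
    ultimately show ?case by blast
  qed
  obtain n :: nat where n: "s + 2 \<le> real n" using real_arch_simple by blast
  have "\<exists>C>0. \<forall>\<tau>>0. norm (bromwich p \<tau>) \<le> C * \<tau> powr (- 1 - s)"
    by (rule *[of s p n]) (use assms n in auto)
  then obtain C where C: "0 < C" and CJ: "\<forall>\<tau>>0. norm (bromwich p \<tau>) \<le> C * \<tau> powr (- 1 - s)"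
    by blast
  show ?thesis by (rule that[OF C]) (use CJ in simp)
qed

text \<open>
  Without the damping factor the integral over the line \<open>Re z = 1 / \<tau>\<close> is exactly a multiple of
  \<open>\<tau>\<close> to the power \<open>- 1 - p\<close>. The factor differs from one by at most \<open>|z|\<^sup>a\<close>, so the error is an
  integral of the same kind with \<open>a\<close> added to the exponent, and it converges absolutely if
  \<open>p + a \<le> -2\<close>.
\<close>

lemma bromwich_asymp_base:
  assumes "p + a \<le> -2"
  shows "\<exists>K C. \<forall>\<tau>>0. norm (bromwich p \<tau> - K * of_real (\<tau> powr (- 1 - p))) \<le> C * \<tau> powr (- 1 - p - a)"
proof -
  define f where "f \<tau> z = exp (of_real \<tau> * z) * z powr of_real p" for \<tau> :: real and z :: complex
  define K where "K = (LINT y|lborel. f 1 (Complex 1 y))"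
  have hol: "f \<tau> holomorphic_on {z. 0 < Re z}" for \<tau>
  proof (rule holomorphic_onI)
    fix z assume "z \<in> {z. 0 < Re z}"
    then have "z \<notin> \<real>\<^sub>\<le>\<^sub>0" using complex_nonpos_Reals_iff by auto
    then have "(f \<tau> has_field_derivative
      exp (of_real \<tau> * z) * (of_real p * z powr (of_real p - 1)) + exp (of_real \<tau> * z) * of_real \<tau>
          * z powr of_real p) (at z)"
      unfolding f_def[abs_def] by (auto intro!: derivative_eq_intros)
    then have "f \<tau> field_differentiable at z"
      by (auto simp: field_differentiable_def)
    then show "f \<tau> field_differentiable at z within {z. 0 < Re z}"
      by (rule field_differentiable_at_within)
  qed
  have fc: "continuous_on UNIV (\<lambda>y. f \<tau> (Complex \<sigma> y))" if "0 < \<sigma>" for \<sigma> \<tau>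
    by (rule continuous_on_compose2[OF holomorphic_on_imp_continuous_on[OF hol]])
       (use that in \<open>auto simp: Complex_eq intro!: continuous_intros\<close>)
  have fi: "integrable lborel (\<lambda>y. f \<tau> (Complex \<sigma> y))" if "0 < \<sigma>" for \<sigma> \<tau>
    by (rule vertical_line_integral_bound(1)[where s=p and C="exp (\<tau> * \<sigma>)"])
       (use that assms a_pos fc in \<open>auto simp: f_def norm_mult norm_powr_real_powr'\<close>)
  have scale: "(LINT y|lborel. f \<tau> (Complex (1/\<tau>) y)) = K * of_real (\<tau> powr (- 1 - p))" if t: "0 < \<tau>" for \<tau>
  proof -
    have e: "f \<tau> (Complex (1/\<tau>) (0 + (1/\<tau>) * v)) = of_real (\<tau> powr (- p)) * f 1 (Complex 1 v)" for v
    proof -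
      have c: "Complex (1/\<tau>) (0 + (1/\<tau>) * v) = of_real (1/\<tau>) * Complex 1 v"
        by (simp add: complex_eq_iff)
      have r: "0 < 1/\<tau>" and nz: "Complex 1 v \<noteq> 0" using t by (auto simp: complex_eq_iff)
      have "Ln (of_real (1/\<tau>) * Complex 1 v) = of_real (ln (1/\<tau>)) + Ln (Complex 1 v)"
        using Ln_times_of_real[OF r nz] Ln_of_real[OF r] by metis
      then have "(of_real (1/\<tau>) * Complex 1 v) powr of_real p
          = exp (of_real (p * ln (1/\<tau>))) * Complex 1 v powr of_real p"
        using t nz by (simp add: powr_def algebra_simps flip: exp_add)
      also have "exp (of_real (p * ln (1/\<tau>))) = complex_of_real (\<tau> powr (-p))"
        unfolding exp_of_real using t by (simp add: powr_def ln_div)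
      finally show ?thesis unfolding c f_def using t by simp
    qed
    have "(LINT y|lborel. f \<tau> (Complex (1/\<tau>) y))
        = \<bar>1/\<tau>\<bar> *\<^sub>R (LINT v|lborel. f \<tau> (Complex (1/\<tau>) (0 + (1/\<tau>) * v)))"
      by (rule lborel_integral_real_affine) (use t in simp)
    also have "\<dots> = \<bar>1/\<tau>\<bar> *\<^sub>R (of_real (\<tau> powr (- p)) * K)"
      unfolding e K_def by (subst integral_mult_right_zero) simp
    also have "\<dots> = K * of_real (\<tau> powr (- 1 - p))"
      using t powr_add[of \<tau> "-1" "-p"] by (simp add: scaleR_conv_of_real powr_minus_divide)
    finally show ?thesis .
  qed
  have "norm (bromwich p \<tau> - K * of_real (\<tau> powr (- 1 - p))) \<le> pi * exp 1 * \<tau> powr (- 1 - p - a)"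
      if t: "0 < \<tau>" for \<tau>
  proof -
    have "bromwich p \<tau> - K * of_real (\<tau> powr (- 1 - p))
        = (LINT y|lborel. bromwich_fun p \<tau> (Complex (1/\<tau>) y) - f \<tau> (Complex (1/\<tau>) y))"
      unfolding scale[OF t, symmetric] using bromwich_eq[of "1/\<tau>"] bromwich_fun_integrable[of "1/\<tau>"]
          fi[of "1/\<tau>"] t by simp
    moreover have "norm (LINT y|lborel. bromwich_fun p \<tau> (Complex (1/\<tau>) y) - f \<tau> (Complex (1/\<tau>) y))
        \<le> pi * exp 1 * (1/\<tau>) powr (p + a + 1)"
    proof (rule vertical_line_integral_bound(2)[of "1/\<tau>" "p + a" "exp 1" "\<lambda>z. bromwich_fun p \<tau> z - f \<tau> z"])
      show "continuous_on UNIV (\<lambda>y. bromwich_fun p \<tau> (Complex (1/\<tau>) y) - f \<tau> (Complex (1/\<tau>) y))"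
        using t by (intro continuous_intros bromwich_fun_continuous fc) auto
      fix y
      define z where "z = Complex (1/\<tau>) y"
      have z: "0 < Re z" "\<tau> * Re z = 1" using t by (auto simp: z_def)
      have "0 \<le> Re (z powr of_real a)"
      proof -
        have "\<bar>Im (Ln z)\<bar> < pi/2" using Re_Ln_pos_lt_imp z by blast
        moreover have "a * \<bar>Im (Ln z)\<bar> \<le> 1 * \<bar>Im (Ln z)\<bar>"
          using a_less_1 by (intro mult_right_mono) auto
        ultimately have "\<bar>a * Im (Ln z)\<bar> \<le> pi/2" using a_pos by (simp only: abs_mult abs_of_pos)
        then have "0 \<le> cos (a * Im (Ln z))" by (intro cos_ge_zero) linarith+
        then show ?thesis using z by (auto simp: powr_def Re_exp)
      qed
      then have e: "norm (exp (- (z powr of_real a)) - 1) \<le> norm z powr a"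
        using norm_exp_minus_minus_1_le[of "z powr of_real a"] by (simp add: norm_powr_real_powr')
      have "bromwich_fun p \<tau> z - f \<tau> z = exp (of_real \<tau> * z) * z powr of_real p
          * (exp (- (z powr of_real a)) - 1)"
        by (simp add: bromwich_fun_def f_def damped_power_def algebra_simps)
      also have "norm \<dots> = exp 1 * norm z powr p * norm (exp (- (z powr of_real a)) - 1)"
        using z by (simp add: norm_mult norm_powr_real_powr')
      also have "\<dots> \<le> exp 1 * norm z powr p * norm z powr a"
        by (intro mult_left_mono e) auto
      finally show "norm (bromwich_fun p \<tau> (Complex (1/\<tau>) y) - f \<tau> (Complex (1/\<tau>) y))
          \<le> exp 1 * norm (Complex (1/\<tau>) y) powr (p + a)"
        by (simp add: z_def powr_add mult.assoc)
    qed (use t assms in auto)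
    moreover have "(1/\<tau>) powr (p + a + 1) = \<tau> powr (- 1 - p - a)"
      using t powr_minus_divide[of \<tau> "p + a + 1"] by (simp add: powr_divide algebra_simps)
    ultimately show ?thesis by simp
  qed
  then show ?thesis by blast
qed

text \<open>
  Integration by parts: the term with \<open>p - 1 + a\<close> is already of the order of the error.
\<close>

lemma bromwich_asymp_step:
  assumes "\<exists>K C. \<forall>\<tau>>0. norm (bromwich (p - 1) \<tau> - K * of_real (\<tau> powr (- 1 - (p - 1))))
      \<le> C * \<tau> powr (- 1 - (p - 1) - a)"
  shows "\<exists>K C. \<forall>\<tau>>0. norm (bromwich p \<tau> - K * of_real (\<tau> powr (- 1 - p))) \<le> C * \<tau> powr (- 1 - p - a)"
proof -
  from assms obtain K C1 where
    C1': "\<forall>\<tau>>0. norm (bromwich (p - 1) \<tau> - K * of_real (\<tau> powr (- 1 - (p - 1))))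
        \<le> C1 * \<tau> powr (- 1 - (p - 1) - a)"
    by blast
  have C1: "norm (bromwich (p - 1) \<tau> - K * of_real (\<tau> powr (- 1 - (p - 1))))
      \<le> C1 * \<tau> powr (- 1 - (p - 1) - a)"
    if "0 < \<tau>" for \<tau>
    using C1' that by blast
  obtain C2 where C2: "0 < C2" "\<And>\<tau>. 0 < \<tau> \<Longrightarrow> norm (bromwich (p - 1 + a) \<tau>) \<le> C2 * \<tau> powr (- 1 - (p - 1 + a))"
    using bromwich_bound[of "p - 1 + a"] by blast
  have "norm (bromwich p \<tau> - (- of_real p * K) * of_real (\<tau> powr (- 1 - p)))
      \<le> (a * C2 + \<bar>p\<bar> * C1) * \<tau> powr (- 1 - p - a)" if t: "0 < \<tau>" for \<tau>
  proof -
    have e1: "\<tau> powr (- 1 - (p - 1)) = \<tau> * \<tau> powr (- 1 - p)" using t powr_add[of \<tau> 1 "- 1 - p"] by simp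
    have ex: "- 1 - (p - 1) - a = - p - a" "- 1 - (p - 1 + a) = - p - a" by simp_all
    have ex3: "1 + (- 1 - p - a) = - p - a" by simp
    have "\<tau> powr (- p - a) = \<tau> * \<tau> powr (- 1 - p - a)"
      using t powr_add[of \<tau> 1 "- 1 - p - a"] unfolding ex3 by simp
    note e2 = this[folded ex(1)] this[folded ex(2)]
    have "\<tau> * norm (bromwich p \<tau> - (- of_real p * K) * of_real (\<tau> powr (- 1 - p)))
      = norm (of_real \<tau> * (bromwich p \<tau> - (- of_real p * K) * of_real (\<tau> powr (- 1 - p))))"
      using t by (simp only: norm_mult norm_of_real abs_of_pos)
    also have "of_real \<tau> * (bromwich p \<tau> - (- of_real p * K) * of_real (\<tau> powr (- 1 - p)))
      = of_real a * bromwich (p - 1 + a) \<tau> - of_real p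
          * (bromwich (p - 1) \<tau> - K * of_real (\<tau> powr (- 1 - (p - 1))))"
      unfolding right_diff_distrib[of "of_real \<tau>"] bromwich_by_parts e1 by (simp add: algebra_simps)
    also have "norm \<dots> \<le> a * norm (bromwich (p - 1 + a) \<tau>) + \<bar>p\<bar>
        * norm (bromwich (p - 1) \<tau> - K * of_real (\<tau> powr (- 1 - (p - 1))))"
      using a_pos norm_triangle_ineq4[of "of_real a * bromwich (p - 1 + a) \<tau>" "of_real p
          * (bromwich (p - 1) \<tau> - K * of_real (\<tau> powr (- 1 - (p - 1))))"]
      by (simp add: norm_mult)
    also have "\<dots> \<le> a * (C2 * (\<tau> * \<tau> powr (- 1 - p - a))) + \<bar>p\<bar> * (C1 * (\<tau> * \<tau> powr (- 1 - p - a)))"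
      using C1[OF t] C2(2)[OF t] a_pos unfolding e2 by (intro add_mono mult_left_mono) auto
    finally have "\<tau> * norm (bromwich p \<tau> - (- of_real p * K) * of_real (\<tau> powr (- 1 - p)))
        \<le> \<tau> * ((a * C2 + \<bar>p\<bar> * C1) * \<tau> powr (- 1 - p - a))"
      by (simp add: algebra_simps)
    then show ?thesis using t by (simp only: mult_le_cancel_left_pos)
  qed
  then show ?thesis by blast
qed

text \<open>
  Three integrations by parts lead from the power \<open>a - 4\<close>, where the integral converges absolutely
  also after adding \<open>a\<close> to the exponent, to the power \<open>a - 1\<close>.
\<close>

lemma bromwich_asymp:
  "\<exists>K C. \<forall>\<tau>>0. norm (bromwich (a - 1) \<tau> - K * of_real (\<tau> powr (- a))) \<le> C * \<tau> powr (- 2 * a)"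
proof -
  have "\<exists>K C. \<forall>\<tau>>0. norm (bromwich (a - 1) \<tau> - K * of_real (\<tau> powr (- 1 - (a - 1))))
      \<le> C * \<tau> powr (- 1 - (a - 1) - a)"
    by (rule bromwich_asymp_step, rule bromwich_asymp_step, rule bromwich_asymp_step, rule
        bromwich_asymp_base) (use a_less_1 in simp)
  then show ?thesis by simp
qed

end

section \<open>The density of the stable subordinator\<close>

context stable_index
begin

text \<open>
  By Fubini on the line \<open>Re z = \<mu> / 2\<close> the transform is the integral of
  \<open>damped_power p z / (\<mu> - z)\<close>, which the Cauchy formula for the half plane evaluates.
\<close>

lemma Laplace_transform_bromwich:
  assumes \<mu>: "0 < \<mu>"
  shows "integrable lborel (\<lambda>\<tau>. indicator {0<..} \<tau> *\<^sub>R (exp (- of_real (\<tau> * \<mu>)) * bromwich p \<tau>))"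
    and "(LINT \<tau>|lborel. indicator {0<..} \<tau> *\<^sub>R (exp (- of_real (\<tau> * \<mu>)) * bromwich p \<tau>))
        = 2 * pi * damped_power p (of_real \<mu>)"
proof -
  \<comment> \<open>Any line between the origin and \<open>\<mu>\<close> would do: \<open>exp (\<tau> z)\<close> must grow slower than \<open>exp (\<tau> \<mu>)\<close>.\<close>
  define \<sigma> where "\<sigma> = \<mu> / 2"
  have \<sigma>: "0 < \<sigma>" "\<sigma> < \<mu>" using \<mu> by (auto simp: \<sigma>_def)
  define G where "G y = damped_power p (Complex \<sigma> y)" for y
  define w where "w y = of_real \<mu> - Complex \<sigma> y" for y
  define F where "F = (\<lambda>(\<tau>, y). (indicator {0<..} \<tau> *\<^sub>R exp (- (of_real \<tau> * w y))) * G y)"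
  have w: "Re (w y) = \<mu> - \<sigma>" for y by (simp add: w_def)
  have G[measurable]: "G \<in> borel_measurable borel"
    unfolding G_def[abs_def] by (intro borel_measurable_continuous_onI damped_power_continuous \<sigma>)
  have [measurable]: "w \<in> borel_measurable borel"
    unfolding w_def[abs_def] Complex_eq by (intro borel_measurable_continuous_onI continuous_intros)
  have Gi: "integrable lborel G"
    using bromwich_fun_integrable[OF \<sigma>(1), of p 0] by (simp add: G_def[abs_def] bromwich_fun_def)
  have Fh: "F (\<tau>, y) = indicator {0<..} \<tau> *\<^sub>R
      (exp (- of_real (\<tau> * \<mu>)) * bromwich_fun p \<tau> (Complex \<sigma> y))" for \<tau> y
    by (simp add: F_def bromwich_fun_def G_def w_def algebra_simps flip: exp_add)
  have Fn: "norm (F (\<tau>, y)) = indicator {0<..} \<tau> *\<^sub>R exp (- (\<tau> * (\<mu> - \<sigma>))) * norm (G y)" for \<tau> y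
    by (simp add: F_def norm_mult w)
  have Fm: "F \<in> borel_measurable (lborel \<Otimes>\<^sub>M lborel)"
    unfolding F_def split_beta' by measurable
  have F: "integrable (lborel \<Otimes>\<^sub>M lborel) F"
  proof (rule lborel_pair.Fubini_integrable[OF Fm])
    have "integrable lborel (\<lambda>t. indicator {0<..} t *\<^sub>R exp (- (t * (\<mu> - \<sigma>))))"
      using integrable_I0i_exp_mscale[of "\<mu> - \<sigma>"] \<sigma> by (simp add: set_integrable_def)
    then show "integrable lborel (\<lambda>\<tau>. LINT y|lborel. norm (F (\<tau>, y)))"
      unfolding Fn by simp
    show "AE \<tau> in lborel. integrable lborel (\<lambda>y. F (\<tau>, y))"
      unfolding Fh by (intro AE_I2 integrable_scaleR_right integrable_mult_right
          bromwich_fun_integrable[OF \<sigma>(1)])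
  qed
  have 1: "(LINT y|lborel. F (\<tau>, y)) = indicator {0<..} \<tau> *\<^sub>R (exp (- of_real (\<tau> * \<mu>)) * bromwich p \<tau>)"
      for \<tau>
    unfolding Fh bromwich_eq[OF \<sigma>(1)] by simp
  have 2: "(LINT \<tau>|lborel. F (\<tau>, y)) = G y / w y" for y
    unfolding F_def prod.case integral_mult_left_zero
    using integral_exp_half_line(2)[of "w y"] w[of y] \<sigma> by simp
  show "integrable lborel (\<lambda>\<tau>. indicator {0<..} \<tau> *\<^sub>R (exp (- of_real (\<tau> * \<mu>)) * bromwich p \<tau>))"
    using lborel_pair.integrable_fst'[OF F] unfolding 1 .
  have int2: "integrable lborel (\<lambda>y. G y / w y)"
  proof -
    have "integrable (lborel \<Otimes>\<^sub>M lborel) (\<lambda>(x, y). F (y, x))"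
      using lborel_pair.integrable_product_swap[OF F] .
    from lborel_pair.integrable_fst'[OF this] show ?thesis by (simp add: 2)
  qed
  have "(LINT \<tau>|lborel. LINT y|lborel. F (\<tau>, y)) = (LINT y|lborel. LINT \<tau>|lborel. F (\<tau>, y))"
    using lborel_pair.Fubini_integral[of "\<lambda>\<tau> y. F (\<tau>, y)"] F by (simp add: case_prod_eta)
  also have "\<dots> = (LINT y|lborel. damped_power p (Complex \<sigma> y) / (of_real \<mu> - Complex \<sigma> y))"
    unfolding 2 G_def w_def ..
  also have "\<dots> = 2 * pi * damped_power p (of_real \<mu>)"
  proof -
    define s where "s = min p (-1)"
    obtain C where C: "0 < C" "\<And>z. 0 < Re z \<Longrightarrow> norm (damped_power p z) \<le> C * norm z powr s"
      using damped_power_bound[of s p] by (metis min.cobounded1 s_def)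
    show ?thesis
    proof (rule half_plane_Cauchy_formula[OF \<sigma> damped_power_holomorphic, where B="\<lambda>n. C
        * max \<sigma> (real n) powr s"])
      show "integrable lborel (\<lambda>y. damped_power p (Complex \<sigma> y) / (of_real \<mu> - Complex \<sigma> y))"
        using int2 unfolding G_def w_def .
    next
      fix z :: complex and n :: nat assume z: "\<sigma> \<le> Re z" "real n \<le> norm z"
      then have "max \<sigma> (real n) \<le> norm z" using complex_Re_le_cmod[of z] by simp
      then have "norm z powr s \<le> max \<sigma> (real n) powr s"
        using \<sigma> by (intro powr_mono2') (auto simp: s_def)
      then have "C * norm z powr s \<le> C * max \<sigma> (real n) powr s" using C(1) by simp
      then show "norm (damped_power p z) \<le> C * max \<sigma> (real n) powr s" using C(2)[of z] z \<sigma> by linarith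
    next
      have "filterlim (\<lambda>n. max \<sigma> (real n)) at_top sequentially"
        by (rule filterlim_at_top_mono[OF filterlim_real_sequentially]) simp
      then show "(\<lambda>n. C * max \<sigma> (real n) powr s) \<longlonglongrightarrow> 0"
        by (intro tendsto_mult_right_zero tendsto_neg_powr) (auto simp: s_def)
    qed
  qed
  finally show "(LINT \<tau>|lborel. indicator {0<..} \<tau> *\<^sub>R (exp (- of_real (\<tau> * \<mu>)) * bromwich p \<tau>))
      = 2 * pi * damped_power p (of_real \<mu>)"
    unfolding 1 .
qed

lemma damped_power_of_real: "0 < \<mu> \<Longrightarrow> damped_power p (of_real \<mu>) = of_real (\<mu> powr p * exp (- (\<mu> powr a)))"
  by (simp add: damped_power_def powr_of_real exp_of_real flip: of_real_minus)

lemma Laplace_transform_Re_bromwich: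
  assumes "0 < \<mu>"
  shows "has_bochner_integral lborel (\<lambda>\<tau>. indicator {0<..} \<tau> * (exp (- (\<tau> * \<mu>)) * Re (bromwich p \<tau>)))
    (2 * pi * \<mu> powr p * exp (- (\<mu> powr a)))"
proof -
  have e: "Re (indicator {0<..} \<tau> *\<^sub>R (exp (- of_real (\<tau> * \<mu>)) * bromwich p \<tau>))
      = indicator {0<..} \<tau> * (exp (- (\<tau> * \<mu>)) * Re (bromwich p \<tau>))" for \<tau>
  proof -
    have "exp (- complex_of_real (\<tau> * \<mu>)) = complex_of_real (exp (- (\<tau> * \<mu>)))"
      by (simp add: exp_of_real flip: of_real_minus of_real_mult)
    then show ?thesis by simp
  qed
  show ?thesis
    using integrable_Re[OF Laplace_transform_bromwich(1)[OF assms, of p]]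
        integral_Re[OF Laplace_transform_bromwich(1)[OF assms, of p]]
    unfolding e Laplace_transform_bromwich(2)[OF assms] damped_power_of_real[OF assms]
        by (simp add: has_bochner_integral_iff)
qed

text \<open>
  The density of the \<open>a\<close>-stable subordinator at time one.
\<close>

definition \<eta> :: "real \<Rightarrow> real" where
  "\<eta> \<tau> = (if 0 < \<tau> then Re (bromwich 0 \<tau>) / (2 * pi) else 0)"

text \<open>
  One integration by parts. It makes the power \<open>a - 1\<close> of \<open>bromwich_asymp\<close> relevant and identifies
  the Laplace transform of \<open>\<tau> \<eta> \<tau>\<close> without differentiating under the integral.
\<close>

lemma \<tau>_\<eta>: "\<tau> * \<eta> \<tau> = indicator {0<..} \<tau> * (a / (2 * pi) * Re (bromwich (a - 1) \<tau>))"
proof (cases "0 < \<tau>")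
  case True
  have "Re (of_real \<tau> * bromwich 0 \<tau>) = Re (of_real a * bromwich (a - 1) \<tau>)"
    using bromwich_by_parts[of \<tau> 0] by (simp add: add.commute)
  then show ?thesis using True by (simp add: \<eta>_def)
qed (simp add: \<eta>_def)

lemma \<eta>_nonpos [simp]: "\<tau> \<le> 0 \<Longrightarrow> \<eta> \<tau> = 0" by (simp add: \<eta>_def)

lemma Laplace_transform_\<eta>:
  assumes "0 < \<mu>"
  shows "has_bochner_integral lborel (\<lambda>\<tau>. exp (- (\<tau> * \<mu>)) * \<eta> \<tau>) (exp (- (\<mu> powr a)))"
proof -
  have "exp (- (\<tau> * \<mu>)) * \<eta> \<tau> = 1 / (2 * pi) *
      (indicator {0<..} \<tau> * (exp (- (\<tau> * \<mu>)) * Re (bromwich 0 \<tau>)))" for \<tau>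
    by (simp add: \<eta>_def)
  then show ?thesis
    using has_bochner_integral_mult_right[OF Laplace_transform_Re_bromwich[OF assms, of 0], of "1 /
        (2 * pi)"] assms
    by simp
qed

lemma Laplace_transform_\<tau>_\<eta>:
  assumes "0 < \<mu>"
  shows "has_bochner_integral lborel (\<lambda>\<tau>. exp (- (\<tau> * \<mu>)) * (\<tau> * \<eta> \<tau>))
      (a * \<mu> powr (a - 1) * exp (- (\<mu> powr a)))"
proof -
  have "exp (- (\<tau> * \<mu>)) * (\<tau> * \<eta> \<tau>) = a / (2 * pi)
      * (indicator {0<..} \<tau> * (exp (- (\<tau> * \<mu>)) * Re (bromwich (a - 1) \<tau>)))" for \<tau>
    unfolding \<tau>_\<eta> by simp
  then show ?thesis
    using has_bochner_integral_mult_right[OF Laplace_transform_Re_bromwich[OF assms, of "a - 1"], of "a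
        / (2 * pi)"] assms
    by (simp add: mult.assoc)
qed

lemma \<eta>_measurable [measurable]: "\<eta> \<in> borel_measurable borel"
proof -
  have "integrable lborel (\<lambda>\<tau>. exp (- (\<tau> * 1)) * \<eta> \<tau>)"
    using Laplace_transform_\<eta>[of 1] unfolding has_bochner_integral_iff by simp
  from borel_measurable_integrable[OF this]
  have "(\<lambda>\<tau>. exp (- (\<tau> * 1)) * \<eta> \<tau>) \<in> borel_measurable borel"
    by simp
  then have "(\<lambda>\<tau>. exp \<tau> * (exp (- (\<tau> * 1)) * \<eta> \<tau>)) \<in> borel_measurable borel" by measurable
  moreover have "exp \<tau> * (exp (- (\<tau> * 1)) * \<eta> \<tau>) = \<eta> \<tau>" for \<tau>
    by (simp add: exp_minus field_simps)
  ultimately show ?thesis by (simp only:)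
qed

lemma \<eta>_bound:
  assumes "s \<le> 1 + a"
  obtains C where "0 < C" "\<And>\<tau>. 0 < \<tau> \<Longrightarrow> \<bar>\<eta> \<tau>\<bar> \<le> C * \<tau> powr (- s)"
proof -
  obtain C where C: "0 < C" "\<And>\<tau>. 0 < \<tau> \<Longrightarrow> norm (bromwich (a - 1) \<tau>) \<le> C * \<tau> powr (- 1 - (s - 2))"
    using bromwich_bound[of "s - 2" "a - 1"] assms by auto
  show ?thesis
  proof (rule that)
    show "0 < a / (2 * pi) * C" using a_pos C by simp
    fix \<tau> :: real assume t: "0 < \<tau>"
    have "\<tau> * \<bar>\<eta> \<tau>\<bar> = \<bar>\<tau> * \<eta> \<tau>\<bar>" using t by (simp add: abs_mult)
    also have "\<dots> = a / (2 * pi) * \<bar>Re (bromwich (a - 1) \<tau>)\<bar>"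
      unfolding \<tau>_\<eta> using t a_pos by (simp add: abs_mult)
    also have "\<dots> \<le> a / (2 * pi) * (C * \<tau> powr (- 1 - (s - 2)))"
      using C(2)[OF t] abs_Re_le_cmod[of "bromwich (a - 1) \<tau>"] a_pos by (intro mult_left_mono) auto
    also have "\<tau> powr (- 1 - (s - 2)) = \<tau> * \<tau> powr (- s)"
      using t powr_add[of \<tau> 1 "- s"] by simp
    finally have "\<tau> * \<bar>\<eta> \<tau>\<bar> \<le> \<tau> * (a / (2 * pi) * C * \<tau> powr (- s))" by (simp add: mult_ac)
    then show "\<bar>\<eta> \<tau>\<bar> \<le> a / (2 * pi) * C * \<tau> powr (- s)" using t by (simp only: mult_le_cancel_left_pos)
  qed
qed

text \<open>
  Near the origin \<open>\<eta>\<close> decays faster than any power, at infinity like the power \<open>- 1 - a\<close>.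
\<close>

lemma \<eta>_moment_integrable:
  assumes "m < a"
  shows "integrable lborel (\<lambda>\<tau>. \<tau> powr m * \<eta> \<tau>)"
proof -
  obtain C1 where C1: "0 < C1" "\<And>\<tau>. 0 < \<tau> \<Longrightarrow> \<bar>\<eta> \<tau>\<bar> \<le> C1 * \<tau> powr (- m)"
    using \<eta>_bound[of m] assms by auto
  obtain C2 where C2: "0 < C2" "\<And>\<tau>. 0 < \<tau> \<Longrightarrow> \<bar>\<eta> \<tau>\<bar> \<le> C2 * \<tau> powr (- (1 + a))"
    using \<eta>_bound[of "1 + a"] by auto
  let ?w = "\<lambda>\<tau>::real. C1 * (indicator {0..1} \<tau> * \<tau> powr 0) + C2 * (indicator {1..} \<tau> * \<tau> powr (m - 1 - a))"
  show ?thesis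
  proof (rule Bochner_Integration.integrable_bound[where f="?w"])
    show "integrable lborel ?w"
      using assms by (intro Bochner_Integration.integrable_add integrable_mult_right
          powr_integrable_near_0 powr_integrable_at_infinity) auto
    have "\<bar>\<tau> powr m * \<eta> \<tau>\<bar> \<le> ?w \<tau>" for \<tau>
    proof -
      consider "\<tau> \<le> 0" | "0 < \<tau>" "\<tau> \<le> 1" | "1 < \<tau>" by linarith
      then show ?thesis
      proof cases
        case 1 then show ?thesis using C1 C2 by simp
      next
        case 2
        have "\<bar>\<tau> powr m * \<eta> \<tau>\<bar> \<le> \<tau> powr m * (C1 * \<tau> powr (- m))"
          using C1(2)[OF 2(1)] by (simp add: abs_mult mult_left_mono)
        also have "\<dots> = C1" using 2 by (simp add: powr_minus field_simps)
        finally show ?thesis using 2 C2 by (auto simp: indicator_def intro: order_trans)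
      next
        case 3
        have "\<bar>\<tau> powr m * \<eta> \<tau>\<bar> \<le> \<tau> powr m * (C2 * \<tau> powr (- (1 + a)))"
          using C2(2)[of \<tau>] 3 by (simp add: abs_mult mult_left_mono)
        also have "\<dots> = C2 * \<tau> powr (m + (- (1 + a)))" by (simp only: powr_add mult.left_commute)
        also have "m + (- (1 + a)) = m - 1 - a" by simp
        finally show ?thesis using 3 by (simp add: indicator_def)
      qed
    qed
    then show "AE \<tau> in lborel. norm (\<tau> powr m * \<eta> \<tau>) \<le> norm (?w \<tau>)"
      unfolding real_norm_def using abs_ge_self order_trans by blast
  qed simp
qed

definition tail_const :: real where "tail_const = a / Gamma (1 - a)"

text \<open>
  The expansion of the Bromwich integral gives this with some constant \<open>c\<close>. Then \<open>\<tau> \<eta> \<tau>\<close> differs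
  from \<open>c \<tau>\<^sup>-\<^sup>a\<close> by an integrable function, since \<open>2 a > 1\<close>. Hence their Laplace transforms, which
  blow up at the origin like \<open>a \<mu>\<^sup>a\<^sup>-\<^sup>1\<close> and \<open>c \<Gamma>(1 - a) \<mu>\<^sup>a\<^sup>-\<^sup>1\<close>, differ by a bounded function,
  and so \<open>a = c \<Gamma>(1 - a)\<close>.
\<close>

lemma \<eta>_asymp:
  obtains C where "0 < C" "\<And>\<tau>. 0 < \<tau> \<Longrightarrow> \<bar>\<eta> \<tau> - tail_const * \<tau> powr (- 1 - a)\<bar> \<le> C * \<tau> powr (- 1 - 2 * a)"
proof -
  obtain K C' where KC: "\<forall>\<tau>>0. norm (bromwich (a - 1) \<tau> - K * of_real (\<tau> powr (- a)))
      \<le> C' * \<tau> powr (- 2 * a)"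
    using bromwich_asymp by blast
  define c where "c = a / (2 * pi) * Re K"
  define C where "C = a / (2 * pi) * \<bar>C'\<bar> + 1"
  have C0: "0 < C" using a_pos by (simp add: C_def add_nonneg_pos)
  have t\<eta>: "\<bar>\<tau> * \<eta> \<tau> - c * \<tau> powr (- a)\<bar> \<le> C * \<tau> powr (- 2 * a)" if t: "0 < \<tau>" for \<tau>
  proof -
    have "\<tau> * \<eta> \<tau> - c * \<tau> powr (- a) = a / (2 * pi) * Re (bromwich (a - 1) \<tau> - K * of_real (\<tau> powr (- a)))"
      unfolding \<tau>_\<eta> c_def using t by (simp add: algebra_simps)
    also have "\<bar>\<dots>\<bar> \<le> a / (2 * pi) * (C' * \<tau> powr (- 2 * a))"
      using KC t abs_Re_le_cmod[of "bromwich (a - 1) \<tau> - K * of_real (\<tau> powr (- a))"] a_pos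
      unfolding abs_mult by (intro mult_mono) (auto intro: order_trans)
    also have "\<dots> \<le> a / (2 * pi) * (\<bar>C'\<bar> * \<tau> powr (- 2 * a))"
      using a_pos by (intro mult_left_mono mult_right_mono) auto
    also have "\<dots> \<le> C * \<tau> powr (- 2 * a)" unfolding C_def by (simp add: algebra_simps)
    finally show ?thesis .
  qed
  obtain C1 where C1: "0 < C1" "\<And>\<tau>. 0 < \<tau> \<Longrightarrow> \<bar>\<eta> \<tau>\<bar> \<le> C1 * \<tau> powr (- (1 + a))"
    using \<eta>_bound[of "1 + a"] by auto
  \<comment> \<open>The difference is dominated by \<open>\<tau>\<^sup>-\<^sup>a\<close> near the origin and by \<open>\<tau>\<^sup>-\<^sup>2\<^sup>a\<close> at infinity.\<close>
  let ?d = "\<lambda>\<tau>. \<tau> * \<eta> \<tau> - c * (indicator {0..} \<tau> * \<tau> powr (- a))"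
  let ?w = "\<lambda>\<tau>::real. (C1 + \<bar>c\<bar>) * (indicator {0..1} \<tau> * \<tau> powr (- a)) + C
      * (indicator {1..} \<tau> * \<tau> powr (- 2 * a))"
  have wi: "integrable lborel ?w"
    using half_less_a a_less_1 by (intro Bochner_Integration.integrable_add integrable_mult_right
        powr_integrable_near_0 powr_integrable_at_infinity) auto
  have dw: "\<bar>?d \<tau>\<bar> \<le> ?w \<tau>" for \<tau>
  proof -
    consider "\<tau> < 0" | "\<tau> = 0" | "0 < \<tau>" "\<tau> \<le> 1" | "1 < \<tau>" by linarith
    then show ?thesis
    proof cases
      case 3
      have "\<tau> * \<bar>\<eta> \<tau>\<bar> \<le> \<tau> * (C1 * \<tau> powr (- (1 + a)))" using C1(2)[OF 3(1)] 3 by (intro mult_left_mono) auto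
      also have "\<dots> = C1 * \<tau> powr (- a)" using 3 powr_add[of \<tau> 1 "- (1 + a)"] by simp
      finally have "\<bar>?d \<tau>\<bar> \<le> C1 * \<tau> powr (- a) + \<bar>c\<bar> * \<tau> powr (- a)"
        using 3 by (auto simp: abs_mult intro: order_trans[OF abs_triangle_ineq4])
      then show ?thesis using 3 C0 by (auto simp: indicator_def algebra_simps)
    next
      case 4
      then show ?thesis using t\<eta>[of \<tau>] by (simp add: indicator_def)
    qed (use C0 C1 in \<open>auto simp: indicator_def\<close>)
  qed
  define W where "W = (LINT \<tau>|lborel. ?w \<tau>)"
  have main: "\<bar>a * exp (- (\<mu> powr a)) - c * Gamma (1 - a)\<bar> \<le> W * \<mu> powr (1 - a)" if \<mu>: "0 < \<mu>" for \<mu>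
  proof -
    have L1: "has_bochner_integral lborel (\<lambda>\<tau>. exp (- (\<tau> * \<mu>)) * (\<tau> * \<eta> \<tau>))
        (a * \<mu> powr (a - 1) * exp (- (\<mu> powr a)))"
      by (rule Laplace_transform_\<tau>_\<eta>[OF \<mu>])
    have L2: "has_bochner_integral lborel (\<lambda>\<tau>. c
        * (indicator {0..} \<tau> * (\<tau> powr (1 - a - 1) * exp (- (\<tau> * \<mu>)))))
            (c * (Gamma (1 - a) * \<mu> powr (- (1 - a))))"
      by (intro has_bochner_integral_mult_right Gamma_integral_scaled \<mu>) (use a_less_1 in auto)
    have "has_bochner_integral lborel (\<lambda>\<tau>. exp (- (\<tau> * \<mu>)) * ?d \<tau>)
        (a * \<mu> powr (a - 1) * exp (- (\<mu> powr a)) - c * (Gamma (1 - a) * \<mu> powr (- (1 - a))))"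
      using has_bochner_integral_diff[OF L1 L2] by (simp add: algebra_simps)
    then have i: "integrable lborel (\<lambda>\<tau>. exp (- (\<tau> * \<mu>)) * ?d \<tau>)"
      and v: "(LINT \<tau>|lborel. exp (- (\<tau> * \<mu>)) * ?d \<tau>)
          = \<mu> powr (a - 1) * (a * exp (- (\<mu> powr a)) - c * Gamma (1 - a))"
      by (auto simp: has_bochner_integral_iff algebra_simps)
    have "\<bar>LINT \<tau>|lborel. exp (- (\<tau> * \<mu>)) * ?d \<tau>\<bar> \<le> (LINT \<tau>|lborel. \<bar>exp (- (\<tau> * \<mu>)) * ?d \<tau>\<bar>)"
      using integral_norm_bound[of lborel "\<lambda>\<tau>. exp (- (\<tau> * \<mu>)) * ?d \<tau>"] by simp
    also have "\<dots> \<le> W" unfolding W_def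
    proof (rule integral_mono[OF _ wi])
      show "integrable lborel (\<lambda>\<tau>. \<bar>exp (- (\<tau> * \<mu>)) * ?d \<tau>\<bar>)" using i by simp
      fix \<tau> :: real
      show "\<bar>exp (- (\<tau> * \<mu>)) * ?d \<tau>\<bar> \<le> ?w \<tau>"
      proof (cases "0 \<le> \<tau>")
        case True
        then have "\<bar>exp (- (\<tau> * \<mu>)) * ?d \<tau>\<bar> \<le> 1 * \<bar>?d \<tau>\<bar>"
          using \<mu> unfolding abs_mult by (intro mult_right_mono) auto
        also have "1 * \<bar>?d \<tau>\<bar> = \<bar>?d \<tau>\<bar>" by simp
        also note dw[of \<tau>]
        finally show ?thesis .
      next
        case False
        then show ?thesis using dw[of \<tau>] by (simp add: indicator_def)
      qed
    qed
    finally have "\<mu> powr (a - 1) * \<bar>a * exp (- (\<mu> powr a)) - c * Gamma (1 - a)\<bar> \<le> W"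
      unfolding v abs_mult by simp
    then have "\<mu> powr (1 - a) * (\<mu> powr (a - 1) * \<bar>a * exp (- (\<mu> powr a)) - c * Gamma (1 - a)\<bar>)
        \<le> \<mu> powr (1 - a) * W"
      by (intro mult_left_mono) auto
    moreover have "\<mu> powr (1 - a) * \<mu> powr (a - 1) = 1" using \<mu> by (simp flip: powr_add)
    ultimately show ?thesis by (simp add: mult.assoc[symmetric] mult.commute)
  qed
  have "((\<lambda>\<mu>. a * exp (- (\<mu> powr a)) - c * Gamma (1 - a)) \<longlongrightarrow> 0) (at_right 0)"
  proof (rule Lim_null_comparison)
    show "\<forall>\<^sub>F \<mu> in at_right 0. norm (a * exp (- (\<mu> powr a)) - c * Gamma (1 - a)) \<le> W * \<mu> powr (1 - a)"
      using main by (auto simp: eventually_at_right_less intro: eventually_at_rightI[of 0 1])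
    show "((\<lambda>\<mu>. W * \<mu> powr (1 - a)) \<longlongrightarrow> 0) (at_right 0)"
      using a_less_1 by real_asymp
  qed
  moreover have "((\<lambda>\<mu>. a * exp (- (\<mu> powr a)) - c * Gamma (1 - a)) \<longlongrightarrow> a - c * Gamma (1 - a)) (at_right 0)"
    using a_pos by real_asymp
  ultimately have "a - c * Gamma (1 - a) = 0"
    using tendsto_unique trivial_limit_at_right_real by blast
  moreover have "0 < Gamma (1 - a)" using a_less_1 by (intro Gamma_real_pos) simp
  ultimately have c: "c = tail_const" by (simp add: tail_const_def nonzero_eq_divide_eq)
  show ?thesis
  proof (rule that[OF C0])
    fix \<tau> :: real assume t: "0 < \<tau>"
    have e1: "\<tau> powr (- a) = \<tau> * \<tau> powr (- 1 - a)" using t powr_add[of \<tau> 1 "- 1 - a"] by simp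
    have e2: "\<tau> powr (- 2 * a) = \<tau> * \<tau> powr (- 1 - 2 * a)" using t powr_add[of \<tau> 1 "- 1 - 2 * a"] by simp
    have "\<tau> * \<bar>\<eta> \<tau> - c * \<tau> powr (- 1 - a)\<bar> = \<bar>\<tau> * \<eta> \<tau> - c * \<tau> powr (- a)\<bar>"
      unfolding e1 using t by (simp add: abs_mult flip: right_diff_distrib mult.left_commute[of \<tau>])
    also have "\<dots> \<le> \<tau> * (C * \<tau> powr (- 1 - 2 * a))" using t\<eta>[OF t] unfolding e2
        by (simp add: mult.left_commute)
    finally show "\<bar>\<eta> \<tau> - tail_const * \<tau> powr (- 1 - a)\<bar> \<le> C * \<tau> powr (- 1 - 2 * a)"
      using t c by (simp only: mult_le_cancel_left_pos)
  qed
qed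

end

section \<open>Mixtures of Gaussians\<close>

context stable_index
begin

text \<open>
  The density at \<open>z\<close> of a Gaussian with the normalisation of dimension \<open>k\<close>, averaged over its
  variance with the weight \<open>\<phi>\<close>. The parameter \<open>k\<close> is separate from the dimension of the space
  because derivatives in \<open>z\<close> change it.
\<close>

definition mixture :: "(real \<Rightarrow> real) \<Rightarrow> real \<Rightarrow> 'a::euclidean_space \<Rightarrow> real \<Rightarrow> real" where
  "mixture \<phi> k z \<theta> = (LINT \<tau>|lborel. (4 * pi * \<theta> * \<tau>) powr (- k / 2)
      * exp (- (norm z)\<^sup>2 / (4 * (\<theta> * \<tau>))) * \<phi> \<tau>)"

abbreviation N :: "real \<Rightarrow> 'a::euclidean_space \<Rightarrow> real \<Rightarrow> real" where
  "N k z \<theta> \<equiv> mixture \<eta> k z \<theta>"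

lemma mixture_abs_integrable:
  fixes z :: "'a::euclidean_space"
  assumes "0 < \<theta>" "- k / 2 < a"
  shows "integrable lborel (\<lambda>\<tau>. (4 * pi * \<theta> * \<tau>) powr (- k / 2) * \<bar>\<eta> \<tau>\<bar>)"
    and "integrable lborel (\<lambda>\<tau>. (4 * pi * \<theta> * \<tau>) powr (- k / 2) * exp (- (norm z)\<^sup>2 / (4 * (\<theta> * \<tau>))) * \<eta> \<tau>)"
proof -
  have "integrable lborel (\<lambda>\<tau>. (4 * pi * \<theta>) powr (- k / 2) * \<bar>\<tau> powr (- k / 2) * \<eta> \<tau>\<bar>)"
    by (intro integrable_mult_right integrable_abs \<eta>_moment_integrable assms)
  moreover have "(4 * pi * \<theta>) powr (- k / 2) * \<bar>\<tau> powr (- k / 2) * \<eta> \<tau>\<bar>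
      = (4 * pi * \<theta> * \<tau>) powr (- k / 2) * \<bar>\<eta> \<tau>\<bar>" for \<tau>
    using assms(1) by (cases "0 < \<tau>") (simp_all add: powr_mult abs_mult)
  ultimately show 1: "integrable lborel (\<lambda>\<tau>. (4 * pi * \<theta> * \<tau>) powr (- k / 2) * \<bar>\<eta> \<tau>\<bar>)" by (simp only:)
  show "integrable lborel (\<lambda>\<tau>. (4 * pi * \<theta> * \<tau>) powr (- k / 2) * exp (- (norm z)\<^sup>2 / (4 * (\<theta> * \<tau>))) * \<eta> \<tau>)"
  proof (rule Bochner_Integration.integrable_bound[OF 1])
    show "AE \<tau> in lborel. norm ((4 * pi * \<theta> * \<tau>) powr (- k / 2) * exp (- (norm z)\<^sup>2 / (4 * (\<theta> * \<tau>))) * \<eta> \<tau>)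
       \<le> norm ((4 * pi * \<theta> * \<tau>) powr (- k / 2) * \<bar>\<eta> \<tau>\<bar>)"
    proof (rule AE_I2)
      fix \<tau> :: real
      show "norm ((4 * pi * \<theta> * \<tau>) powr (- k / 2) * exp (- (norm z)\<^sup>2 / (4 * (\<theta> * \<tau>))) * \<eta> \<tau>)
       \<le> norm ((4 * pi * \<theta> * \<tau>) powr (- k / 2) * \<bar>\<eta> \<tau>\<bar>)"
      proof (cases "0 < \<tau>")
        case True
        then have "exp (- (norm z)\<^sup>2 / (4 * (\<theta> * \<tau>))) \<le> 1" using assms(1) by simp
        then show ?thesis by (simp add: abs_mult mult_right_mono mult_left_le)
      qed simp
    qed
  qed simp
qed

text \<open>
  Drop the exponential and scale \<open>\<theta>\<close> out.
\<close>

lemma N_sup_bound: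
  assumes "- k / 2 < a"
  obtains C where "0 < C" "\<And>(z::'a::euclidean_space) \<theta>. 0 < \<theta> \<Longrightarrow> \<bar>N k z \<theta>\<bar> \<le> C * \<theta> powr (- k / 2)"
proof -
  define C where "C = (LINT \<tau>|lborel. (4 * pi * 1 * \<tau>) powr (- k / 2) * \<bar>\<eta> \<tau>\<bar>)"
  have C0: "0 \<le> C" unfolding C_def by (intro integral_nonneg_AE AE_I2) auto
  have "\<bar>N k z \<theta>\<bar> \<le> (C + 1) * \<theta> powr (- k / 2)" if \<theta>: "0 < \<theta>" for z :: 'a and \<theta>
  proof -
    let ?f = "\<lambda>\<tau>. (4 * pi * \<theta> * \<tau>) powr (- k / 2) * exp (- (norm z)\<^sup>2 / (4 * (\<theta> * \<tau>))) * \<eta> \<tau>"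
    have "\<bar>N k z \<theta>\<bar> \<le> (LINT \<tau>|lborel. \<bar>?f \<tau>\<bar>)"
      unfolding mixture_def using integral_norm_bound[of lborel ?f] by simp
    also have "\<dots> \<le> (LINT \<tau>|lborel. \<theta> powr (- k / 2) * ((4 * pi * 1 * \<tau>) powr (- k / 2) * \<bar>\<eta> \<tau>\<bar>))"
    proof (rule integral_mono)
      show "integrable lborel (\<lambda>\<tau>. \<bar>?f \<tau>\<bar>)" using mixture_abs_integrable(2)[OF \<theta> assms, of z] by simp
      show "integrable lborel (\<lambda>\<tau>. \<theta> powr (- k / 2) * ((4 * pi * 1 * \<tau>) powr (- k / 2) * \<bar>\<eta> \<tau>\<bar>))"
        using mixture_abs_integrable(1)[of 1 k] assms by simp
      fix \<tau> :: real
      show "\<bar>?f \<tau>\<bar> \<le> \<theta> powr (- k / 2) * ((4 * pi * 1 * \<tau>) powr (- k / 2) * \<bar>\<eta> \<tau>\<bar>)"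
      proof (cases "0 < \<tau>")
        case True
        then have "exp (- (norm z)\<^sup>2 / (4 * (\<theta> * \<tau>))) \<le> 1" using \<theta> by simp
        then have 1: "\<bar>?f \<tau>\<bar> \<le> (4 * pi * \<theta> * \<tau>) powr (- k / 2) * \<bar>\<eta> \<tau>\<bar>"
          by (simp add: abs_mult mult_right_mono mult_left_le)
        have 2: "(4 * pi * \<theta> * \<tau>) powr (- k / 2) = \<theta> powr (- k / 2) * (4 * pi * 1 * \<tau>) powr (- k / 2)"
          using \<theta> True powr_mult[of \<theta> "4 * pi * 1 * \<tau>" "- k / 2"] by (simp add: mult_ac)
        show ?thesis
          by (rule order_trans[OF 1 eq_refl]) (unfold 2, rule mult.assoc)
      qed simp
    qed
    also have "\<dots> = C * \<theta> powr (- k / 2)" unfolding C_def by (subst integral_mult_right_zero) simp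
    also have "\<dots> \<le> (C + 1) * \<theta> powr (- k / 2)" by (intro mult_right_mono) auto
    finally show ?thesis .
  qed
  then show ?thesis using that[of "C + 1"] C0 by simp
qed

definition mixture_const :: "real \<Rightarrow> real \<Rightarrow> real" where
  "mixture_const k s = pi powr (- k / 2) * 4 powr s * Gamma (k / 2 + s)"

text \<open>
  A Gamma integral in \<open>1 / \<tau>\<close>.
\<close>

lemma mixture_powr:
  fixes z :: "'a::euclidean_space"
  assumes "0 < \<theta>" "0 < k / 2 + s" "z \<noteq> 0"
  shows "has_bochner_integral lborel (\<lambda>\<tau>. (4 * pi * \<theta> * \<tau>) powr (- k / 2)
      * exp (- (norm z)\<^sup>2 / (4 * (\<theta> * \<tau>))) * (indicator {0<..} \<tau> * \<tau> powr (- 1 - s)))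
    (mixture_const k s * \<theta> powr s * norm z powr (- k - 2 * s))"
proof -
  define B where "B = (norm z)\<^sup>2 / (4 * \<theta>)"
  have B: "0 < B" using assms by (simp add: B_def)
  have e: "(4 * pi * \<theta> * \<tau>) powr (- k / 2) * exp (- (norm z)\<^sup>2 / (4 * (\<theta> * \<tau>)))
      * (indicator {0<..} \<tau> * \<tau> powr (- 1 - s))
    = (4 * pi * \<theta>) powr (- k / 2) * (indicator {0<..} \<tau>
        * (\<tau> powr (- 1 - (k / 2 + s)) * exp (- (B / \<tau>))))" for \<tau>
  proof (cases "0 < \<tau>")
    case True
    have "- k / 2 + (- 1 - s) = - 1 - (k / 2 + s)" by simp
    then have "\<tau> powr (- k / 2) * \<tau> powr (- 1 - s) = \<tau> powr (- 1 - (k / 2 + s))"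
      unfolding powr_add[symmetric] by (simp only:)
    moreover have "- (norm z)\<^sup>2 / (4 * (\<theta> * \<tau>)) = - (B / \<tau>)" by (simp add: B_def)
    ultimately show ?thesis using True assms(1) by (simp add: powr_mult mult_ac)
  qed simp
  have v: "(4 * pi * \<theta>) powr (- k / 2) * (Gamma (k / 2 + s) * B powr (- (k / 2 + s)))
      = mixture_const k s * \<theta> powr s * norm z powr (- k - 2 * s)"
  proof -
    have 1: "(4 * pi * \<theta>) powr (- k / 2) = pi powr (- k / 2) * (4 * \<theta>) powr (- k / 2)"
      using assms(1) by (simp add: powr_mult mult_ac)
    have "B powr (- (k / 2 + s)) = ((norm z)\<^sup>2) powr (- (k / 2 + s)) / (4 * \<theta>) powr (- (k / 2 + s))"
      unfolding B_def using assms by (simp add: powr_divide)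
    also have "((norm z)\<^sup>2) powr (- (k / 2 + s)) = norm z powr (- k - 2 * s)"
    proof -
      have "((norm z)\<^sup>2) powr (- (k / 2 + s)) = (norm z powr 2) powr (- (k / 2 + s))" by simp
      also have "\<dots> = norm z powr (2 * (- (k / 2 + s)))" by (rule powr_powr)
      also have "2 * (- (k / 2 + s)) = - k - 2 * s" by simp
      finally show ?thesis .
    qed
    also have "norm z powr (- k - 2 * s) / (4 * \<theta>) powr (- (k / 2 + s))
        = norm z powr (- k - 2 * s) * (4 * \<theta>) powr (k / 2 + s)"
      unfolding powr_minus divide_inverse inverse_inverse_eq ..
    finally have 2: "B powr (- (k / 2 + s)) = norm z powr (- k - 2 * s) * (4 * \<theta>) powr (k / 2 + s)" .
    have "(4 * \<theta>) powr (- k / 2) * (4 * \<theta>) powr (k / 2 + s) = (4 * \<theta>) powr s" by (simp flip: powr_add)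
    also have "\<dots> = 4 powr s * \<theta> powr s" using assms(1) by (simp add: powr_mult)
    finally have 3: "(4 * \<theta>) powr (- k / 2) * (4 * \<theta>) powr (k / 2 + s) = 4 powr s * \<theta> powr s" .
    have "(4 * pi * \<theta>) powr (- k / 2) * (Gamma (k / 2 + s) * B powr (- (k / 2 + s)))
       = pi powr (- k / 2) * Gamma (k / 2 + s) * norm z powr (- k - 2 * s)
           * ((4 * \<theta>) powr (- k / 2) * (4 * \<theta>) powr (k / 2 + s))"
      unfolding 1 2 by (simp only: mult_ac)
    then show ?thesis unfolding 3 mixture_const_def by (simp only: mult_ac)
  qed
  show ?thesis
    unfolding e v[symmetric] by (intro has_bochner_integral_mult_right Gamma_integral_inverted assms B)
qed

lemma mixture_compare:
  assumes \<phi>: "\<And>\<tau>. \<bar>\<phi> \<tau>\<bar> \<le> C * (indicator {0<..} \<tau> * \<tau> powr (- 1 - s))" and "0 < \<theta>" "0 < k / 2 + s"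
      and z: "(z::'a::euclidean_space) \<noteq> 0"
  shows "\<bar>mixture \<phi> k z \<theta>\<bar> \<le> C * mixture_const k s * \<theta> powr s * norm z powr (- k - 2 * s)"
proof -
  let ?K = "\<lambda>\<tau>. (4 * pi * \<theta> * \<tau>) powr (- k / 2) * exp (- (norm z)\<^sup>2 / (4 * (\<theta> * \<tau>)))"
  let ?p = "\<lambda>\<tau>. indicator {0<..} \<tau> * \<tau> powr (- 1 - s)"
  note P = mixture_powr[OF assms(2,3) z]
  have le: "\<bar>?K \<tau> * \<phi> \<tau>\<bar> \<le> C * (?K \<tau> * ?p \<tau>)" for \<tau>
    using mult_left_mono[OF \<phi>[of \<tau>], of "?K \<tau>"] by (simp add: abs_mult mult_ac)
  have "\<bar>mixture \<phi> k z \<theta>\<bar> \<le> (LINT \<tau>|lborel. \<bar>?K \<tau> * \<phi> \<tau>\<bar>)"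
    unfolding mixture_def using integral_norm_bound[of lborel "\<lambda>\<tau>. ?K \<tau> * \<phi> \<tau>"] by simp
  also have "\<dots> \<le> (LINT \<tau>|lborel. C * (?K \<tau> * ?p \<tau>))"
  proof (rule integral_mono')
    show "integrable lborel (\<lambda>\<tau>. C * (?K \<tau> * ?p \<tau>))"
      using P by (intro integrable_mult_right) (simp add: has_bochner_integral_iff)
    show "\<bar>?K \<tau> * \<phi> \<tau>\<bar> \<le> C * (?K \<tau> * ?p \<tau>)" for \<tau> by (rule le)
    show "0 \<le> C * (?K \<tau> * ?p \<tau>)" for \<tau> by (rule order_trans[OF abs_ge_zero le])
  qed
  also have "\<dots> = C * (mixture_const k s * \<theta> powr s * norm z powr (- k - 2 * s))"
    using P by (subst integral_mult_right_zero) (simp add: has_bochner_integral_iff)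
  finally show ?thesis by (simp add: mult_ac)
qed

lemma N_decay:
  assumes "0 \<le> k"
  obtains C where "0 < C" "\<And>(z::'a::euclidean_space) \<theta>. 0 < \<theta> \<Longrightarrow> z \<noteq> 0 \<Longrightarrow> \<bar>N k z \<theta>\<bar>
      \<le> C * \<theta> powr a * norm z powr (- k - 2 * a)"
proof -
  obtain C where C: "0 < C" "\<And>\<tau>. 0 < \<tau> \<Longrightarrow> \<bar>\<eta> \<tau>\<bar> \<le> C * \<tau> powr (- (1 + a))"
    using \<eta>_bound[of "1 + a"] by auto
  have le: "\<bar>\<eta> \<tau>\<bar> \<le> C * (indicator {0<..} \<tau> * \<tau> powr (- 1 - a))" for \<tau>
    using C(2)[of \<tau>] by (cases "0 < \<tau>") auto
  have "0 < mixture_const k a" unfolding mixture_const_def using assms a_pos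
      by (intro mult_pos_pos Gamma_real_pos) auto
  then show ?thesis
    using that[of "C * mixture_const k a"] mixture_compare[OF le, where 'a='a] C(1) assms a_pos by simp
qed

text \<open>
  Both the leading term and the error of \<open>\<eta>_asymp\<close> are powers, whose mixtures are known exactly.
\<close>

lemma N_asymp:
  assumes "0 \<le> k"
  obtains C where "0 < C" "\<And>(z::'a::euclidean_space) \<theta>. 0 < \<theta> \<Longrightarrow> z \<noteq> 0 \<Longrightarrow>
    \<bar>N k z \<theta> - tail_const * mixture_const k a * \<theta> powr a * norm z powr (- k - 2 * a)\<bar>
        \<le> C * \<theta> powr (2 * a) * norm z powr (- k - 4 * a)"
proof -
  obtain C where C: "0 < C" "\<And>\<tau>. 0 < \<tau> \<Longrightarrow> \<bar>\<eta> \<tau> - tail_const * \<tau> powr (- 1 - a)\<bar> \<le> C * \<tau> powr (- 1 - 2 * a)"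
    using \<eta>_asymp by blast
  let ?p = "\<lambda>\<tau>. indicator {0<..} \<tau> * \<tau> powr (- 1 - a)"
  have le: "\<bar>\<eta> \<tau> - tail_const * ?p \<tau>\<bar> \<le> C * (indicator {0<..} \<tau> * \<tau> powr (- 1 - 2 * a))" for \<tau>
    using C(2)[of \<tau>] by (cases "0 < \<tau>") auto
  have "\<bar>N k z \<theta> - tail_const * mixture_const k a * \<theta> powr a * norm z powr (- k - 2 * a)\<bar>
     \<le> C * mixture_const k (2 * a) * \<theta> powr (2 * a) * norm z powr (- k - 4 * a)"
         if "0 < \<theta>" "z \<noteq> 0" for z :: 'a and \<theta>
  proof -
    let ?K = "\<lambda>\<tau>. (4 * pi * \<theta> * \<tau>) powr (- k / 2) * exp (- (norm z)\<^sup>2 / (4 * (\<theta> * \<tau>)))"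
    have P: "has_bochner_integral lborel (\<lambda>\<tau>. ?K \<tau> * ?p \<tau>)
        (mixture_const k a * \<theta> powr a * norm z powr (- k - 2 * a))"
      by (rule mixture_powr) (use that assms a_pos in auto)
    have i: "integrable lborel (\<lambda>\<tau>. ?K \<tau> * \<eta> \<tau>)"
      using mixture_abs_integrable(2)[of \<theta> k z] that assms a_pos by simp
    have "mixture (\<lambda>\<tau>. \<eta> \<tau> - tail_const * ?p \<tau>) k z \<theta>
        = (LINT \<tau>|lborel. ?K \<tau> * \<eta> \<tau> - tail_const * (?K \<tau> * ?p \<tau>))"
      unfolding mixture_def by (simp only: right_diff_distrib mult_ac)
    also have "\<dots> = N k z \<theta> - tail_const * (mixture_const k a * \<theta> powr a * norm z powr (- k - 2 * a))"
    proof (subst Bochner_Integration.integral_diff)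
      show "integrable lborel (\<lambda>\<tau>. tail_const * (?K \<tau> * ?p \<tau>))"
        using P by (intro integrable_mult_right) (simp only: has_bochner_integral_iff)
      show "(LINT \<tau>|lborel. ?K \<tau> * \<eta> \<tau>) - (LINT \<tau>|lborel. tail_const * (?K \<tau> * ?p \<tau>))
          = N k z \<theta> - tail_const * (mixture_const k a * \<theta> powr a * norm z powr (- k - 2 * a))"
        unfolding integral_mult_right_zero mixture_def using P by (simp only: has_bochner_integral_iff)
    qed (rule i)
    finally have "N k z \<theta> - tail_const * mixture_const k a * \<theta> powr a * norm z powr (- k - 2 * a)
        = mixture (\<lambda>\<tau>. \<eta> \<tau> - tail_const * ?p \<tau>) k z \<theta>"
      by (simp only: mult.assoc)
    moreover have "\<bar>mixture (\<lambda>\<tau>. \<eta> \<tau> - tail_const * ?p \<tau>) k z \<theta>\<bar>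
        \<le> C * mixture_const k (2 * a) * \<theta> powr (2 * a) * norm z powr (- k - 2 * (2 * a))"
      by (rule mixture_compare[OF le]) (use that assms a_pos in auto)
    ultimately show ?thesis by simp
  qed
  moreover have "0 < mixture_const k (2 * a)" unfolding mixture_const_def using assms a_pos
      by (intro mult_pos_pos Gamma_real_pos) auto
  ultimately show ?thesis using that[of "C * mixture_const k (2 * a)"] C(1) by simp
qed

lemma N_measurable [measurable]: "(\<lambda>z::'a::euclidean_space. N k z \<theta>) \<in> borel_measurable borel"
  unfolding mixture_def by measurable

text \<open>
  Differentiating the exponent of the Gaussian produces \<open>- (z \<bullet> v) / (2 \<theta> \<tau>)\<close>, and \<open>1 / (2 \<theta> \<tau>)\<close>
  is \<open>2 \<pi>\<close> divided by the base \<open>4 \<pi> \<theta> \<tau>\<close> of the normalising power.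
\<close>

lemma N_has_derivative:
  fixes z v :: "'a::euclidean_space"
  assumes \<theta>: "0 < \<theta>" and k: "0 \<le> k"
  shows "((\<lambda>r. N k (z + r *\<^sub>R v) \<theta>) has_field_derivative
     (- 2 * pi * ((z + r *\<^sub>R v) \<bullet> v) * N (k + 2) (z + r *\<^sub>R v) \<theta>)) (at r)"
proof -
  let ?f = "\<lambda>r \<tau>. (4 * pi * \<theta> * \<tau>) powr (- k / 2) * exp (- (norm (z + r *\<^sub>R v))\<^sup>2 / (4 * (\<theta> * \<tau>))) * \<eta> \<tau>"
  let ?f' = "\<lambda>r \<tau>. (- 2 * pi * ((z + r *\<^sub>R v) \<bullet> v))
      * ((4 * pi * \<theta> * \<tau>) powr (- (k + 2) / 2) * exp (- (norm (z + r *\<^sub>R v))\<^sup>2 / (4 * (\<theta> * \<tau>))) * \<eta> \<tau>)"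
  let ?w = "\<lambda>\<tau>. 2 * norm v * sqrt pi * ((4 * pi * \<theta> * \<tau>) powr (- (k + 1) / 2) * \<bar>\<eta> \<tau>\<bar>)"
  have k2: "(4 * pi * \<theta> * \<tau>) powr (- (k + 2) / 2) = (4 * pi * \<theta> * \<tau>) powr (- k / 2) / (4 * pi * \<theta> * \<tau>)"
      if "0 < \<tau>" for \<tau>
  proof -
    have "(4 * pi * \<theta> * \<tau>) powr (- k / 2 - 1) = (4 * pi * \<theta> * \<tau>) powr (- k / 2) / (4 * pi * \<theta> * \<tau>)"
      using that \<theta> by (simp add: powr_diff)
    moreover have "- (k + 2) / 2 = - k / 2 - 1" by simp
    ultimately show ?thesis by metis
  qed
  have "((\<lambda>r. LINT \<tau>|lborel. ?f r \<tau>) has_field_derivative (LINT \<tau>|lborel. ?f' r \<tau>)) (at r)"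
  proof (rule has_field_derivative_integral[where f="?f" and f'="?f'" and w="?w"])
    show "integrable lborel (?f r)" for r
      by (rule mixture_abs_integrable(2)) (use \<theta> k a_pos in auto)
    show "((\<lambda>r. ?f r \<tau>) has_field_derivative ?f' r \<tau>) (at r)" for r \<tau>
    proof (cases "0 < \<tau>")
      case True
      have "((\<lambda>r. (norm (z + r *\<^sub>R v))\<^sup>2) has_field_derivative 2 * ((z + r *\<^sub>R v) \<bullet> v)) (at r)"
        unfolding power2_norm_eq_inner
        by (auto intro!: derivative_eq_intros simp: inner_add_left inner_add_right inner_commute
            algebra_simps)
      then have "((\<lambda>r. - (norm (z + r *\<^sub>R v))\<^sup>2 / (4 * (\<theta> * \<tau>))) has_field_derivative
          - (2 * ((z + r *\<^sub>R v) \<bullet> v)) / (4 * (\<theta> * \<tau>))) (at r)"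
        by (intro DERIV_cdivide DERIV_minus)
      then have "((\<lambda>r. ?f r \<tau>) has_field_derivative
         (4 * pi * \<theta> * \<tau>) powr (- k / 2) * (exp (- (norm (z + r *\<^sub>R v))\<^sup>2 / (4 * (\<theta> * \<tau>)))
             * (- (2 * ((z + r *\<^sub>R v) \<bullet> v)) / (4 * (\<theta> * \<tau>)))) * \<eta> \<tau>) (at r)"
        by (intro DERIV_cmult_right DERIV_cmult DERIV_fun_exp)
      moreover have "(4 * pi * \<theta> * \<tau>) powr (- k / 2) * (E * (- (2 * I) / (4 * (\<theta> * \<tau>)))) * \<eta> \<tau>
        = (- 2 * pi * I) * ((4 * pi * \<theta> * \<tau>) powr (- (k + 2) / 2) * E * \<eta> \<tau>)" for E I
      proof -
        have "- (2 * I) / (4 * (\<theta> * \<tau>)) = (- 2 * pi * I) / (4 * pi * \<theta> * \<tau>)" using True \<theta> by simp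
        then show ?thesis unfolding k2[OF True] by simp
      qed
      ultimately show ?thesis by (simp only:)
    qed simp
    show "\<bar>?f' r \<tau>\<bar> \<le> ?w \<tau>" for r \<tau>
    proof (cases "0 < \<tau>")
      case True
      let ?u = "z + r *\<^sub>R v"
      define T where "T = \<theta> * \<tau>"
      have T: "0 < T" using True \<theta> by (simp add: T_def)
      have p: "4 * pi * \<theta> * \<tau> = 4 * pi * T" by (simp add: T_def)
      have ex: "norm ?u * exp (- (norm ?u)\<^sup>2 / (4 * T)) \<le> 2 * sqrt T"
      proof (rule order_trans[OF norm_times_gaussian_le[OF T]])
        have "exp (- (norm ?u)\<^sup>2 / (8 * T)) \<le> 1" using T by simp
        then show "2 * sqrt T * exp (- (norm ?u)\<^sup>2 / (8 * T)) \<le> 2 * sqrt T" using T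
            by (simp add: mult_left_le)
      qed
      have pw: "(4 * pi * T) powr (- (k + 2) / 2) * (2 * sqrt T)
          = (4 * pi * T) powr (- (k + 1) / 2) / sqrt pi"
      proof -
        have "- (k + 2) / 2 = - (k + 1) / 2 + - (1 / 2)" by (simp add: field_simps)
        then have "(4 * pi * T) powr (- (k + 2) / 2)
            = (4 * pi * T) powr (- (k + 1) / 2) * (4 * pi * T) powr (- (1 / 2))"
          by (metis powr_add)
        also have "(4 * pi * T) powr (- (1 / 2)) = 1 / (2 * sqrt pi * sqrt T)"
          using T by (simp add: powr_minus_divide powr_half_sqrt real_sqrt_mult)
        finally show ?thesis using T by simp
      qed
      have "\<bar>?u \<bullet> v\<bar> \<le> norm ?u * norm v" by (rule Cauchy_Schwarz_ineq2)
      then have "\<bar>?f' r \<tau>\<bar> \<le> 2 * pi * (norm ?u * norm v)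
          * ((4 * pi * T) powr (- (k + 2) / 2) * exp (- (norm ?u)\<^sup>2 / (4 * T)) * \<bar>\<eta> \<tau>\<bar>)"
        unfolding p T_def[symmetric] abs_mult by (intro mult_mono mult_nonneg_nonneg) auto
      also have "\<dots> = 2 * pi * norm v * (4 * pi * T) powr (- (k + 2) / 2) * \<bar>\<eta> \<tau>\<bar>
          * (norm ?u * exp (- (norm ?u)\<^sup>2 / (4 * T)))"
        by (simp only: mult_ac)
      also have "\<dots> \<le> 2 * pi * norm v * (4 * pi * T) powr (- (k + 2) / 2) * \<bar>\<eta> \<tau>\<bar> * (2 * sqrt T)"
        by (intro mult_left_mono ex) auto
      also have "\<dots> = 2 * norm v * (pi * ((4 * pi * T) powr (- (k + 2) / 2) * (2 * sqrt T))) * \<bar>\<eta> \<tau>\<bar>"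
        by (simp only: mult_ac)
      also have "\<dots> = ?w \<tau>"
      proof -
        have "pi * (X / sqrt pi) = (pi / sqrt pi) * X" for X by simp
        then have ps: "pi * (X / sqrt pi) = sqrt pi * X" for X by (simp only: real_div_sqrt[OF pi_ge_zero])
        show ?thesis unfolding pw p ps by (simp only: mult_ac)
      qed
      finally show ?thesis .
    qed simp
    show "integrable lborel ?w"
      by (intro integrable_mult_right mixture_abs_integrable(1)) (use \<theta> k a_pos in auto)
    show "?f' r \<in> borel_measurable lborel" by measurable
  qed
  then show ?thesis unfolding mixture_def integral_mult_right_zero .
qed

end

section \<open>The fractional heat kernel and its gradient\<close>

context stable_index
begin

text \<open>
  Subordination: \<open>exp (- t |\<xi>|\<^sup>2\<^sup>a)\<close> is the Laplace transform of \<open>\<eta>\<close> at \<open>\<theta> |\<xi>|\<^sup>2\<close> with \<open>\<theta>\<^sup>a = t\<close>,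
  and each \<open>exp (- \<theta> \<tau> |\<xi>|\<^sup>2)\<close> is the Fourier transform of a Gaussian.
\<close>

lemma heat_kernel_eq_mixture:
  fixes x :: "'a::euclidean_space"
  assumes t: "0 < t"
  shows "heat_kernel (2 * a) x t = N (DIM('a)) x (t powr (1 / a))"
proof -
  define \<theta> where "\<theta> = t powr (1 / a)"
  have \<theta>: "0 < \<theta>" "\<theta> powr a = t" using t a_pos by (auto simp: \<theta>_def powr_powr)
  define d where "d = real DIM('a)"
  have d: "0 \<le> d" by (simp add: d_def)
  define F where "F = (\<lambda>(\<tau>, \<xi>::'a). exp (\<i> * of_real (x \<bullet> \<xi>))
      * of_real (exp (- (\<theta> * \<tau>) * (norm \<xi>)\<^sup>2) * \<eta> \<tau>))"
  have Fm: "F \<in> borel_measurable (lborel \<Otimes>\<^sub>M lborel)" unfolding F_def split_beta' by measurable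
  have pw: "(pi / (\<theta> * \<tau>)) powr (d / 2) = (2 * pi) ^ DIM('a) * (4 * pi * \<theta> * \<tau>) powr (- d / 2)"
      if "0 < \<tau>" for \<tau>
  proof -
    have "pi / (\<theta> * \<tau>) = (2 * pi)\<^sup>2 / (4 * pi * \<theta> * \<tau>)" using that \<theta>
        by (simp add: field_simps power2_eq_square)
    then have "(pi / (\<theta> * \<tau>)) powr (d / 2) = ((2 * pi)\<^sup>2 / (4 * pi * \<theta> * \<tau>)) powr (d / 2)"
      by (simp only:)
    also have "\<dots> = ((2 * pi)\<^sup>2) powr (d / 2) / (4 * pi * \<theta> * \<tau>) powr (d / 2)"
      by (rule powr_divide)
    also have "((2 * pi)\<^sup>2) powr (d / 2) = ((2 * pi) powr 2) powr (d / 2)" by simp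
    also have "\<dots> = (2 * pi) powr d" unfolding powr_powr by simp
    also have "\<dots> = (2 * pi) ^ DIM('a)" by (simp add: d_def powr_realpow)
    also have "(2 * pi) ^ DIM('a) / (4 * pi * \<theta> * \<tau>) powr (d / 2)
        = (2 * pi) ^ DIM('a) * (4 * pi * \<theta> * \<tau>) powr (- (d / 2))"
      unfolding powr_minus divide_inverse ..
    also have "- (d / 2) = - d / 2" by simp
    finally show ?thesis .
  qed
  have Fx: "(LINT \<xi>|lborel. F (\<tau>, \<xi>)) = of_real
      ((2 * pi) ^ DIM('a) * ((4 * pi * \<theta> * \<tau>) powr (- d / 2) * exp (- (norm x)\<^sup>2 / (4 * (\<theta> * \<tau>))) * \<eta> \<tau>))"
    and Fi: "integrable lborel (\<lambda>\<xi>. F (\<tau>, \<xi>))"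
    and Fn: "(LINT \<xi>|lborel. norm (F (\<tau>, \<xi>)))
        = (2 * pi) ^ DIM('a) * ((4 * pi * \<theta> * \<tau>) powr (- d / 2) * \<bar>\<eta> \<tau>\<bar>)" for \<tau>
  proof -
    have "(LINT \<xi>|lborel. F (\<tau>, \<xi>)) = of_real
        ((2 * pi) ^ DIM('a) * ((4 * pi * \<theta> * \<tau>) powr (- d / 2) * exp (- (norm x)\<^sup>2 / (4 * (\<theta> * \<tau>))) * \<eta> \<tau>))
      \<and> integrable lborel (\<lambda>\<xi>. F (\<tau>, \<xi>))
      \<and> (LINT \<xi>|lborel. norm (F (\<tau>, \<xi>))) = (2 * pi) ^ DIM('a) * ((4 * pi * \<theta> * \<tau>) powr (- d / 2) * \<bar>\<eta> \<tau>\<bar>)"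
    proof (cases "0 < \<tau>")
      case True
      then have T: "0 < \<theta> * \<tau>" using \<theta> by simp
      have F1: "F (\<tau>, \<xi>) = (exp (\<i> * of_real (x \<bullet> \<xi>)) * of_real (exp (- (\<theta> * \<tau>) * (norm \<xi>)\<^sup>2)))
          * of_real (\<eta> \<tau>)" for \<xi>
        by (simp add: F_def)
      have F2: "norm (F (\<tau>, \<xi>)) = exp (- (\<theta> * \<tau>) * (norm \<xi>)\<^sup>2) * \<bar>\<eta> \<tau>\<bar>" for \<xi>
        by (simp add: F_def norm_mult)
      show ?thesis
        unfolding F2 unfolding F1 integral_mult_left_zero
        using gaussian_Fourier[OF T, of x] gaussian_integral[OF T, where 'a='a] pw[OF True]
        by (simp add: has_bochner_integral_iff d_def[symmetric] mult_ac)
    qed (simp add: F_def)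
    then show "(LINT \<xi>|lborel. F (\<tau>, \<xi>)) = of_real
        ((2 * pi) ^ DIM('a) * ((4 * pi * \<theta> * \<tau>) powr (- d / 2) * exp (- (norm x)\<^sup>2 / (4 * (\<theta> * \<tau>))) * \<eta> \<tau>))"
      "integrable lborel (\<lambda>\<xi>. F (\<tau>, \<xi>))"
      "(LINT \<xi>|lborel. norm (F (\<tau>, \<xi>))) = (2 * pi) ^ DIM('a) * ((4 * pi * \<theta> * \<tau>) powr (- d / 2) * \<bar>\<eta> \<tau>\<bar>)"
      by blast+
  qed
  have F: "integrable (lborel \<Otimes>\<^sub>M lborel) F"
  proof (rule lborel_pair.Fubini_integrable[OF Fm])
    show "integrable lborel (\<lambda>\<tau>. LINT \<xi>|lborel. norm (F (\<tau>, \<xi>)))"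
      unfolding Fn using d a_pos \<theta> by (intro integrable_mult_right mixture_abs_integrable(1)) auto
  qed (use Fi in simp)
  have Ft: "(LINT \<tau>|lborel. F (\<tau>, \<xi>)) = exp (\<i> * of_real (x \<bullet> \<xi>))
      * of_real (exp (- t * norm \<xi> powr (2 * a)))" if "\<xi> \<noteq> 0" for \<xi>
  proof -
    have m: "0 < \<theta> * (norm \<xi>)\<^sup>2" using that \<theta> by simp
    have "(LINT \<tau>|lborel. F (\<tau>, \<xi>)) = exp (\<i> * of_real (x \<bullet> \<xi>))
        * of_real (LINT \<tau>|lborel. exp (- (\<tau> * (\<theta> * (norm \<xi>)\<^sup>2))) * \<eta> \<tau>)"
      unfolding F_def prod.case integral_mult_right_zero integral_complex_of_real by (simp add: mult_ac)
    also have "(LINT \<tau>|lborel. exp (- (\<tau> * (\<theta> * (norm \<xi>)\<^sup>2))) * \<eta> \<tau>) = exp (- ((\<theta> * (norm \<xi>)\<^sup>2) powr a))"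
      using Laplace_transform_\<eta>[OF m] by (simp add: has_bochner_integral_iff)
    also have "(\<theta> * (norm \<xi>)\<^sup>2) powr a = t * norm \<xi> powr (2 * a)"
      using \<theta> that by (simp add: powr_mult powr_powr flip: powr_numeral)
    finally show ?thesis by simp
  qed
  have "(LINT \<xi>|lborel. exp (\<i> * of_real (x \<bullet> \<xi>)) * of_real (exp (- t * norm \<xi> powr (2 * a))))
      = (LINT \<xi>|lborel. LINT \<tau>|lborel. F (\<tau>, \<xi>))"
  proof (rule integral_cong_AE)
    have "AE \<xi> in lborel. \<xi> \<noteq> (0::'a)" by (rule AE_lborel_singleton)
    then show "AE \<xi> in lborel. exp (\<i> * of_real (x \<bullet> \<xi>)) * of_real (exp (- t * norm \<xi> powr (2 * a)))
        = (LINT \<tau>|lborel. F (\<tau>, \<xi>))"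
      by eventually_elim (simp add: Ft)
    show "(\<lambda>\<xi>. LINT \<tau>|lborel. F (\<tau>, \<xi>)) \<in> borel_measurable lborel"
      unfolding F_def split_beta' by measurable
  qed measurable
  also have "\<dots> = (LINT \<tau>|lborel. LINT \<xi>|lborel. F (\<tau>, \<xi>))"
    using lborel_pair.Fubini_integral[of "\<lambda>\<tau> \<xi>. F (\<tau>, \<xi>)"] F by (simp add: case_prod_eta)
  also have "\<dots> = of_real ((2 * pi) ^ DIM('a) * N d x \<theta>)"
    unfolding Fx integral_complex_of_real integral_mult_right_zero mixture_def ..
  finally show ?thesis
    unfolding heat_kernel_def inverse_fourier_def \<theta>_def[symmetric] d_def[symmetric] by simp
qed

lemma heat_profile_eq_heat_kernel: "heat_profile \<alpha> x = heat_kernel \<alpha> x 1"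
  by (simp add: heat_profile_def heat_kernel_def)

text \<open>
  Each Gaussian is treated by \<open>norm_times_gaussian_le\<close>, which leaves the moment of \<open>\<eta>\<close> of order
  \<open>(1 - j) / 2\<close>. The case \<open>j = 0\<close> is the first moment of the kernel, and \<open>j = 2\<close> bounds the \<open>L\<^sup>1\<close>
  norm of its gradient.
\<close>

lemma N_first_moment:
  fixes j :: real
  assumes j: "0 \<le> j" "(1 - j) / 2 < a"
  obtains C where "0 < C"
    "\<And>\<theta>. 0 < \<theta> \<Longrightarrow> integrable lborel (\<lambda>z::'a::euclidean_space. norm z * N (DIM('a) + j) z \<theta>)"
    "\<And>\<theta>. 0 < \<theta> \<Longrightarrow> (LINT z::'a|lborel. norm z * \<bar>N (DIM('a) + j) z \<theta>\<bar>) \<le> C * \<theta> powr ((1 - j) / 2)"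
proof -
  define d where "d = real DIM('a)"
  \<comment> \<open>The factors come from \<open>norm_times_gaussian_le\<close>, from the doubled variance, and from the excess \<open>j\<close>
    of the parameter over the dimension.\<close>
  define c where "c = 2 * 2 powr (d / 2) * (4 * pi) powr (- j / 2)"
  define m where "m = (1 - j) / 2"
  define C where "C = (LINT \<tau>|lborel. c * \<bar>\<tau> powr m * \<eta> \<tau>\<bar>)"
  have tail_const: "0 < c" by (simp add: c_def)
  have C0: "0 \<le> C" unfolding C_def using tail_const by (intro integral_nonneg_AE AE_I2) auto
  have wi: "integrable lborel (\<lambda>\<tau>. c * \<bar>\<tau> powr m * \<eta> \<tau>\<bar>)"
    using j unfolding m_def by (intro integrable_mult_right integrable_abs \<eta>_moment_integrable) auto
  have main: "integrable lborel (\<lambda>z::'a. norm z * N (d + j) z \<theta>) \<and>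
      (LINT z::'a|lborel. norm z * \<bar>N (d + j) z \<theta>\<bar>) \<le> C * \<theta> powr m"
    if \<theta>: "0 < \<theta>" for \<theta>
  proof -
    define F where "F = (\<lambda>(\<tau>, z::'a). norm z *
        ((4 * pi * \<theta> * \<tau>) powr (- (d + j) / 2) * exp (- (norm z)\<^sup>2 / (4 * (\<theta> * \<tau>))) * \<eta> \<tau>))"
    have Fm: "F \<in> borel_measurable (lborel \<Otimes>\<^sub>M lborel)" unfolding F_def split_beta' by measurable
    have inner: "integrable lborel (\<lambda>z. F (\<tau>, z)) \<and> (LINT z|lborel. norm (F (\<tau>, z)))
        \<le> \<theta> powr m * (c * \<bar>\<tau> powr m * \<eta> \<tau>\<bar>)" for \<tau>
    proof (cases "0 < \<tau>")
      case True
      define T where "T = \<theta> * \<tau>"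
      have T: "0 < T" using \<theta> True by (simp add: T_def)
      have p: "4 * pi * \<theta> * \<tau> = 4 * pi * T" by (simp add: T_def)
      let ?E = "\<lambda>z::'a. (4 * pi * T) powr (- (d + j) / 2) * \<bar>\<eta> \<tau>\<bar> * (2 * sqrt T)
          * exp (- (1 / (8 * T)) * (norm z)\<^sup>2)"
      have le: "norm (F (\<tau>, z)) \<le> ?E z" for z
      proof -
        have "norm (F (\<tau>, z)) = (4 * pi * T) powr (- (d + j) / 2) * \<bar>\<eta> \<tau>\<bar>
            * (norm z * exp (- (norm z)\<^sup>2 / (4 * T)))"
          by (simp add: F_def T_def abs_mult mult_ac)
        also have "\<dots> \<le> (4 * pi * T) powr (- (d + j) / 2) * \<bar>\<eta> \<tau>\<bar>
            * (2 * sqrt T * exp (- (norm z)\<^sup>2 / (8 * T)))"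
          by (intro mult_left_mono norm_times_gaussian_le T) auto
        finally show ?thesis by (simp add: mult_ac)
      qed
      have G: "has_bochner_integral lborel ?E
          ((4 * pi * T) powr (- (d + j) / 2) * \<bar>\<eta> \<tau>\<bar> * (2 * sqrt T) * (pi / (1 / (8 * T))) powr (d / 2))"
        using T unfolding d_def by (intro has_bochner_integral_mult_right gaussian_integral) simp
      have Fi: "integrable lborel (\<lambda>z. F (\<tau>, z))"
      proof (rule Bochner_Integration.integrable_bound)
        show "integrable lborel ?E" using G by (simp only: has_bochner_integral_iff)
        show "AE z in lborel. norm (F (\<tau>, z)) \<le> norm (?E z)"
          unfolding real_norm_def[of "?E z" for z] using le abs_ge_self order_trans by blast
        show "(\<lambda>z. F (\<tau>, z)) \<in> borel_measurable lborel" unfolding F_def prod.case by measurable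
      qed
      have "(LINT z|lborel. norm (F (\<tau>, z))) \<le> (LINT z|lborel. ?E z)"
        by (rule integral_mono) (use Fi G le in \<open>simp_all only: has_bochner_integral_iff integrable_norm\<close>)
      also have "\<dots> = (4 * pi * T) powr (- (d + j) / 2) * \<bar>\<eta> \<tau>\<bar> * (2 * sqrt T)
          * (pi / (1 / (8 * T))) powr (d / 2)"
        using G by (simp only: has_bochner_integral_iff)
      also have "(pi / (1 / (8 * T))) powr (d / 2) = 2 powr (d / 2) * (4 * pi * T) powr (d / 2)"
        using T by (simp add: mult_ac flip: powr_mult)
      also have "(4 * pi * T) powr (- (d + j) / 2) * \<bar>\<eta> \<tau>\<bar> * (2 * sqrt T)
          * (2 powr (d / 2) * (4 * pi * T) powr (d / 2))
        = 2 * 2 powr (d / 2) * ((4 * pi * T) powr (- (d + j) / 2) * (4 * pi * T) powr (d / 2)) * sqrt T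
            * \<bar>\<eta> \<tau>\<bar>"
        by (simp only: mult_ac)
      also have "(4 * pi * T) powr (- (d + j) / 2) * (4 * pi * T) powr (d / 2)
          = (4 * pi) powr (- j / 2) * T powr (- j / 2)"
      proof -
        have "- (d + j) / 2 + d / 2 = - j / 2" by (simp add: field_simps)
        then have "(4 * pi * T) powr (- (d + j) / 2) * (4 * pi * T) powr (d / 2)
            = (4 * pi * T) powr (- j / 2)"
          unfolding powr_add[symmetric] by simp
        then show ?thesis using T by (simp add: powr_mult)
      qed
      also have "2 * 2 powr (d / 2) * ((4 * pi) powr (- j / 2) * T powr (- j / 2)) * sqrt T * \<bar>\<eta> \<tau>\<bar>
          = c * (T powr (- j / 2) * T powr (1 / 2)) * \<bar>\<eta> \<tau>\<bar>"
        using T by (simp add: c_def powr_half_sqrt mult_ac)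
      also have "T powr (- j / 2) * T powr (1 / 2) = T powr m"
        unfolding powr_add[symmetric] by (simp add: m_def field_simps)
      also have "T powr m = \<theta> powr m * \<tau> powr m" using \<theta> True by (simp add: T_def powr_mult)
      also have "c * (\<theta> powr m * \<tau> powr m) * \<bar>\<eta> \<tau>\<bar> = \<theta> powr m * (c * \<bar>\<tau> powr m * \<eta> \<tau>\<bar>)"
        by (simp add: abs_mult mult_ac)
      finally show ?thesis using Fi by blast
    qed (simp add: F_def)
    have F: "integrable (lborel \<Otimes>\<^sub>M lborel) F"
    proof (rule lborel_pair.Fubini_integrable[OF Fm])
      show "integrable lborel (\<lambda>\<tau>. LINT z|lborel. norm (F (\<tau>, z)))"
      proof (rule Bochner_Integration.integrable_bound)
        show "integrable lborel (\<lambda>\<tau>. \<theta> powr m * (c * \<bar>\<tau> powr m * \<eta> \<tau>\<bar>))" by (intro integrable_mult_right wi)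
        show "(\<lambda>\<tau>. LINT z|lborel. norm (F (\<tau>, z))) \<in> borel_measurable lborel"
          unfolding F_def split_beta' by measurable
        show "AE \<tau> in lborel. norm (LINT z|lborel. norm (F (\<tau>, z)))
            \<le> norm (\<theta> powr m * (c * \<bar>\<tau> powr m * \<eta> \<tau>\<bar>))"
          using inner tail_const by (intro AE_I2) (simp add: abs_mult)
      qed
    qed (use inner in simp)
    have Ht: "(LINT \<tau>|lborel. F (\<tau>, z)) = norm z * N (d + j) z \<theta>" for z
      unfolding F_def mixture_def prod.case integral_mult_right_zero ..
    have F': "integrable (lborel \<Otimes>\<^sub>M lborel) (\<lambda>(z, \<tau>). F (\<tau>, z))"
      by (rule lborel_pair.integrable_product_swap[OF F])
    have i: "integrable lborel (\<lambda>z::'a. norm z * N (d + j) z \<theta>)"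
      using lborel_pair.integrable_fst'[OF F'] by (simp add: Ht)
    have nF: "integrable (lborel \<Otimes>\<^sub>M lborel) (\<lambda>x. norm (F x))" by (rule integrable_norm[OF F])
    have nF': "integrable (lborel \<Otimes>\<^sub>M lborel) (\<lambda>(z, \<tau>). norm (F (\<tau>, z)))"
      by (rule lborel_pair.integrable_product_swap[OF nF])
    have "(LINT z::'a|lborel. norm z * \<bar>N (d + j) z \<theta>\<bar>) \<le> (LINT z|lborel. LINT \<tau>|lborel. norm (F (\<tau>, z)))"
    proof (rule integral_mono)
      show "integrable lborel (\<lambda>z::'a. norm z * \<bar>N (d + j) z \<theta>\<bar>)"
        using integrable_abs[OF i] by (simp add: abs_mult)
      show "integrable lborel (\<lambda>z. LINT \<tau>|lborel. norm (F (\<tau>, z)))"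
        using lborel_pair.integrable_fst'[OF nF'] by simp
      fix z :: 'a
      have "norm z * \<bar>N (d + j) z \<theta>\<bar> = norm (LINT \<tau>|lborel. F (\<tau>, z))" unfolding Ht by (simp add: abs_mult)
      also have "\<dots> \<le> (LINT \<tau>|lborel. norm (F (\<tau>, z)))" by (rule integral_norm_bound)
      finally show "norm z * \<bar>N (d + j) z \<theta>\<bar> \<le> (LINT \<tau>|lborel. norm (F (\<tau>, z)))" .
    qed
    also have "\<dots> = (LINT \<tau>|lborel. LINT z|lborel. norm (F (\<tau>, z)))"
    proof (rule lborel_pair.Fubini_integral)
      show "integrable (lborel \<Otimes>\<^sub>M lborel) (\<lambda>(\<tau>, z). norm (F (\<tau>, z)))"
        using nF by (simp add: split_beta')
    qed
    also have "\<dots> \<le> (LINT \<tau>|lborel. \<theta> powr m * (c * \<bar>\<tau> powr m * \<eta> \<tau>\<bar>))"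
    proof (rule integral_mono)
      show "integrable lborel (\<lambda>\<tau>. LINT z|lborel. norm (F (\<tau>, z)))"
        using lborel_pair.integrable_fst'[OF nF] by simp
      show "integrable lborel (\<lambda>\<tau>. \<theta> powr m * (c * \<bar>\<tau> powr m * \<eta> \<tau>\<bar>))" by (intro integrable_mult_right wi)
    qed (use inner in blast)
    also have "\<dots> = C * \<theta> powr m" unfolding C_def by (subst integral_mult_right_zero) simp
    finally show ?thesis using i by blast
  qed
  show ?thesis
  proof (rule that[of "C + 1"])
    show "0 < C + 1" using C0 by simp
    fix \<theta> :: real assume \<theta>: "0 < \<theta>"
    show "integrable lborel (\<lambda>z::'a. norm z * N (DIM('a) + j) z \<theta>)" using main[OF \<theta>] by (simp only: d_def)
    have "C * \<theta> powr m \<le> (C + 1) * \<theta> powr m" by (intro mult_right_mono) auto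
    then show "(LINT z::'a|lborel. norm z * \<bar>N (DIM('a) + j) z \<theta>\<bar>) \<le> (C + 1) * \<theta> powr ((1 - j) / 2)"
      using main[OF \<theta>] unfolding d_def m_def by linarith
  qed
qed


text \<open>
  The derivative of the heat kernel in the direction \<open>v\<close>, see \<open>heat_kernel_has_derivative\<close>.
\<close>

definition kernel_deriv :: "'a::euclidean_space \<Rightarrow> 'a \<Rightarrow> real \<Rightarrow> real" where
  "kernel_deriv v z t = - 2 * pi * (z \<bullet> v) * N (real DIM('a) + 2) z (t powr (1 / a))"

lemma time_scale:
  assumes "0 < t"
  shows "0 < t powr (1 / a)" "(t powr (1 / a)) powr a = t" "(t powr (1 / a)) powr (2 * a) = t\<^sup>2"
  using assms a_pos by (auto simp: powr_powr powr_numeral)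

lemma heat_kernel_sup_bound:
  obtains C where "0 < C" "\<And>(x::'a::euclidean_space) t. 0 < t \<Longrightarrow> \<bar>heat_kernel (2 * a) x t\<bar>
      \<le> C * t powr (- (DIM('a) / (2 * a)))"
proof -
  obtain C where C: "0 < C" "\<And>(z::'a) \<theta>. 0 < \<theta> \<Longrightarrow> \<bar>N (DIM('a)) z \<theta>\<bar> \<le> C * \<theta> powr (- real DIM('a) / 2)"
    using N_sup_bound[of "DIM('a)"] a_pos by auto
  show ?thesis
  proof (rule that[OF C(1)])
    fix x :: 'a and t :: real assume t: "0 < t"
    have "(t powr (1 / a)) powr (- real DIM('a) / 2) = t powr (- (DIM('a) / (2 * a)))"
      by (simp add: powr_powr mult.commute)
    then show "\<bar>heat_kernel (2 * a) x t\<bar> \<le> C * t powr (- (DIM('a) / (2 * a)))"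
      using C(2)[OF time_scale(1)[OF t], of x] unfolding heat_kernel_eq_mixture[OF t] by (simp only:)
  qed
qed

lemma heat_kernel_decay:
  obtains C where "0 < C" "\<And>(x::'a::euclidean_space) t. 0 < t \<Longrightarrow> x \<noteq> 0 \<Longrightarrow> \<bar>heat_kernel (2 * a) x t\<bar>
      \<le> C * t * norm x powr (- (2 * a + DIM('a)))"
proof -
  obtain C where C: "0 < C" "\<And>(z::'a) \<theta>. 0 < \<theta> \<Longrightarrow> z \<noteq> 0 \<Longrightarrow> \<bar>N (DIM('a)) z \<theta>\<bar>
      \<le> C * \<theta> powr a * norm z powr (- real DIM('a) - 2 * a)"
    using N_decay[of "DIM('a)"] by auto
  show ?thesis
  proof (rule that[OF C(1)])
    fix x :: 'a and t :: real assume t: "0 < t" and x: "x \<noteq> 0"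
    have "- real DIM('a) - 2 * a = - (2 * a + DIM('a))" by simp
    then show "\<bar>heat_kernel (2 * a) x t\<bar> \<le> C * t * norm x powr (- (2 * a + DIM('a)))"
      using C(2)[OF time_scale(1)[OF t] x] unfolding heat_kernel_eq_mixture[OF t] time_scale(2)[OF t]
          by (simp only:)
  qed
qed

lemma heat_kernel_measurable [measurable]: "0 < t
    \<Longrightarrow> (\<lambda>x::'a::euclidean_space. heat_kernel (2 * a) x t) \<in> borel_measurable borel"
  by (simp add: heat_kernel_eq_mixture)

lemma heat_kernel_first_moment:
  obtains C where "0 < C"
    "\<And>t. 0 < t \<Longrightarrow> integrable lborel (\<lambda>x::'a::euclidean_space. norm x * heat_kernel (2 * a) x t)"
    "\<And>t. 0 < t \<Longrightarrow> (LINT x::'a|lborel. norm x * \<bar>heat_kernel (2 * a) x t\<bar>) \<le> C * t powr (1 / (2 * a))"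
proof -
  obtain C where C: "0 < C" "\<And>\<theta>. 0 < \<theta> \<Longrightarrow> integrable lborel (\<lambda>z::'a. norm z * N (DIM('a) + 0) z \<theta>)"
    "\<And>\<theta>. 0 < \<theta> \<Longrightarrow> (LINT z::'a|lborel. norm z * \<bar>N (DIM('a) + 0) z \<theta>\<bar>) \<le> C * \<theta> powr ((1 - 0) / 2)"
    using N_first_moment[of 0, where 'a='a] half_less_a by auto
  show ?thesis
  proof (rule that[OF C(1)])
    fix t :: real assume t: "0 < t"
    show "integrable lborel (\<lambda>x::'a. norm x * heat_kernel (2 * a) x t)"
      using C(2)[OF time_scale(1)[OF t]] unfolding heat_kernel_eq_mixture[OF t] by simp
    have "(t powr (1 / a)) powr ((1 - 0) / 2) = t powr (1 / (2 * a))"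
      by (simp add: powr_powr mult.commute)
    then show "(LINT x::'a|lborel. norm x * \<bar>heat_kernel (2 * a) x t\<bar>) \<le> C * t powr (1 / (2 * a))"
      using C(3)[OF time_scale(1)[OF t]] unfolding heat_kernel_eq_mixture[OF t] by simp
  qed
qed

text \<open>
  Outside the unit ball \<open>|f x| \<le> |x| |f x|\<close>.
\<close>

lemma integrable_from_first_moment:
  fixes f :: "'a::euclidean_space \<Rightarrow> real"
  assumes [measurable]: "f \<in> borel_measurable borel" and B: "\<And>x. \<bar>f x\<bar> \<le> B"
      and i: "integrable lborel (\<lambda>x. norm x * f x)"
  shows "integrable lborel f"
proof (rule Bochner_Integration.integrable_bound)
  have "integrable lborel (indicator (cball 0 1) :: 'a \<Rightarrow> real)"
    using emeasure_bounded_finite[of "cball (0::'a) 1"] by (intro integrable_real_indicator) auto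
  then show "integrable lborel (\<lambda>x. B * indicator (cball (0::'a) 1) x + \<bar>norm x * f x\<bar>)"
    by (intro Bochner_Integration.integrable_add integrable_mult_right integrable_abs i)
  show "AE x in lborel. norm (f x) \<le> norm (B * indicator (cball (0::'a) 1) x + \<bar>norm x * f x\<bar>)"
  proof (rule AE_I2)
    fix x :: 'a
    have B0: "0 \<le> B" using order_trans[OF abs_ge_zero B] .
    show "norm (f x) \<le> norm (B * indicator (cball (0::'a) 1) x + \<bar>norm x * f x\<bar>)"
    proof (cases "norm x \<le> 1")
      case True
      have "\<bar>f x\<bar> \<le> B + norm x * \<bar>f x\<bar>" using B[of x] by (intro add_increasing2) auto
      then show ?thesis using True B0 by (simp add: abs_mult)
    next
      case False
      then have "1 * \<bar>f x\<bar> \<le> norm x * \<bar>f x\<bar>" by (intro mult_right_mono) auto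
      then show ?thesis using False by (simp add: abs_mult)
    qed
  qed
qed simp

lemma heat_kernel_integrable:
  assumes "0 < t" shows "integrable lborel (\<lambda>x::'a::euclidean_space. heat_kernel (2 * a) x t)"
proof -
  obtain C where C: "\<And>x::'a. \<bar>heat_kernel (2 * a) x t\<bar> \<le> C * t powr (- (DIM('a) / (2 * a)))"
    using heat_kernel_sup_bound[where 'a='a] assms by metis
  obtain C' :: real where "\<And>t. 0 < t \<Longrightarrow> integrable lborel (\<lambda>x::'a. norm x * heat_kernel (2 * a) x t)"
    using heat_kernel_first_moment[where 'a='a] by metis
  then show ?thesis
    using assms C by (intro integrable_from_first_moment[OF _ C]) auto
qed

lemma heat_kernel_has_derivative:
  fixes x v :: "'a::euclidean_space"
  assumes "0 < t"
  shows "((\<lambda>r. heat_kernel (2 * a) (x + r *\<^sub>R v) t) has_field_derivative kernel_deriv v (x + r *\<^sub>R v) t)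
      (at r)"
  using N_has_derivative[OF time_scale(1)[OF assms], of "DIM('a)" x v r] assms
  unfolding heat_kernel_eq_mixture[OF assms] kernel_deriv_def by (simp only:)

lemma kernel_deriv_measurable [measurable]: "(\<lambda>z::'a::euclidean_space. kernel_deriv v z t)
    \<in> borel_measurable borel"
  unfolding kernel_deriv_def by measurable

lemma kernel_deriv_decay:
  obtains C where "0 < C" "\<And>(v::'a::euclidean_space) z t. 0 < t \<Longrightarrow> z \<noteq> 0 \<Longrightarrow>
    \<bar>kernel_deriv v z t\<bar> \<le> C * norm v * t * norm z powr (- (2 * a + DIM('a) + 1))"
proof -
  obtain C where C: "0 < C" "\<And>(z::'a) \<theta>. 0 < \<theta> \<Longrightarrow> z \<noteq> 0 \<Longrightarrow> \<bar>N (real DIM('a) + 2) z \<theta>\<bar>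
      \<le> C * \<theta> powr a * norm z powr (- (real DIM('a) + 2) - 2 * a)"
    using N_decay[of "real DIM('a) + 2"] by auto
  show ?thesis
  proof (rule that[of "2 * pi * C"])
    fix v z :: 'a and t :: real assume t: "0 < t" and z: "z \<noteq> 0"
    have "\<bar>kernel_deriv v z t\<bar> = 2 * pi * \<bar>z \<bullet> v\<bar> * \<bar>N (real DIM('a) + 2) z (t powr (1 / a))\<bar>"
      by (simp add: kernel_deriv_def abs_mult)
    also have "\<dots> \<le> 2 * pi * (norm z * norm v) * (C * t * norm z powr (- (real DIM('a) + 2) - 2 * a))"
      using C(2)[OF time_scale(1)[OF t] z] time_scale(2)[OF t] C(1) t
      by (intro mult_mono Cauchy_Schwarz_ineq2) auto
    also have "\<dots> = 2 * pi * C * norm v * t * (norm z powr 1 * norm z powr (- (real DIM('a) + 2) - 2 * a))"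
      using z by (simp add: mult_ac)
    also have "norm z powr 1 * norm z powr (- (real DIM('a) + 2) - 2 * a)
        = norm z powr (- (2 * a + DIM('a) + 1))"
      unfolding powr_add[symmetric] by (simp add: algebra_simps)
    finally show "\<bar>kernel_deriv v z t\<bar> \<le> 2 * pi * C * norm v * t * norm z powr (- (2 * a + DIM('a) + 1))" .
  qed (use C in simp)
qed

text \<open>
  The factor \<open>z \<bullet> v\<close> is harmless in the unit ball and is absorbed by the decay outside of it.
\<close>

lemma kernel_deriv_bounded:
  assumes t: "0 < t"
  obtains B where "\<And>(z::'a::euclidean_space). \<bar>kernel_deriv v z t\<bar> \<le> B"
proof -
  obtain C1 where C1: "0 < C1" "\<And>(v::'a) z t. 0 < t \<Longrightarrow> z \<noteq> 0 \<Longrightarrow> \<bar>kernel_deriv v z t\<bar>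
      \<le> C1 * norm v * t * norm z powr (- (2 * a + DIM('a) + 1))"
    using kernel_deriv_decay[where 'a='a] by metis
  obtain C2 where C2: "0 < C2" "\<And>(z::'a) \<theta>. 0 < \<theta> \<Longrightarrow> \<bar>N (real DIM('a) + 2) z \<theta>\<bar>
      \<le> C2 * \<theta> powr (- (real DIM('a) + 2) / 2)"
    using N_sup_bound[of "real DIM('a) + 2", where 'a='a] a_pos by auto
  define K where "K = C2 * (t powr (1 / a)) powr (- (real DIM('a) + 2) / 2)"
  have "\<bar>kernel_deriv v z t\<bar> \<le> C1 * norm v * t + 2 * pi * norm v * K" for z :: 'a
  proof (cases "1 \<le> norm z")
    case True
    have "norm z powr (- (2 * a + DIM('a) + 1)) \<le> 1 powr (- (2 * a + DIM('a) + 1))"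
      using True a_pos by (intro powr_mono2') auto
    then have "C1 * norm v * t * norm z powr (- (2 * a + DIM('a) + 1)) \<le> C1 * norm v * t * 1"
      using C1 t by (intro mult_left_mono) auto
    moreover have "0 \<le> 2 * pi * norm v * K" unfolding K_def using C2 by simp
    moreover have "\<bar>kernel_deriv v z t\<bar> \<le> C1 * norm v * t * norm z powr (- (2 * a + DIM('a) + 1))"
      using True by (intro C1(2)[OF t]) auto
    ultimately show ?thesis by linarith
  next
    case False
    have "\<bar>kernel_deriv v z t\<bar> = 2 * pi * \<bar>z \<bullet> v\<bar> * \<bar>N (real DIM('a) + 2) z (t powr (1 / a))\<bar>"
      by (simp add: kernel_deriv_def abs_mult)
    also have "\<dots> \<le> 2 * pi * (1 * norm v) * K"
    proof (intro mult_mono)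
      show "\<bar>z \<bullet> v\<bar> \<le> 1 * norm v"
        using Cauchy_Schwarz_ineq2[of z v] mult_right_mono[of "norm z" 1 "norm v"] False by simp
      show "\<bar>N (real DIM('a) + 2) z (t powr (1 / a))\<bar> \<le> K" unfolding K_def
          by (rule C2(2)[OF time_scale(1)[OF t]])
    qed auto
    finally have "\<bar>kernel_deriv v z t\<bar> \<le> 2 * pi * norm v * K" by (simp only: mult_1)
    then show ?thesis using C1 t by (intro add_increasing) auto
  qed
  then show ?thesis by (rule that)
qed

lemma kernel_deriv_L1:
  obtains C where "0 < C"
    "\<And>(v::'a::euclidean_space) t. 0 < t \<Longrightarrow> integrable lborel (\<lambda>z. kernel_deriv v z t)"
    "\<And>(v::'a::euclidean_space) t. 0 < t \<Longrightarrow> (LINT z|lborel. \<bar>kernel_deriv v z t\<bar>)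
        \<le> C * norm v * t powr (- (1 / (2 * a)))"
proof -
  obtain C where C: "0 < C" "\<And>\<theta>. 0 < \<theta> \<Longrightarrow> integrable lborel (\<lambda>z::'a. norm z * N (real DIM('a) + 2) z \<theta>)"
    "\<And>\<theta>. 0 < \<theta> \<Longrightarrow> (LINT z::'a|lborel. norm z * \<bar>N (real DIM('a) + 2) z \<theta>\<bar>) \<le> C * \<theta> powr ((1 - 2) / 2)"
    using N_first_moment[of 2, where 'a='a] a_pos by auto
  show ?thesis
  proof (rule that[of "2 * pi * C"])
    fix v :: 'a and t :: real assume t: "0 < t"
    let ?\<theta> = "t powr (1 / a)"
    have le: "\<bar>kernel_deriv v z t\<bar> \<le> 2 * pi * norm v * (norm z * \<bar>N (real DIM('a) + 2) z ?\<theta>\<bar>)" for z :: 'a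
    proof -
      have "\<bar>kernel_deriv v z t\<bar> = 2 * pi * \<bar>N (real DIM('a) + 2) z ?\<theta>\<bar> * \<bar>z \<bullet> v\<bar>"
        by (simp add: kernel_deriv_def abs_mult)
      also have "\<dots> \<le> 2 * pi * \<bar>N (real DIM('a) + 2) z ?\<theta>\<bar> * (norm z * norm v)"
        by (intro mult_left_mono Cauchy_Schwarz_ineq2) auto
      finally show ?thesis by (simp add: mult_ac)
    qed
    have wi: "integrable lborel (\<lambda>z::'a. 2 * pi * norm v * (norm z * \<bar>N (real DIM('a) + 2) z ?\<theta>\<bar>))"
      using integrable_abs[OF C(2)[OF time_scale(1)[OF t]]]
          by (intro integrable_mult_right) (simp add: abs_mult)
    show i: "integrable lborel (\<lambda>z. kernel_deriv v z t)"
      by (rule Bochner_Integration.integrable_bound[OF wi]) (use le in \<open>auto intro: order_trans\<close>)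
    have "(LINT z|lborel. \<bar>kernel_deriv v z t\<bar>)
        \<le> (LINT z::'a|lborel. 2 * pi * norm v * (norm z * \<bar>N (real DIM('a) + 2) z ?\<theta>\<bar>))"
      by (rule integral_mono[OF integrable_abs[OF i] wi le])
    also have "\<dots> = 2 * pi * norm v * (LINT z::'a|lborel. norm z * \<bar>N (real DIM('a) + 2) z ?\<theta>\<bar>)"
      by (rule integral_mult_right_zero)
    also have "\<dots> \<le> 2 * pi * norm v * (C * ?\<theta> powr ((1 - 2) / 2))"
      by (intro mult_left_mono C(3) time_scale(1) t) auto
    also have "?\<theta> powr ((1 - 2) / 2) = t powr (- (1 / (2 * a)))" by (simp add: powr_powr mult.commute)
    finally show "(LINT z|lborel. \<bar>kernel_deriv v z t\<bar>) \<le> 2 * pi * C * norm v * t powr (- (1 / (2 * a)))"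
      by (simp add: mult_ac)
  qed (use C in simp)
qed

definition gradient_const :: "nat \<Rightarrow> real" where "gradient_const d
    = 2 * pi * tail_const * mixture_const (real d + 2) a"

lemma kernel_deriv_asymp:
  obtains C where "0 < C" "\<And>(v::'a::euclidean_space) z t. 0 < t \<Longrightarrow> z \<noteq> 0 \<Longrightarrow>
    \<bar>kernel_deriv v z t + gradient_const (DIM('a)) * t * ((z \<bullet> v) * norm z powr (- (2 * a + DIM('a) + 2)))\<bar>
      \<le> C * norm v * t\<^sup>2 * norm z powr (- (4 * a + DIM('a) + 1))"
proof -
  obtain C where C: "0 < C" "\<And>(z::'a) \<theta>. 0 < \<theta> \<Longrightarrow> z \<noteq> 0 \<Longrightarrow>
     \<bar>N (real DIM('a) + 2) z \<theta> - tail_const * mixture_const (real DIM('a) + 2) a * \<theta> powr a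
         * norm z powr (- (real DIM('a) + 2) - 2 * a)\<bar>
      \<le> C * \<theta> powr (2 * a) * norm z powr (- (real DIM('a) + 2) - 4 * a)"
    using N_asymp[of "real DIM('a) + 2", where 'a='a] by auto
  show ?thesis
  proof (rule that[of "2 * pi * C"])
    fix v z :: 'a and t :: real assume t: "0 < t" and z: "z \<noteq> 0"
    have ex: "- (real DIM('a) + 2) - 2 * a = - (2 * a + DIM('a) + 2)" by simp
    have "kernel_deriv v z t + gradient_const (DIM('a)) * t
        * ((z \<bullet> v) * norm z powr (- (2 * a + DIM('a) + 2)))
      = - (2 * pi * (z \<bullet> v) * (N (real DIM('a) + 2) z (t powr (1 / a)) - tail_const
          * mixture_const (real DIM('a) + 2) a * t * norm z powr (- (2 * a + DIM('a) + 2))))"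
      by (simp add: kernel_deriv_def gradient_const_def algebra_simps)
    also have "\<bar>\<dots>\<bar> = 2 * pi * \<bar>z \<bullet> v\<bar> * \<bar>N (real DIM('a) + 2) z (t powr (1 / a)) - tail_const
        * mixture_const (real DIM('a) + 2) a * t * norm z powr (- (2 * a + DIM('a) + 2))\<bar>"
      by (simp add: abs_mult)
    also have "\<dots> \<le> 2 * pi * (norm z * norm v) * (C * t\<^sup>2 * norm z powr (- (real DIM('a) + 2) - 4 * a))"
      using C(2)[OF time_scale(1)[OF t] z] C(1) unfolding time_scale(2,3)[OF t] ex
      by (intro mult_mono Cauchy_Schwarz_ineq2) auto
    also have "\<dots> = 2 * pi * C * norm v * t\<^sup>2 * (norm z powr 1 * norm z powr (- (real DIM('a) + 2) - 4 * a))"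
      using z by (simp add: mult_ac)
    also have "norm z powr 1 * norm z powr (- (real DIM('a) + 2) - 4 * a)
        = norm z powr (- (4 * a + DIM('a) + 1))"
      unfolding powr_add[symmetric] by (simp add: algebra_simps)
    finally show "\<bar>kernel_deriv v z t + gradient_const (DIM('a)) * t
        * ((z \<bullet> v) * norm z powr (- (2 * a + DIM('a) + 2)))\<bar>
      \<le> 2 * pi * C * norm v * t\<^sup>2 * norm z powr (- (4 * a + DIM('a) + 1))" .
  qed (use C in simp)
qed

text \<open>
  The segment from \<open>x\<close> to \<open>x - y\<close> stays outside the ball of radius \<open>|x| / 2\<close>. There the second
  derivatives, which are combinations of mixtures with parameters \<open>d + 2\<close> and \<open>d + 4\<close>, have size
  \<open>t\<close> times \<open>|x|\<close> to the power \<open>- (2 a + d + 2)\<close>.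
\<close>

lemma kernel_deriv_increment:
  obtains C where "0 < C" "\<And>(v::'a::euclidean_space) x y t. 0 < t \<Longrightarrow> x \<noteq> 0 \<Longrightarrow> norm y \<le> norm x / 2 \<Longrightarrow>
    \<bar>kernel_deriv v (x - y) t - kernel_deriv v x t\<bar>
        \<le> C * norm v * norm y * t * norm x powr (- (2 * a + DIM('a) + 2))"
proof -
  define d where "d = real DIM('a)"
  obtain C1 where C1: "0 < C1" "\<And>(z::'a) \<theta>. 0 < \<theta> \<Longrightarrow> z \<noteq> 0 \<Longrightarrow> \<bar>N (d + 2) z \<theta>\<bar>
      \<le> C1 * \<theta> powr a * norm z powr (- (d + 2) - 2 * a)"
    using N_decay[of "d + 2"] by (auto simp: d_def)
  obtain C2 where C2: "0 < C2" "\<And>(z::'a) \<theta>. 0 < \<theta> \<Longrightarrow> z \<noteq> 0 \<Longrightarrow> \<bar>N (d + 4) z \<theta>\<bar>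
      \<le> C2 * \<theta> powr a * norm z powr (- (d + 4) - 2 * a)"
    using N_decay[of "d + 4"] by (auto simp: d_def)
  define e where "e = - (2 * a + d + 2)"
  have e: "e \<le> 0" using a_pos by (simp add: e_def d_def)
  define K where "K = (2 * pi * C1 + 4 * pi\<^sup>2 * C2) * (1/2) powr e"
  show ?thesis
  proof (rule that[of K])
    show "0 < K" unfolding K_def using C1 C2 by (intro mult_pos_pos add_pos_pos) auto
    fix v x y :: 'a and t :: real assume t: "0 < t" and x: "x \<noteq> 0" and y: "norm y \<le> norm x / 2"
    let ?\<theta> = "t powr (1 / a)"
    let ?z = "\<lambda>r. x + r *\<^sub>R (- y)"
    let ?D = "\<lambda>r. - 2 * pi * ((- y) \<bullet> v) * N (d + 2) (?z r) ?\<theta>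
         + - 2 * pi * (?z r \<bullet> v) * (- 2 * pi * (?z r \<bullet> (- y)) * N (d + 2 + 2) (?z r) ?\<theta>)"
    have d1: "((\<lambda>r. N (d + 2) (?z r) ?\<theta>) has_field_derivative
        (- 2 * pi * (?z r \<bullet> (- y)) * N (d + 2 + 2) (?z r) ?\<theta>)) (at r)" for r
      by (rule N_has_derivative[OF time_scale(1)[OF t]]) (simp add: d_def)
    have d2: "((\<lambda>r. - 2 * pi * (?z r \<bullet> v)) has_field_derivative - 2 * pi * ((- y) \<bullet> v)) (at r)" for r
      by (auto intro!: derivative_eq_intros simp: inner_add_left algebra_simps)
    have kd: "kernel_deriv v (?z r) t = (- 2 * pi * (?z r \<bullet> v)) * N (d + 2) (?z r) ?\<theta>" for r
      unfolding kernel_deriv_def d_def ..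
    have der: "((\<lambda>r. kernel_deriv v (?z r) t) has_field_derivative ?D r) (at r)" for r
      unfolding kd by (rule DERIV_cong[OF DERIV_mult[OF d2 d1]]) (simp add: mult_ac)
    have bound: "\<bar>?D r\<bar> \<le> K * norm v * norm y * t * norm x powr e" if r: "r \<in> {0..1}" for r
    proof -
      let ?n = "norm (?z r)"
      have "norm (r *\<^sub>R (- y)) \<le> norm y" using r by (simp add: mult_left_le_one_le)
      then have n: "norm x / 2 \<le> ?n" using y norm_diff_ineq[of x "r *\<^sub>R (- y)"] by linarith
      have n0: "0 < ?n" using n x by (smt (verit) divide_pos_pos zero_less_norm_iff)
      then have z0: "?z r \<noteq> 0" by auto
      have ne: "?n powr e \<le> (1/2) powr e * norm x powr e"
      proof -
        have "?n powr e \<le> (norm x / 2) powr e" using n x e by (intro powr_mono2') auto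
        also have "\<dots> = (1/2 * norm x) powr e" by simp
        finally show ?thesis by (simp only: powr_mult)
      qed
      have b1: "\<bar>N (d + 2) (?z r) ?\<theta>\<bar> \<le> C1 * t * ?n powr e"
        using C1(2)[OF time_scale(1)[OF t] z0] time_scale(2)[OF t] by (simp add: e_def algebra_simps)
      have b2: "?n * (?n * \<bar>N (d + 2 + 2) (?z r) ?\<theta>\<bar>) \<le> C2 * t * ?n powr e"
      proof -
        have "?n * (?n * \<bar>N (d + 2 + 2) (?z r) ?\<theta>\<bar>) \<le> ?n * (?n * (C2 * t * ?n powr (- (d + 4) - 2 * a)))"
          using C2(2)[OF time_scale(1)[OF t] z0] time_scale(2)[OF t]
              by (intro mult_left_mono) (auto simp: add.assoc)
        also have "\<dots> = C2 * t * (?n powr 2 * ?n powr (- (d + 4) - 2 * a))"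
          using n0 by (simp add: power2_eq_square mult_ac)
        also have "?n powr 2 * ?n powr (- (d + 4) - 2 * a) = ?n powr e"
          unfolding powr_add[symmetric] by (simp add: e_def algebra_simps)
        finally show ?thesis .
      qed
      have "\<bar>?D r\<bar> \<le> \<bar>- 2 * pi * ((- y) \<bullet> v) * N (d + 2) (?z r) ?\<theta>\<bar> + \<bar>- 2 * pi * (?z r \<bullet> v)
          * (- 2 * pi * (?z r \<bullet> (- y)) * N (d + 2 + 2) (?z r) ?\<theta>)\<bar>"
        by (rule abs_triangle_ineq)
      also have "\<dots> = 2 * pi * \<bar>y \<bullet> v\<bar> * \<bar>N (d + 2) (?z r) ?\<theta>\<bar> + 4 * pi\<^sup>2
          * (\<bar>?z r \<bullet> v\<bar> * \<bar>?z r \<bullet> (- y)\<bar> * \<bar>N (d + 2 + 2) (?z r) ?\<theta>\<bar>)"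
        by (simp add: abs_mult power2_eq_square)
      also have "\<dots> \<le> 2 * pi * (norm y * norm v) * (C1 * t * ?n powr e) + 4 * pi\<^sup>2
          * ((?n * norm v) * (?n * norm (- y)) * \<bar>N (d + 2 + 2) (?z r) ?\<theta>\<bar>)"
        using C1(1) t by (intro add_mono mult_mono Cauchy_Schwarz_ineq2 b1 order_refl
            mult_nonneg_nonneg) auto
      also have "(?n * norm v) * (?n * norm (- y)) * \<bar>N (d + 2 + 2) (?z r) ?\<theta>\<bar>
          = norm y * norm v * (?n * (?n * \<bar>N (d + 2 + 2) (?z r) ?\<theta>\<bar>))"
        by (simp only: mult_ac norm_minus_cancel)
      also have "2 * pi * (norm y * norm v) * (C1 * t * ?n powr e) + 4 * pi\<^sup>2
          * (norm y * norm v * (?n * (?n * \<bar>N (d + 2 + 2) (?z r) ?\<theta>\<bar>)))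
         \<le> 2 * pi * (norm y * norm v) * (C1 * t * ?n powr e) + 4 * pi\<^sup>2
             * (norm y * norm v * (C2 * t * ?n powr e))"
        by (intro add_left_mono mult_left_mono b2) auto
      also have "\<dots> = (2 * pi * C1 + 4 * pi\<^sup>2 * C2) * norm v * norm y * t * ?n powr e"
          by (simp add: algebra_simps)
      also have "\<dots> \<le> (2 * pi * C1 + 4 * pi\<^sup>2 * C2) * norm v * norm y * t * ((1/2) powr e * norm x powr e)"
        using C1(1) C2(1) t by (intro mult_left_mono ne) auto
      finally show ?thesis by (simp add: K_def mult_ac)
    qed
    have "norm (kernel_deriv v (?z 1) t - kernel_deriv v (?z 0) t)
        \<le> (K * norm v * norm y * t * norm x powr e) * norm (1 - 0 :: real)"
    proof (rule field_differentiable_bound[where S="{0..1::real}" and f="\<lambda>r. kernel_deriv v (?z r) t"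
        and f'="?D"])
      show "((\<lambda>r. kernel_deriv v (?z r) t) has_field_derivative ?D r) (at r within {0..1})"
          if "r \<in> {0..1}" for r
        by (rule has_field_derivative_at_within[OF der])
    qed (use bound in auto)
    then show "\<bar>kernel_deriv v (x - y) t - kernel_deriv v x t\<bar>
        \<le> K * norm v * norm y * t * norm x powr (- (2 * a + DIM('a) + 2))"
      by (simp add: e_def d_def)
  qed
qed

end

section \<open>Expansion of the Duhamel integral\<close>

context stable_index
begin

lemma kernel_deriv_convolution_integrable:
  fixes w :: "'a::euclidean_space \<Rightarrow> real"
  assumes t: "0 < t" and w: "integrable lborel w"
  shows "integrable lborel (\<lambda>y. kernel_deriv v (x - y) t * w y)"
proof -
  obtain B where B: "\<And>z::'a. \<bar>kernel_deriv v z t\<bar> \<le> B" using kernel_deriv_bounded[OF t] by blast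
  have [measurable]: "w \<in> borel_measurable borel" using borel_measurable_integrable[OF w] by simp
  show ?thesis
  proof (rule Bochner_Integration.integrable_bound)
    show "integrable lborel (\<lambda>y. B * w y)" by (intro integrable_mult_right w)
    show "AE y in lborel. norm (kernel_deriv v (x - y) t * w y) \<le> norm (B * w y)"
      using order_trans[OF B abs_ge_self] by (intro AE_I2) (auto simp: abs_mult intro!: mult_right_mono)
  qed measurable
qed

lemma heat_convolution_integrable:
  fixes w :: "'a::euclidean_space \<Rightarrow> real"
  assumes t: "0 < t" and w: "integrable lborel w"
  shows "integrable lborel (\<lambda>y. heat_kernel (2 * a) (x - y) t * w y)"
proof -
  obtain C where C: "\<And>x::'a. \<bar>heat_kernel (2 * a) x t\<bar> \<le> C * t powr (- (DIM('a) / (2 * a)))"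
    using heat_kernel_sup_bound[where 'a='a] t by metis
  have [measurable]: "w \<in> borel_measurable borel" using borel_measurable_integrable[OF w] by simp
  note [measurable] = heat_kernel_measurable[OF t]
  show ?thesis
  proof (rule Bochner_Integration.integrable_bound)
    show "integrable lborel (\<lambda>y. C * t powr (- (DIM('a) / (2 * a))) * w y)"
        by (intro integrable_mult_right w)
    show "AE y in lborel. norm (heat_kernel (2 * a) (x - y) t * w y)
        \<le> norm (C * t powr (- (DIM('a) / (2 * a))) * w y)"
      unfolding norm_mult[of _ "w y" for y] real_norm_def[of "w y" for y]
      using C by (intro AE_I2 mult_right_mono) (auto intro: order_trans[OF _ abs_ge_self])
  qed measurable
qed

lemma heat_convolution_has_derivative:
  fixes w :: "'a::euclidean_space \<Rightarrow> real"
  assumes t: "0 < t" and w: "integrable lborel w"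
  shows "((\<lambda>r. LINT y|lborel. heat_kernel (2 * a) (x + r *\<^sub>R v - y) t * w y) has_field_derivative
           (LINT y|lborel. kernel_deriv v (x - y) t * w y)) (at 0)"
proof -
  obtain B where B: "\<And>z::'a. \<bar>kernel_deriv v z t\<bar> \<le> B" using kernel_deriv_bounded[OF t] by blast
  have [measurable]: "w \<in> borel_measurable borel" using borel_measurable_integrable[OF w] by simp
  note [measurable] = heat_kernel_measurable[OF t]
  have "((\<lambda>r. LINT y|lborel. heat_kernel (2 * a) (x + r *\<^sub>R v - y) t * w y) has_field_derivative
           (LINT y|lborel. kernel_deriv v (x + 0 *\<^sub>R v - y) t * w y)) (at 0)"
  proof (rule has_field_derivative_integral[where f="\<lambda>r y. heat_kernel (2 * a) (x + r *\<^sub>R v - y) t * w y"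
      and f'="\<lambda>r y. kernel_deriv v (x + r *\<^sub>R v - y) t * w y" and w="\<lambda>y. B * \<bar>w y\<bar>"])
    show "integrable lborel (\<lambda>y. heat_kernel (2 * a) (x + r *\<^sub>R v - y) t * w y)" for r
      by (rule heat_convolution_integrable[OF t w])
    show "((\<lambda>r. heat_kernel (2 * a) (x + r *\<^sub>R v - y) t * w y) has_field_derivative kernel_deriv v
        (x + r *\<^sub>R v - y) t * w y) (at r)" for r y
      using heat_kernel_has_derivative[OF t, of "x - y" v r, THEN DERIV_cmult_right, of "w y"]
      by (simp add: algebra_simps)
    show "\<bar>kernel_deriv v (x + r *\<^sub>R v - y) t * w y\<bar> \<le> B * \<bar>w y\<bar>" for r y
      unfolding abs_mult by (intro mult_right_mono B) simp
    show "integrable lborel (\<lambda>y. B * \<bar>w y\<bar>)" by (intro integrable_mult_right integrable_abs w)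
  qed measurable
  then show ?thesis by simp
qed

text \<open>
  The convolution takes values in the line spanned by \<open>b\<close>, so its divergence is the derivative of
  the scalar convolution in the direction \<open>b\<close>.
\<close>

lemma divergence_heat_semigroup:
  fixes w :: "'a::euclidean_space \<Rightarrow> real" and b :: 'a
  assumes t: "0 < t" and w: "integrable lborel w"
    and diff: "heat_semigroup (2 * a) t (\<lambda>y. w y *\<^sub>R b) differentiable (at x)"
  shows "divergence (heat_semigroup (2 * a) t (\<lambda>y. w y *\<^sub>R b)) x
      = (LINT y|lborel. kernel_deriv b (x - y) t * w y)"
proof -
  let ?H = "heat_semigroup (2 * a) t (\<lambda>y. w y *\<^sub>R b)"
  let ?D = "frechet_derivative ?H (at x)"
  let ?K = "\<lambda>v. LINT y|lborel. kernel_deriv v (x - y) t * w y"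
  have H: "?H x = (LINT y|lborel. heat_kernel (2 * a) (x - y) t * w y) *\<^sub>R b" for x
    unfolding heat_semigroup_def scaleR_scaleR
    by (rule integral_scaleR_left) (rule heat_convolution_integrable[OF t w])
  have D: "?D v = ?K v *\<^sub>R b" for v
  proof -
    have "(?H has_derivative ?D) (at x)" using diff frechet_derivative_works by blast
    then have "(?H has_derivative ?D) (at (x + 0 *\<^sub>R v))" by simp
    moreover have "((\<lambda>r. x + r *\<^sub>R v) has_derivative (\<lambda>r. r *\<^sub>R v)) (at (0::real))"
      by (auto intro!: derivative_eq_intros)
    ultimately have "((\<lambda>r. ?H (x + r *\<^sub>R v)) has_derivative (\<lambda>r. ?D (r *\<^sub>R v))) (at (0::real))"
      using has_derivative_compose[of "\<lambda>r. x + r *\<^sub>R v" "\<lambda>r. r *\<^sub>R v" "0::real" UNIV ?H ?D] by simp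
    moreover have "((\<lambda>r. ?H (x + r *\<^sub>R v)) has_derivative (\<lambda>r. (r * ?K v) *\<^sub>R b)) (at (0::real))"
    proof -
      have "((\<lambda>r. LINT y|lborel. heat_kernel (2 * a) (x + r *\<^sub>R v - y) t * w y) has_derivative
          (\<lambda>r. r * ?K v)) (at 0)"
        by (rule has_derivative_eq_rhs[OF heat_convolution_has_derivative[OF t w, unfolded
            has_field_derivative_def]])
           (rule ext, rule mult.commute)
      then show ?thesis unfolding H by (intro derivative_intros) 
    qed
    ultimately have "(\<lambda>r. ?D (r *\<^sub>R v)) = (\<lambda>r. (r * ?K v) *\<^sub>R b)" by (rule has_derivative_unique)
    from fun_cong[OF this, of 1] show ?thesis by simp
  qed
  have "divergence ?H x = (\<Sum>i\<in>Basis. ?K i * (b \<bullet> i))"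
    unfolding divergence_def D by simp
  also have "\<dots> = (\<Sum>i\<in>Basis. (LINT y|lborel. (b \<bullet> i) * (kernel_deriv i (x - y) t * w y)))"
    by (simp add: mult.commute)
  also have "\<dots> = (LINT y|lborel. (\<Sum>i\<in>Basis. (b \<bullet> i) * (kernel_deriv i (x - y) t * w y)))"
    by (rule Bochner_Integration.integral_sum[symmetric])
       (intro integrable_mult_right kernel_deriv_convolution_integrable t w)
  also have "(\<lambda>y. \<Sum>i\<in>Basis. (b \<bullet> i) * (kernel_deriv i (x - y) t * w y))
      = (\<lambda>y. kernel_deriv b (x - y) t * w y)"
  proof
    fix y
    have "(\<Sum>i\<in>Basis. (b \<bullet> i) * (kernel_deriv i (x - y) t * w y))
      = - 2 * pi * (\<Sum>i\<in>Basis. ((x - y) \<bullet> i) * (b \<bullet> i)) * N (real DIM('a) + 2) (x - y) (t powr (1 / a))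
          * w y"
      unfolding kernel_deriv_def sum_distrib_left sum_distrib_right
          by (intro sum.cong refl) (simp add: mult_ac)
    then show "(\<Sum>i\<in>Basis. (b \<bullet> i) * (kernel_deriv i (x - y) t * w y)) = kernel_deriv b (x - y) t * w y"
      unfolding euclidean_inner[symmetric] by (simp add: kernel_deriv_def)
  qed
  finally show ?thesis .
qed

text \<open>
  With \<open>E\<close> for the power \<open>- (2 a + d + 2)\<close> of \<open>|x|\<close>, the integrand \<open>(\<nabla>p(x - y) - \<nabla>p(x)) w y\<close> is at
  most a multiple of \<open>E |y| w y + S |\<nabla>p(x - y)|\<close>. For \<open>|y| \<le> |x| / 2\<close> this is
  \<open>kernel_deriv_increment\<close>. For the other \<open>y\<close> the first gradient is estimated with \<open>w y \<le> S\<close>, and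
  the second one with its decay and \<open>|x| \<le> 2 |y|\<close>.
\<close>

lemma convolution_expansion:
  obtains C where "0 < C" "\<And>(v::'a::euclidean_space) x w t m S.
    \<lbrakk>0 < t; t \<le> 1; 1 \<le> norm x; integrable lborel w; \<forall>y. 0 \<le> w y;
     integrable lborel (\<lambda>y. norm y * w y); (LINT y|lborel. norm y * w y) \<le> m;
     0 \<le> S; \<forall>y. norm x / 2 \<le> norm y \<longrightarrow> w y \<le> S\<rbrakk> \<Longrightarrow>
    \<bar>(LINT y|lborel. kernel_deriv v (x - y) t * w y) + gradient_const (DIM('a)) * t
        * ((x \<bullet> v) * norm x powr (- (2 * a + DIM('a) + 2))) * (LINT y|lborel. w y)\<bar>
     \<le> C * norm v * ((m + (LINT y|lborel. w y)) * norm x powr (- (2 * a + DIM('a) + 2)) + S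
         * t powr (- (1 / (2 * a))))"
proof -
  obtain C1 where C1: "0 < C1" "\<And>(v::'a) z t. 0 < t \<Longrightarrow> z \<noteq> 0 \<Longrightarrow> \<bar>kernel_deriv v z t\<bar>
      \<le> C1 * norm v * t * norm z powr (- (2 * a + DIM('a) + 1))"
    using kernel_deriv_decay[where 'a='a] by metis
  obtain C2 where C2: "0 < C2" "\<And>(v::'a) x y t. 0 < t \<Longrightarrow> x \<noteq> 0 \<Longrightarrow> norm y \<le> norm x / 2 \<Longrightarrow>
    \<bar>kernel_deriv v (x - y) t - kernel_deriv v x t\<bar>
        \<le> C2 * norm v * norm y * t * norm x powr (- (2 * a + DIM('a) + 2))"
    using kernel_deriv_increment[where 'a='a] by metis
  obtain C3 where C3: "0 < C3" "\<And>(v::'a) z t. 0 < t \<Longrightarrow> z \<noteq> 0 \<Longrightarrow>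
    \<bar>kernel_deriv v z t + gradient_const (DIM('a)) * t * ((z \<bullet> v) * norm z powr (- (2 * a + DIM('a) + 2)))\<bar>
      \<le> C3 * norm v * t\<^sup>2 * norm z powr (- (4 * a + DIM('a) + 1))"
    using kernel_deriv_asymp[where 'a='a] by metis
  obtain C4 where C4: "0 < C4" "\<And>(v::'a) t. 0 < t \<Longrightarrow> integrable lborel (\<lambda>z. kernel_deriv v z t)"
    "\<And>(v::'a) t. 0 < t \<Longrightarrow> (LINT z|lborel. \<bar>kernel_deriv v z t\<bar>) \<le> C4 * norm v * t powr (- (1 / (2 * a)))"
    using kernel_deriv_L1[where 'a='a] by metis
  define C where "C = (C2 + 2 * C1) + C3 + C4"
  show ?thesis
  proof (rule that[of C])
    show "0 < C" using C1(1) C2(1) C3(1) C4(1) by (simp add: C_def)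
    fix v x :: 'a and w :: "'a \<Rightarrow> real" and t m S :: real
    assume t: "0 < t" "t \<le> 1" and x1: "1 \<le> norm x" and w: "integrable lborel w" and "\<forall>y. 0 \<le> w y"
      and mi: "integrable lborel (\<lambda>y. norm y * w y)" and m: "(LINT y|lborel. norm y * w y) \<le> m"
      and S0: "0 \<le> S" and "\<forall>y. norm x / 2 \<le> norm y \<longrightarrow> w y \<le> S"
    then have w0: "\<And>y. 0 \<le> w y" and S: "\<And>y. norm x / 2 \<le> norm y \<Longrightarrow> w y \<le> S" by blast+
    have x0: "x \<noteq> 0" using x1 by auto
    define E where "E = norm x powr (- (2 * a + DIM('a) + 2))"
    have E0: "0 \<le> E" by (simp add: E_def)
    define k where "k z = kernel_deriv v z t" for z
    define I where "I = (LINT y|lborel. w y)"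
    have I0: "0 \<le> I" unfolding I_def using w0 by (intro integral_nonneg_AE AE_I2) auto
    have ki: "integrable lborel (\<lambda>y. k (x - y))"
    proof -
      have "integrable lborel (\<lambda>y. k (x + (-1) *\<^sub>R y))"
        unfolding k_def by (subst lborel_integral_affine(1)) (auto intro!: C4(2)[OF t(1)])
      then show ?thesis by simp
    qed
    have kn: "(LINT y|lborel. \<bar>k (x - y)\<bar>) \<le> C4 * norm v * t powr (- (1 / (2 * a)))"
    proof -
      have "(LINT y|lborel. \<bar>k (x - y)\<bar>) = (LINT y|lborel. \<bar>k y\<bar>)"
        using lborel_integral_affine(2)[of "-1" "\<lambda>y. \<bar>k y\<bar>" x] by (simp add: k_def)
      then show ?thesis using C4(3)[OF t(1), of v] by (simp add: k_def)
    qed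
    have kwi: "integrable lborel (\<lambda>y. k (x - y) * w y)"
      unfolding k_def by (rule kernel_deriv_convolution_integrable[OF t(1) w])
    have pt: "\<bar>(k (x - y) - k x) * w y\<bar> \<le> (C2 + 2 * C1) * norm v * E * (norm y * w y) + S
        * \<bar>k (x - y)\<bar>" for y
    proof (cases "norm y \<le> norm x / 2")
      case True
      have "\<bar>k (x - y) - k x\<bar> \<le> C2 * norm v * norm y * t * E"
        unfolding k_def E_def by (rule C2(2)[OF t(1) x0 True])
      also have "\<dots> \<le> C2 * norm v * norm y * 1 * E"
        using C2(1) t E0 by (intro mult_right_mono mult_left_mono) auto
      also have "\<dots> \<le> (C2 + 2 * C1) * norm v * norm y * 1 * E"
        using C1(1) E0 by (intro mult_right_mono) auto
      finally have "\<bar>k (x - y) - k x\<bar> * w y \<le> (C2 + 2 * C1) * norm v * norm y * 1 * E * w y"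
        by (rule mult_right_mono) (rule w0)
      moreover have "0 \<le> S * \<bar>k (x - y)\<bar>" using S0 by simp
      ultimately show ?thesis using w0[of y] by (simp add: abs_mult mult_ac)
    next
      case False
      have e: "norm x powr (- (2 * a + DIM('a) + 1)) = norm x * E"
      proof -
        have "norm x * E = norm x powr 1 * E" using x0 by simp
        also have "\<dots> = norm x powr (- (2 * a + DIM('a) + 1))" unfolding E_def powr_add[symmetric]
            by (simp add: algebra_simps)
        finally show ?thesis by simp
      qed
      have "\<bar>k x\<bar> \<le> C1 * norm v * t * (norm x * E)"
        unfolding k_def e[symmetric] by (rule C1(2)[OF t(1) x0])
      also have "\<dots> \<le> C1 * norm v * 1 * ((2 * norm y) * E)"
        using C1(1) t E0 False by (intro mult_mono mult_right_mono mult_nonneg_nonneg) auto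
      also have "\<dots> \<le> (C2 + 2 * C1) * norm v * E * norm y"
      proof -
        have "(2 * C1) * (norm v * E * norm y) \<le> (C2 + 2 * C1) * (norm v * E * norm y)"
          using C2(1) E0 by (intro mult_right_mono) auto
        then show ?thesis by (simp add: mult_ac)
      qed
      finally have 1: "\<bar>k x\<bar> * w y \<le> (C2 + 2 * C1) * norm v * E * norm y * w y"
        by (rule mult_right_mono) (rule w0)
      have 2: "\<bar>k (x - y)\<bar> * w y \<le> \<bar>k (x - y)\<bar> * S" using False by (intro mult_left_mono S) auto
      have "\<bar>(k (x - y) - k x) * w y\<bar> = \<bar>k (x - y) - k x\<bar> * w y" using w0[of y] by (simp add: abs_mult)
      also have "\<dots> \<le> (\<bar>k (x - y)\<bar> + \<bar>k x\<bar>) * w y" by (intro mult_right_mono abs_triangle_ineq4 w0)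
      also have "\<dots> \<le> \<bar>k (x - y)\<bar> * S + (C2 + 2 * C1) * norm v * E * norm y * w y"
        using 1 2 by (simp only: distrib_right add_mono)
      finally show ?thesis by (simp only: mult_ac add.commute)
    qed
    have di: "integrable lborel (\<lambda>y. (k (x - y) - k x) * w y)"
      unfolding left_diff_distrib by (intro Bochner_Integration.integrable_diff kwi integrable_mult_right w)
    have "\<bar>LINT y|lborel. (k (x - y) - k x) * w y\<bar> \<le> (LINT y|lborel. \<bar>(k (x - y) - k x) * w y\<bar>)"
      using integral_norm_bound[of lborel "\<lambda>y. (k (x - y) - k x) * w y"] by simp
    also have "\<dots> \<le> (LINT y|lborel. (C2 + 2 * C1) * norm v * E * (norm y * w y) + S * \<bar>k (x - y)\<bar>)"
      by (intro integral_mono integrable_abs di pt Bochner_Integration.integrable_add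
          integrable_mult_right mi ki)
    also have "\<dots> = (C2 + 2 * C1) * norm v * E * (LINT y|lborel. norm y * w y) + S
        * (LINT y|lborel. \<bar>k (x - y)\<bar>)"
      by (subst Bochner_Integration.integral_add)
         (auto intro!: integrable_mult_right mi integrable_abs ki simp only: integral_mult_right_zero)
    also have "\<dots> \<le> (C2 + 2 * C1) * norm v * E * m + S * (C4 * norm v * t powr (- (1 / (2 * a))))"
      using C1(1) C2(1) E0 by (intro add_mono mult_left_mono m kn S0) auto
    finally have P1: "\<bar>LINT y|lborel. (k (x - y) - k x) * w y\<bar>
        \<le> (C2 + 2 * C1) * norm v * E * m + S * (C4 * norm v * t powr (- (1 / (2 * a))))" .
    have P2: "\<bar>k x + gradient_const (DIM('a)) * t * ((x \<bullet> v) * E)\<bar> \<le> C3 * norm v * E"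
    proof -
      have "\<bar>k x + gradient_const (DIM('a)) * t * ((x \<bullet> v) * E)\<bar>
          \<le> C3 * norm v * t\<^sup>2 * norm x powr (- (4 * a + DIM('a) + 1))"
        unfolding k_def E_def by (rule C3(2)[OF t(1) x0])
      also have "\<dots> \<le> C3 * norm v * 1 * E"
        unfolding E_def using C3(1) t x1 half_less_a
        by (intro mult_mono powr_mono mult_nonneg_nonneg) (auto simp: power_le_one)
      finally show ?thesis by simp
    qed
    have "(LINT y|lborel. k (x - y) * w y) = (LINT y|lborel. (k (x - y) - k x) * w y + k x * w y)"
      by (simp add: algebra_simps)
    also have "\<dots> = (LINT y|lborel. (k (x - y) - k x) * w y) + k x * I"
      unfolding I_def by (subst Bochner_Integration.integral_add) (auto intro!: di integrable_mult_right w)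
    finally have "(LINT y|lborel. k (x - y) * w y) + gradient_const (DIM('a)) * t * ((x \<bullet> v) * E) * I
       = (LINT y|lborel. (k (x - y) - k x) * w y) + (k x + gradient_const (DIM('a)) * t * ((x \<bullet> v) * E))
           * I"
      by (simp add: algebra_simps)
    also have "\<bar>\<dots>\<bar> \<le> \<bar>LINT y|lborel. (k (x - y) - k x) * w y\<bar> + \<bar>k x + gradient_const (DIM('a)) * t
        * ((x \<bullet> v) * E)\<bar> * I"
      using I0 abs_triangle_ineq[of "LINT y|lborel. (k (x - y) - k x)
          * w y" "(k x + gradient_const (DIM('a)) * t * ((x \<bullet> v) * E)) * I"]
      by (simp add: abs_mult)
    also have "\<dots> \<le> (C2 + 2 * C1) * norm v * E * m + S * (C4 * norm v * t powr (- (1 / (2 * a)))) + C3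
        * norm v * E * I"
      by (intro add_mono P1 mult_right_mono P2 I0)
    also have "\<dots> \<le> C * norm v * E * m + S * (C * norm v * t powr (- (1 / (2 * a)))) + C * norm v * E * I"
    proof -
      have m0: "0 \<le> m" using order_trans[OF integral_nonneg_AE m] w0 by simp
      show ?thesis
        using C1(1) C2(1) C3(1) C4(1) E0 m0 S0 I0
            by (intro add_mono mult_left_mono mult_right_mono) (auto simp: C_def)
    qed
    finally show "\<bar>(LINT y|lborel. kernel_deriv v (x - y) t * w y) + gradient_const (DIM('a)) * t
        * ((x \<bullet> v) * norm x powr (- (2 * a + DIM('a) + 2))) * (LINT y|lborel. w y)\<bar>
     \<le> C * norm v * ((m + (LINT y|lborel. w y)) * norm x powr (- (2 * a + DIM('a) + 2)) + S
         * t powr (- (1 / (2 * a))))"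
      unfolding k_def I_def E_def by (simp add: algebra_simps)
  qed
qed


lemma tail_const_pos: "0 < tail_const"
  unfolding tail_const_def using a_pos a_less_1 by (intro divide_pos_pos Gamma_real_pos) auto

lemma tail_const_eq: "tail_const = a * sin (pi * a) * Gamma a / pi"
proof -
  have "Gamma (complex_of_real a) * Gamma (1 - complex_of_real a)
      = of_real pi / sin (of_real pi * of_real a)"
    by (rule Gamma_reflection_complex)
  moreover have "1 - complex_of_real a = of_real (1 - a)" "of_real pi * of_real a
      = complex_of_real (pi * a)"
    by simp_all
  ultimately have "complex_of_real (Gamma a) * of_real (Gamma (1 - a))
      = of_real pi / of_real (sin (pi * a))"
    by (simp only: Gamma_complex_of_real sin_of_real)
  then have r: "Gamma a * Gamma (1 - a) = pi / sin (pi * a)"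
    by (simp only: of_real_mult[symmetric] of_real_divide[symmetric] of_real_eq_iff)
  have s: "0 < sin (pi * a)" using mult_strict_left_mono[OF a_less_1 pi_gt_zero] a_pos
      by (intro sin_gt_zero) auto
  have G: "0 < Gamma (1 - a)" using a_less_1 by (intro Gamma_real_pos) simp
  show ?thesis unfolding tail_const_def using r s G by (simp add: field_simps)
qed

text \<open>
  The reflection formula turns \<open>1 / \<Gamma>(1 - a)\<close> into \<open>sin (\<pi> a) \<Gamma>(a) / \<pi>\<close>.
\<close>

lemma gradient_const_eq_c1: "gradient_const d = c1 (2 * a) d"
proof -
  have p: "pi powr (- ((real d + 4) / 2)) = pi powr (- (real d + 2) / 2) / pi"
  proof -
    have "- ((real d + 4) / 2) = - (real d + 2) / 2 - 1" by (simp add: field_simps)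
    then show ?thesis by (simp only: powr_diff) simp
  qed
  have q: "2 * 2 powr (2 * a - 1) = (4::real) powr a"
  proof -
    have "(4::real) powr a = (2 powr 2) powr a" by simp
    also have "\<dots> = 2 powr (2 * a)" by (rule powr_powr)
    finally show ?thesis by (simp add: powr_diff)
  qed
  have "c1 (2 * a) d = 2 * pi * a * (2 * 2 powr (2 * a - 1)) * (pi powr (- (real d + 2) / 2) / pi)
      * sin (pi * a) * Gamma ((real d + 2) / 2 + a) * Gamma a"
    unfolding c1_def p[symmetric] by (simp add: algebra_simps add_divide_distrib)
  also have "\<dots> = gradient_const d"
    unfolding gradient_const_def tail_const_eq mixture_const_def q by (simp add: mult_ac)
  finally show ?thesis ..
qed

text \<open>
  For small times every \<open>z \<noteq> 0\<close> lies in the range where the positive leading term of the tail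
  dominates.
\<close>

lemma heat_kernel_eventually_pos:
  fixes z :: "'a::euclidean_space"
  assumes z: "z \<noteq> 0"
  shows "eventually (\<lambda>t. 0 < heat_kernel (2 * a) z t) (at_right 0)"
proof -
  define d where "d = real DIM('a)"
  obtain C where C: "0 < C" "\<And>(z::'a) \<theta>. 0 < \<theta> \<Longrightarrow> z \<noteq> 0 \<Longrightarrow>
    \<bar>N d z \<theta> - tail_const * mixture_const d a * \<theta> powr a * norm z powr (- d - 2 * a)\<bar>
        \<le> C * \<theta> powr (2 * a) * norm z powr (- d - 4 * a)"
    using N_asymp[of d, where 'a='a] by (auto simp: d_def)
  define A where "A = tail_const * mixture_const d a * norm z powr (- d - 2 * a)"
  define B where "B = C * norm z powr (- d - 4 * a)"
  have A: "0 < A" unfolding A_def mixture_const_def using z tail_const_pos a_pos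
    by (intro mult_pos_pos Gamma_real_pos) (auto simp: d_def add_nonneg_pos)
  have B: "0 < B" unfolding B_def using z C by simp
  have "0 < heat_kernel (2 * a) z t" if "0 < t" "t < A / B" for t
  proof -
    have "\<bar>heat_kernel (2 * a) z t - t * A\<bar> \<le> t\<^sup>2 * B"
      using C(2)[OF time_scale(1)[OF that(1)] z]
          unfolding time_scale(2,3)[OF that(1)] heat_kernel_eq_mixture[OF that(1)] A_def B_def d_def
      by (simp only: mult_ac)
    moreover have "t\<^sup>2 * B < t * A" using that B by (simp add: power2_eq_square field_simps)
    ultimately show ?thesis by linarith
  qed
  moreover have "0 < A / B" using A B by simp
  ultimately show ?thesis by (intro eventually_at_rightI[of 0 "A / B"]) auto
qed

text \<open>
  Measurability of \<open>f\<close> is recovered from the integrability of its products with the kernel by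
  dividing: at any point other than the origin the kernel is positive for all small times.
\<close>

lemma flux_measurable:
  fixes f :: "'a::euclidean_space \<Rightarrow> real" and b :: 'a
  assumes b: "b \<noteq> 0"
    and i: "\<And>t. 0 < t \<Longrightarrow> integrable lborel (\<lambda>y. heat_kernel (2 * a) (0 - y) t *\<^sub>R (f y *\<^sub>R b))"
  shows "f \<in> borel_measurable borel"
proof -
  let ?T = "\<lambda>n. inverse (real (Suc n))"
  let ?g = "\<lambda>n y. indicator (- {0}) y * (((heat_kernel (2 * a) (0 - y) (?T n) *\<^sub>R (f y *\<^sub>R b)) \<bullet> b) /
      (heat_kernel (2 * a) (0 - y) (?T n) * (b \<bullet> b)))"
  have T: "filterlim ?T (at_right 0) sequentially"
    unfolding filterlim_at by (auto simp del: of_nat_Suc intro: LIMSEQ_inverse_real_of_nat)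
  have "(\<lambda>y. indicator (- {0}) y * f y) \<in> borel_measurable borel"
  proof (rule borel_measurable_LIMSEQ_real)
    fix n
    have "(\<lambda>y. heat_kernel (2 * a) (0 - y) (?T n) *\<^sub>R (f y *\<^sub>R b)) \<in> borel_measurable borel"
      using borel_measurable_integrable[OF i[of "?T n"]] by simp
    moreover have "(\<lambda>y. heat_kernel (2 * a) (0 - y) (?T n)) \<in> borel_measurable borel"
      by (rule measurable_compose[OF _ heat_kernel_measurable]) auto
    ultimately show "?g n \<in> borel_measurable borel" by measurable
  next
    fix y :: 'a
    show "(\<lambda>n. ?g n y) \<longlonglongrightarrow> indicator (- {0}) y * f y"
    proof (cases "y = 0")
      case False
      then have "0 - y \<noteq> 0" by simp
      from heat_kernel_eventually_pos[OF this]
      have "eventually (\<lambda>n. 0 < heat_kernel (2 * a) (0 - y) (?T n)) sequentially"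
        using T unfolding filterlim_iff by blast
      then have "eventually (\<lambda>n. ?g n y = indicator (- {0}) y * f y) sequentially"
        by eventually_elim (use b in simp)
      then show ?thesis by (rule tendsto_eventually)
    qed simp
  qed
  then have "(\<lambda>y. indicator (- {0}) y * f y + f 0 * indicator {0} y) \<in> borel_measurable borel" by measurable
  moreover have "indicator (- {0}) y * f y + f 0 * indicator {0} y = f y" for y by (simp add: indicator_def)
  ultimately show ?thesis by (simp only:)
qed

text \<open>
  The bounds on the weight \<open>w\<^sub>s = u(\<cdot>, s)\<^sup>q\<close> come from splitting off one factor: \<open>u\<close> to the power
  \<open>q - 1\<close> is at most a multiple of \<open>s\<^sup>-\<^sup>\<beta>\<close> with \<open>\<beta> = (\<alpha> - 1) / \<alpha>\<close>, and the remaining \<open>u \<le> C p\<close>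
  brings the moments of the kernel. The first moment of \<open>w\<^sub>s\<close> is then of order
  \<open>1 / \<alpha> - \<beta> = (2 - \<alpha>) / \<alpha>\<close> in \<open>s\<close>, which is bounded since \<open>\<alpha> < 2\<close>.
\<close>

lemma profile_expansion:
  fixes u :: "'a::euclidean_space \<Rightarrow> real \<Rightarrow> real" and b :: 'a
  assumes b: "b \<noteq> 0"
    and duhamel: "duhamel_solution (2 * a) b M u"
    and sim: "self_similar (2 * a) u"
    and "0 < C"
    and u: "\<And>x t. 0 < t \<Longrightarrow> 0 \<le> u x t \<and> u x t \<le> C * heat_kernel (2 * a) x t"
  defines "q \<equiv> q_tilde (2 * a) DIM('a)"
  shows "\<exists>K. \<forall>x. 1 \<le> norm x \<longrightarrow>
    \<bar>profile u x - (M * heat_profile (2 * a) x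
       + gradient_const DIM('a) * (2 * a)\<^sup>2 / (2 * a + 1) * (LINT y|lborel. profile u y powr q)
           * ((b \<bullet> x) / norm x powr (2 * a + DIM('a) + 2)))\<bar>
     \<le> K * max (norm x powr (- (q * (2 * a + DIM('a))))) (norm x powr (- (2 * a + DIM('a) + 2)))"
proof -
  define d where "d = real DIM('a)"
  have d: "0 < d" by (simp add: d_def)
  define e where "e = (2 * a - 1) / d"
  have e: "0 < e" using half_less_a d by (simp add: e_def)
  have q: "q = 1 + e" by (simp add: q_def q_tilde_def e_def d_def)
  define \<beta> where "\<beta> = 1 - 1 / (2 * a)"
  have \<beta>: "0 < \<beta>" "\<beta> < 1/2" "\<beta> < 1" using half_less_a a_less_1 by (auto simp: \<beta>_def field_simps)
  have de: "d / (2 * a) * e = \<beta>" using d a_pos by (simp add: e_def \<beta>_def field_simps)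
  define f where "f s y = u y s powr q" for s y
  have fu: "u y s * \<bar>u y s\<bar> powr ((2 * a - 1) / DIM('a)) = f s y" if "0 < s" for s y
    using mult_abs_powr[of "u y s" "(2 * a - 1) / DIM('a)"] u[OF that, of y]
        by (simp add: f_def q e_def d_def)
  have flux: "flux (2 * a) b (\<lambda>z. u z s) = (\<lambda>y. f s y *\<^sub>R b)" if "0 < s" for s
    unfolding flux_def using fu[OF that] by auto
  have duh: "\<And>t x s. 0 < t \<Longrightarrow> s \<in> {0<..<t} \<Longrightarrow> integrable lborel
      (\<lambda>y. heat_kernel (2 * a) (x - y) (t - s) *\<^sub>R flux (2 * a) b (\<lambda>z. u z s) y)"
    "\<And>t x s. 0 < t \<Longrightarrow> s \<in> {0<..<t} \<Longrightarrow> heat_semigroup (2 * a) (t - s) (flux (2 * a) b (\<lambda>z. u z s))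
        differentiable (at x)"
    "\<And>t x. 0 < t \<Longrightarrow> set_integrable lborel {0<..<t}
        (\<lambda>s. divergence (heat_semigroup (2 * a) (t - s) (flux (2 * a) b (\<lambda>z. u z s))) x)"
    "\<And>t x. 0 < t \<Longrightarrow> u x t = M * heat_kernel (2 * a) x t
        - (LINT s:{0<..<t}|lborel. divergence
            (heat_semigroup (2 * a) (t - s) (flux (2 * a) b (\<lambda>z. u z s))) x)"
    using duhamel unfolding duhamel_solution_def by blast+
  have f0: "0 \<le> f s y" for s y by (simp add: f_def)
  have hk0: "0 \<le> heat_kernel (2 * a) x t" if "0 < t" for x :: 'a and t
  proof -
    have "0 \<le> C * heat_kernel (2 * a) x t" using u[OF that, of x] by linarith
    then show ?thesis using \<open>0 < C\<close> by (simp add: zero_le_mult_iff)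
  qed
  \<comment> \<open>The solution is only given pointwise. Measurability at time one is extracted from the Duhamel
    formula at the times \<open>1 + t\<close>, and self-similarity carries it over to all times.\<close>
  have f1m: "f 1 \<in> borel_measurable borel"
  proof (rule flux_measurable[OF b])
    fix t :: real assume "0 < t"
    then show "integrable lborel (\<lambda>y. heat_kernel (2 * a) (0 - y) t *\<^sub>R (f 1 y *\<^sub>R b))"
      using duh(1)[of "1 + t" 1 0] flux[of 1] by simp
  qed
  have scale: "f s y = s powr (- (d / (2 * a) * q)) * f 1 (s powr (- (1 / (2 * a))) *\<^sub>R y)"
      if s: "0 < s" for s y
  proof -
    have "u y s = s powr (- (d / (2 * a))) * u (s powr (- (1 / (2 * a))) *\<^sub>R y) 1"
      using sim s unfolding self_similar_def profile_def d_def by blast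
    then have "f s y = (s powr (- (d / (2 * a))) * u (s powr (- (1 / (2 * a))) *\<^sub>R y) 1) powr q"
      by (simp only: f_def)
    also have "\<dots> = (s powr (- (d / (2 * a)))) powr q * f 1 (s powr (- (1 / (2 * a))) *\<^sub>R y)"
      by (simp only: f_def powr_mult)
    finally show ?thesis by (simp only: powr_powr mult_minus_left)
  qed
  have fm: "f s \<in> borel_measurable borel" if "0 < s" for s
  proof -
    note [measurable] = f1m
    show ?thesis unfolding scale[OF that, abs_def] by measurable
  qed
  obtain C1 where C1: "0 < C1" "\<And>(x::'a) t. 0 < t \<Longrightarrow> \<bar>heat_kernel (2 * a) x t\<bar>
      \<le> C1 * t powr (- (d / (2 * a)))"
    by (rule heat_kernel_sup_bound[where 'a='a, folded d_def]) (rule that)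
  obtain C2 where C2: "0 < C2" "\<And>(x::'a) t. 0 < t \<Longrightarrow> x \<noteq> 0 \<Longrightarrow> \<bar>heat_kernel (2 * a) x t\<bar>
      \<le> C2 * t * norm x powr (- (2 * a + d))"
    by (rule heat_kernel_decay[where 'a='a, folded d_def]) (rule that)
  obtain C3 where C3: "0 < C3" "\<And>t. 0 < t \<Longrightarrow> integrable lborel (\<lambda>x::'a. norm x * heat_kernel (2 * a) x t)"
    "\<And>t. 0 < t \<Longrightarrow> (LINT x::'a|lborel. norm x * \<bar>heat_kernel (2 * a) x t\<bar>) \<le> C3 * t powr (1 / (2 * a))"
    by (rule heat_kernel_first_moment[where 'a='a]) (rule that)
  define K0 where "K0 = (C * C1) powr e * C"
  have K0: "0 < K0" using \<open>0 < C\<close> C1(1) by (simp add: K0_def)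
  have fb: "f s y \<le> K0 * s powr (- \<beta>) * heat_kernel (2 * a) y s" if s: "0 < s" for s y
  proof -
    have ub: "u y s \<le> C * heat_kernel (2 * a) y s" "0 \<le> u y s" using u[OF s, of y] by auto
    have "heat_kernel (2 * a) y s \<le> C1 * s powr (- (d / (2 * a)))"
      using C1(2)[OF s, of y] by linarith
    then have "C * heat_kernel (2 * a) y s \<le> C * (C1 * s powr (- (d / (2 * a))))"
      using \<open>0 < C\<close> by (intro mult_left_mono) auto
    then have "u y s \<le> C * (C1 * s powr (- (d / (2 * a))))"
      using ub(1) by linarith
    then have "u y s powr e \<le> (C * C1 * s powr (- (d / (2 * a)))) powr e"
      using ub(2) e by (intro powr_mono2) (auto simp: mult.assoc)
    also have "\<dots> = (C * C1) powr e * s powr (- \<beta>)"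
      unfolding powr_mult powr_powr mult_minus_left de ..
    finally have pe: "u y s powr e \<le> (C * C1) powr e * s powr (- \<beta>)" .
    have "f s y = u y s powr e * u y s"
      using mult_abs_powr[OF ub(2), of e] ub(2) by (simp add: f_def q mult.commute)
    also have "\<dots> \<le> ((C * C1) powr e * s powr (- \<beta>)) * (C * heat_kernel (2 * a) y s)"
      using pe ub by (intro mult_mono) auto
    finally show ?thesis by (simp add: K0_def mult_ac)
  qed
  have fi: "integrable lborel (f s)" if s: "0 < s" for s
  proof (rule Bochner_Integration.integrable_bound)
    show "integrable lborel (\<lambda>y::'a. K0 * s powr (- \<beta>) * heat_kernel (2 * a) y s)"
      by (intro integrable_mult_right heat_kernel_integrable s)
    show "AE y in lborel. norm (f s y) \<le> norm (K0 * s powr (- \<beta>) * heat_kernel (2 * a) y s)"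
      using fb[OF s] f0 by (intro AE_I2) (auto intro: order_trans[OF _ abs_ge_self])
  qed (use fm[OF s] in simp)
  have fmi: "integrable lborel (\<lambda>y. norm y * f s y)"
    and fmb: "(LINT y|lborel. norm y * f s y) \<le> K0 * C3 * s powr (1 / (2 * a) - \<beta>)" if s: "0 < s" for s
  proof -
    have le: "norm y * f s y \<le> K0 * s powr (- \<beta>) * (norm y * heat_kernel (2 * a) y s)" for y
      using mult_left_mono[OF fb[OF s, of y] norm_ge_zero[of y]] by (simp only: mult_ac)
    have wi: "integrable lborel (\<lambda>y::'a. K0 * s powr (- \<beta>) * (norm y * heat_kernel (2 * a) y s))"
      by (intro integrable_mult_right C3(2) s)
    show i: "integrable lborel (\<lambda>y. norm y * f s y)"
    proof (rule Bochner_Integration.integrable_bound[OF wi])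
      show "AE y in lborel. norm (norm y * f s y)
          \<le> norm (K0 * s powr (- \<beta>) * (norm y * heat_kernel (2 * a) y s))"
        using le f0 by (intro AE_I2) (auto intro: order_trans[OF _ abs_ge_self])
    qed (use fm[OF s] in simp)
    have "(LINT y|lborel. norm y * f s y) \<le> (LINT y::'a|lborel. K0 * s powr (- \<beta>)
        * (norm y * heat_kernel (2 * a) y s))"
      by (rule integral_mono[OF i wi le])
    also have "\<dots> = K0 * s powr (- \<beta>) * (LINT y::'a|lborel. norm y * \<bar>heat_kernel (2 * a) y s\<bar>)"
      using hk0[OF s] by simp
    also have "\<dots> \<le> K0 * s powr (- \<beta>) * (C3 * s powr (1 / (2 * a)))"
      using K0 by (intro mult_left_mono C3(3) s) auto
    also have "\<dots> = K0 * C3 * (s powr (1 / (2 * a)) * s powr (- \<beta>))" by (simp only: mult_ac)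
    also have "s powr (1 / (2 * a)) * s powr (- \<beta>) = s powr (1 / (2 * a) - \<beta>)"
      unfolding powr_add[symmetric] by simp
    finally show "(LINT y|lborel. norm y * f s y) \<le> K0 * C3 * s powr (1 / (2 * a) - \<beta>)" .
  qed
  define m where "m = (LINT y|lborel. f 1 y)"
  have m0: "0 \<le> m" unfolding m_def by (intro integral_nonneg_AE AE_I2 f0)
  have mass: "(LINT y|lborel. f s y) = s powr (- \<beta>) * m" if s: "0 < s" for s
  proof -
    let ?c = "s powr (- (1 / (2 * a)))"
    have c: "?c \<noteq> 0" "\<bar>?c\<bar> ^ DIM('a) = s powr (- (d / (2 * a)))"
      using s by (auto simp: d_def powr_powr simp flip: powr_realpow)
    have "m = s powr (- (d / (2 * a))) * (LINT y|lborel. f 1 (?c *\<^sub>R y))"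
      using lborel_integral_affine(2)[OF c(1) f1m, of 0] c(2) by (simp add: m_def)
    then have "(LINT y|lborel. f 1 (?c *\<^sub>R y)) = s powr (d / (2 * a)) * m"
      using s by (simp add: powr_minus field_simps)
    then have "(LINT y|lborel. f s y) = s powr (- (d / (2 * a) * q)) * (s powr (d / (2 * a)) * m)"
      unfolding scale[OF s] integral_mult_right_zero by (simp only:)
    also have "\<dots> = s powr (- (d / (2 * a) * q) + d / (2 * a)) * m" by (simp only: powr_add mult.assoc)
    also have "- (d / (2 * a) * q) + d / (2 * a) = - \<beta>" unfolding q de[symmetric]
        by (simp add: add_divide_distrib algebra_simps)
    finally show ?thesis .
  qed
  define K2 where "K2 = (C * C2 * (1/2) powr (- (2 * a + d))) powr q"
  have tail: "f s y \<le> K2 * norm x powr (- (q * (2 * a + d)))" if s: "0 < s" "s < 1" and x: "1 \<le> norm x"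
      and y: "norm x / 2 \<le> norm y" for s and x y :: 'a
  proof -
    have y0: "y \<noteq> 0" using x y by auto
    have "u y s \<le> C * heat_kernel (2 * a) y s" using u[OF s(1), of y] by auto
    also have "\<dots> \<le> C * (C2 * s * norm y powr (- (2 * a + d)))"
      using C2(2)[OF s(1) y0] \<open>0 < C\<close> by (intro mult_left_mono) auto
    also have "\<dots> \<le> C * (C2 * 1 * (norm x / 2) powr (- (2 * a + d)))"
      using \<open>0 < C\<close> C2(1) s x y a_pos d by (intro mult_left_mono mult_mono powr_mono2') auto
    also have "(norm x / 2) powr (- (2 * a + d)) = (1/2) powr (- (2 * a + d)) * norm x powr (- (2 * a + d))"
      unfolding powr_mult[symmetric] by simp
    finally have "u y s \<le> (C * C2 * (1/2) powr (- (2 * a + d))) * norm x powr (- (2 * a + d))"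
        by (simp only: mult_ac mult_1)
    then have "f s y \<le> ((C * C2 * (1/2) powr (- (2 * a + d))) * norm x powr (- (2 * a + d))) powr q"
      unfolding f_def using u[OF s(1), of y] q e by (intro powr_mono2) auto
    also have "\<dots> = K2 * (norm x powr (- (2 * a + d))) powr q" by (simp only: K2_def powr_mult)
    also have "(norm x powr (- (2 * a + d))) powr q = norm x powr (- (q * (2 * a + d)))"
      unfolding powr_powr mult_minus_left mult.commute[of q] ..
    finally show ?thesis .
  qed
  have K2: "0 \<le> K2" by (simp add: K2_def)
  obtain C5 where C5: "0 < C5" "\<And>(v::'a) x w t m S.
    \<lbrakk>0 < t; t \<le> 1; 1 \<le> norm x; integrable lborel w; \<forall>y. 0 \<le> w y;
     integrable lborel (\<lambda>y. norm y * w y); (LINT y|lborel. norm y * w y) \<le> m;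
     0 \<le> S; \<forall>y. norm x / 2 \<le> norm y \<longrightarrow> w y \<le> S\<rbrakk> \<Longrightarrow>
    \<bar>(LINT y|lborel. kernel_deriv v (x - y) t * w y) + gradient_const (DIM('a)) * t
        * ((x \<bullet> v) * norm x powr (- (2 * a + DIM('a) + 2))) * (LINT y|lborel. w y)\<bar>
     \<le> C5 * norm v * ((m + (LINT y|lborel. w y)) * norm x powr (- (2 * a + DIM('a) + 2)) + S
         * t powr (- (1 / (2 * a))))"
    by (rule convolution_expansion[where 'a='a]) (rule that)
  \<comment> \<open>The dependence on \<open>s\<close> of the error: first moment, mass, and gradient norm times tail.\<close>
  define W where "W s = K0 * C3 + m * s powr (- \<beta>) + K2 * (1 - s) powr (- (1 / (2 * a)))" for s
  have i1: "has_bochner_integral lborel (\<lambda>s. indicator {0<..<1} s * s powr (- \<beta>)) (1 / (- \<beta> + 1))"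
    by (rule powr_set_integral) (use \<beta> in simp)
  have i2: "has_bochner_integral lborel (\<lambda>s. indicator {0<..<1} s * s powr (1 - \<beta>)) (1 / (1 - \<beta> + 1))"
    by (rule powr_set_integral) (use \<beta> in simp)
  have i3: "integrable lborel (\<lambda>s. indicator {0<..<1} s * (1 - s) powr (- (1 / (2 * a))))"
    by (rule reflected_powr_set_integrable) (use half_less_a in \<open>simp add: field_simps\<close>)
  have i0: "integrable lborel (\<lambda>s::real. indicator {0<..<1} s :: real)"
    by (intro integrable_real_indicator) auto
  have Wi: "integrable lborel (\<lambda>s. indicator {0<..<1} s * W s)"
  proof -
    have "integrable lborel (\<lambda>s. K0 * C3 * indicator {0<..<1} s + m
        * (indicator {0<..<1} s * s powr (- \<beta>)) + K2
            * (indicator {0<..<1} s * (1 - s) powr (- (1 / (2 * a)))))"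
      using i1 by (intro Bochner_Integration.integrable_add integrable_mult_right i0 i3)
          (simp add: has_bochner_integral_iff)
    then show ?thesis by (simp only: W_def distrib_left mult_ac)
  qed
  have beta: "has_bochner_integral lborel (\<lambda>s. indicator {0<..<1} s * ((1 - s) * s powr (- \<beta>)))
      ((2 * a)\<^sup>2 / (2 * a + 1))"
  proof -
    have "has_bochner_integral lborel (\<lambda>s. indicator {0<..<1} s * s powr (- \<beta>) - indicator {0<..<1} s
        * s powr (1 - \<beta>)) (1 / (- \<beta> + 1) - 1 / (1 - \<beta> + 1))"
      by (rule has_bochner_integral_diff[OF i1 i2])
    moreover have "indicator {0<..<1} s * s powr (- \<beta>) - indicator {0<..<1} s * s powr (1 - \<beta>)
        = indicator {0<..<1} s * ((1 - s) * s powr (- \<beta>))" for s :: real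
    proof (cases "0 < s")
      case True
      then have "s powr (1 - \<beta>) = s * s powr (- \<beta>)" using powr_add[of s 1 "- \<beta>"] by simp
      then show ?thesis by (simp add: algebra_simps)
    qed simp
    moreover have "1 / (- \<beta> + 1) - 1 / (1 - \<beta> + 1) = (2 * a)\<^sup>2 / (2 * a + 1)"
      using a_pos by (simp add: \<beta>_def field_simps power2_eq_square)
    ultimately show ?thesis by (simp only:)
  qed
  define K where "K = C5 * norm b * (LINT s|lborel. indicator {0<..<1} s * W s)"
  have "\<bar>profile u x - (M * heat_profile (2 * a) x
       + gradient_const DIM('a) * (2 * a)\<^sup>2 / (2 * a + 1) * m
           * ((b \<bullet> x) / norm x powr (2 * a + DIM('a) + 2)))\<bar>
     \<le> K * max (norm x powr (- (q * (2 * a + DIM('a))))) (norm x powr (- (2 * a + DIM('a) + 2)))"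
         if x: "1 \<le> norm x" for x
  proof -
    define E where "E = max (norm x powr (- (q * (2 * a + DIM('a)))))
        (norm x powr (- (2 * a + DIM('a) + 2)))"
    have E: "0 \<le> E" "norm x powr (- (q * (2 * a + d))) \<le> E" "norm x powr (- (2 * a + DIM('a) + 2)) \<le> E"
      unfolding E_def d_def by (simp_all add: le_max_iff_disj)
    define G where "G s = divergence (heat_semigroup (2 * a) (1 - s) (flux (2 * a) b (\<lambda>z. u z s))) x" for s
    define Q where "Q = gradient_const DIM('a) * m * ((x \<bullet> b) * norm x powr (- (2 * a + DIM('a) + 2)))"
    have Gi: "integrable lborel (\<lambda>s. indicator {0<..<1} s * G s)"
      using duh(3)[of 1 x] by (simp add: set_integrable_def G_def)
    have uG: "u x 1 = M * heat_kernel (2 * a) x 1 - (LINT s|lborel. indicator {0<..<1} s * G s)"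
      using duh(4)[of 1 x] by (simp add: set_lebesgue_integral_def G_def)
    have est: "\<bar>G s + Q * ((1 - s) * s powr (- \<beta>))\<bar> \<le> C5 * norm b * E * W s" if s: "s \<in> {0<..<1}" for s
    proof -
      have s': "0 < s" "s < 1" "0 < 1 - s" "1 - s \<le> 1" using s by auto
      have G: "G s = (LINT y|lborel. kernel_deriv b (x - y) (1 - s) * f s y)"
        unfolding G_def flux[OF s'(1)]
        by (rule divergence_heat_semigroup[OF s'(3) fi[OF s'(1)]])
            (use duh(2)[of 1 s x] s flux[OF s'(1)] in simp)
      have "1 / (2 * a) - \<beta> \<ge> 0" using a_pos a_less_1 by (simp add: \<beta>_def field_simps)
      then have "s powr (1 / (2 * a) - \<beta>) \<le> 1" using s' by (intro powr_le1) auto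
      then have "K0 * C3 * s powr (1 / (2 * a) - \<beta>) \<le> K0 * C3 * 1" using K0 C3(1)
          by (intro mult_left_mono) auto
      then have mb: "(LINT y|lborel. norm y * f s y) \<le> K0 * C3" using fmb[OF s'(1)] by linarith
      have "\<bar>G s + gradient_const (DIM('a)) * (1 - s)
          * ((x \<bullet> b) * norm x powr (- (2 * a + DIM('a) + 2))) * (s powr (- \<beta>) * m)\<bar>
        \<le> C5 * norm b * ((K0 * C3 + s powr (- \<beta>) * m) * norm x powr (- (2 * a + DIM('a) + 2)) + K2
            * norm x powr (- (q * (2 * a + d))) * (1 - s) powr (- (1 / (2 * a))))"
        unfolding G mass[OF s'(1), symmetric]
        by (rule C5(2)) (use s' x fi fmi f0 mb K2 tail in auto)
      also have "\<dots> \<le> C5 * norm b * ((K0 * C3 + s powr (- \<beta>) * m) * E + K2 * E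
          * (1 - s) powr (- (1 / (2 * a))))"
        using C5(1) K0 C3(1) m0 K2 E by (intro mult_left_mono add_mono mult_right_mono) auto
      also have "\<dots> = C5 * norm b * E * W s" by (simp add: W_def algebra_simps)
      finally show ?thesis by (simp add: Q_def mult_ac)
    qed
    have bi: "integrable lborel (\<lambda>s. Q * (indicator {0<..<1} s * ((1 - s) * s powr (- \<beta>))))"
      using beta by (intro integrable_mult_right) (simp only: has_bochner_integral_iff)
    have "\<bar>LINT s|lborel. indicator {0<..<1} s * G s + Q
        * (indicator {0<..<1} s * ((1 - s) * s powr (- \<beta>)))\<bar>
      \<le> (LINT s|lborel. \<bar>indicator {0<..<1} s * G s + Q
          * (indicator {0<..<1} s * ((1 - s) * s powr (- \<beta>)))\<bar>)"
      using integral_norm_bound[of lborel "\<lambda>s. indicator {0<..<1} s * G s + Q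
          * (indicator {0<..<1} s * ((1 - s) * s powr (- \<beta>)))"] by simp
    also have "\<dots> \<le> (LINT s|lborel. C5 * norm b * E * (indicator {0<..<1} s * W s))"
    proof (rule integral_mono)
      show "integrable lborel (\<lambda>s. \<bar>indicator {0<..<1} s * G s + Q
          * (indicator {0<..<1} s * ((1 - s) * s powr (- \<beta>)))\<bar>)"
        by (intro integrable_abs Bochner_Integration.integrable_add Gi bi)
      show "integrable lborel (\<lambda>s. C5 * norm b * E * (indicator {0<..<1} s * W s))"
          by (intro integrable_mult_right Wi)
      fix s :: real
      show "\<bar>indicator {0<..<1} s * G s + Q * (indicator {0<..<1} s * ((1 - s) * s powr (- \<beta>)))\<bar>
          \<le> C5 * norm b * E * (indicator {0<..<1} s * W s)"
        using est[of s] by (cases "s \<in> {0<..<1}") auto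
    qed
    also have "\<dots> = K * E" unfolding integral_mult_right_zero K_def by (simp only: mult_ac)
    finally have "\<bar>(LINT s|lborel. indicator {0<..<1} s * G s) + Q * ((2 * a)\<^sup>2 / (2 * a + 1))\<bar> \<le> K * E"
      using Bochner_Integration.integral_add[OF Gi bi] beta
      unfolding integral_mult_right_zero has_bochner_integral_iff by simp
    moreover have "profile u x - (M * heat_profile (2 * a) x + gradient_const DIM('a)
        * (2 * a)\<^sup>2 / (2 * a + 1) * m * ((b \<bullet> x) / norm x powr (2 * a + DIM('a) + 2)))
      = - ((LINT s|lborel. indicator {0<..<1} s * G s) + Q * ((2 * a)\<^sup>2 / (2 * a + 1)))"
      unfolding profile_def uG heat_profile_eq_heat_kernel Q_def powr_minus divide_inverse
      by (simp add: inner_commute algebra_simps)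
    ultimately show ?thesis unfolding E_def by simp
  qed
  then show ?thesis unfolding m_def f_def profile_def by blast
qed

end

theorem theorem2p4:
  fixes \<alpha> M C :: real
    and b :: "'a::euclidean_space"
    and u :: "'a \<Rightarrow> real \<Rightarrow> real"
  assumes "1 < \<alpha>" and "\<alpha> < 2" and "M > 0"
    and "q_tilde \<alpha> DIM('a) > q_star \<alpha> DIM('a)"
    and "duhamel_solution \<alpha> b M u"
    and "self_similar \<alpha> u"
    and "C > 0"
    and "\<And>x t. t > 0 \<Longrightarrow> 0 \<le> u x t \<and> u x t \<le> C * heat_kernel \<alpha> x t"
  shows "(\<lambda>x. profile u x
            - (M * heat_profile \<alpha> x
               + c1 \<alpha> DIM('a) * \<alpha>\<^sup>2 / (\<alpha> + 1)
                 * Lp_norm (q_tilde \<alpha> DIM('a)) (profile u) powr q_tilde \<alpha> DIM('a)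
                 * ((b \<bullet> x) / norm x powr (\<alpha> + DIM('a) + 2))))
         \<in> O[at_infinity](\<lambda>x. max (norm x powr (- (q_tilde \<alpha> DIM('a) * (\<alpha> + DIM('a)))))
                                  (norm x powr (- (\<alpha> + DIM('a) + 2))))"
    (is "?diff \<in> O[at_infinity](?E)")
proof -
  interpret stable_index "\<alpha> / 2"
    by standard (use assms(1,2) in auto)
  have \<alpha>: "2 * (\<alpha> / 2) = \<alpha>" by simp
  define q where "q = q_tilde \<alpha> DIM('a)"
  have q: "0 < q" using assms(1) by (simp add: q_def q_tilde_def add_pos_nonneg)
  have Lp: "Lp_norm q (profile u) powr q = (LINT y|lborel. profile u y powr q)"
  proof -
    have "(LINT y|lborel. \<bar>profile u y\<bar> powr q) = (LINT y|lborel. profile u y powr q)"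
      using assms(8)[of 1] by (simp add: profile_def)
    moreover have "0 \<le> (LINT y|lborel. profile u y powr q)" by (intro integral_nonneg_AE AE_I2) simp
    ultimately show ?thesis using q by (simp add: Lp_norm_def powr_powr)
  qed
  have "\<exists>K. \<forall>x. 1 \<le> norm x \<longrightarrow> \<bar>?diff x\<bar> \<le> K * ?E x"
  proof (cases "b = 0")
    \<comment> \<open>Without drift the flux carries no information on the measurability of \<open>u\<close>, but then the Duhamel formula
      is the equality of \<open>U\<close> and \<open>M p\<close>.\<close>
    case True
    have "heat_semigroup \<alpha> t (flux \<alpha> b v) = (\<lambda>x. 0)" for t and v :: "'a \<Rightarrow> real"
      by (rule ext) (simp add: heat_semigroup_def flux_def True)
    moreover have "divergence (\<lambda>x::'a. 0) x = 0" for x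
      by (simp add: divergence_def)
    ultimately have "u x 1 = M * heat_kernel \<alpha> x 1" for x
      using assms(5) unfolding duhamel_solution_def by simp
    then have "?diff x = 0" for x
      using True by (simp add: profile_def heat_profile_eq_heat_kernel)
    then show ?thesis by (intro exI[of _ 0]) simp
  next
    case False
    show ?thesis
      using profile_expansion[OF False, unfolded \<alpha>, OF assms(5,6,7,8)]
      unfolding gradient_const_eq_c1 \<alpha> Lp[unfolded q_def] .
  qed
  then obtain K where K: "\<And>x. 1 \<le> norm x \<Longrightarrow> \<bar>?diff x\<bar> \<le> K * ?E x" by blast
  show ?thesis
  proof (rule bigoI)
    have "\<forall>\<^sub>F x in at_infinity. 1 \<le> norm (x :: 'a)"
      unfolding eventually_at_infinity by auto
    then show "\<forall>\<^sub>F x in at_infinity. norm (?diff x) \<le> K * norm (?E x)"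
      by eventually_elim (use K in \<open>simp add: max_def\<close>)
  qed
qed

end
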